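(* Let $X$ be a biquandle of (finite) order $n$ and let $K$ be a virtual knot. Then $$n^{b_2(K)}\geq col_{X}(K),$$ where $b_2(K)$ is the second bridge number of $K$ and $col_X(K)$ is the number of legitimate labelings by $X$ of a diagram of $K$.
   Context: **Virtual knots.** A virtual knot diagram is a generic immersion of an oriented circle in the plane whose double points are either classical crossings (with over/under information) or virtual crossings (no over/under information). A virtual knot is an equivalence class of such diagrams under the generalized Reidemeister moves (the three classical Reidemeister moves, the three purely virtual analogues, and the mixed move passing an arc with only virtual crossings across a classical crossing). **Second bridge number.** Perturb a virtual knot diagram in $\mathbb{R}^2$ so that the standard height function $h:\mathbb{R}^2\to\mathbb{R}$ restricts to the underlying immersed curve as a function with finitely many nondegenerate local maxima and local minima (equal in number), none of them at crossings. The second bridge number $b_2(K)$ is the minimum number of local maxima over all such virtual knot diagrams of $K$. **Biquandle.** A biquandle is a set $X$ with two binary operations $\overline{\triangleright},\underline{\triangleright}$ such that: (i) for all $x\in X$, $x\,\overline{\triangleright}\,x=x\,\underline{\triangleright}\,x$; (ii) for all $y \in X$ the maps $\alpha_y,\beta_y:X\to X$, $\alpha_y(x)=x\,\overline{\triangleright}\,y$, $\beta_y(x)=x\,\underline{\triangleright}\,y$, and the map $S:X\times X\to X\times X$, $S(x,y)=(y\,\overline{\triangleright}\,x,\;x\,\underline{\triangleright}\,y)$, are invertible; (iii) for all $x,y,z\in X$: $(x\,\overline{\triangleright}\,y)\,\overline{\triangleright}\,(z\,\overline{\triangleright}\,y)=(x\,\overline{\triangleright}\,z)\,\overline{\triangleright}\,(y\,\underline{\triangleright}\,z)$,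 $(x\,\underline{\triangleright}\,y)\,\overline{\triangleright}\,(z\,\underline{\triangleright}\,y)=(x\,\overline{\triangleright}\,z)\,\underline{\triangleright}\,(y\,\overline{\triangleright}\,z)$, $(x\,\underline{\triangleright}\,y)\,\underline{\triangleright}\,(z\,\underline{\triangleright}\,y)=(x\,\underline{\triangleright}\,z)\,\underline{\triangleright}\,(y\,\overline{\triangleright}\,z)$. The order of $X$ is its cardinality. **Legitimate labelings.** A short arc of a virtual knot diagram is a segment between two consecutive classical crossings encountered along the knot (virtual crossings do not end a short arc; a diagram with no classical crossings has a single short arc, the whole curve). A labeling of the short arcs by elements of $X$ is legitimate if at every classical crossing the following relation holds. At a positive crossing, if the incoming under-arc is labeled $x$ and the incoming over-arc is labeled $y$, then the outgoing under-arc is labeled $x\,\underline{\triangleright}\,y$ and the outgoing over-arc is labeled $y\,\overline{\triangleright}\,x$. At a negative crossing, if the outgoing under-arc is labeled $x$ and the outgoing over-arc is labeled $y$, then the incoming under-arc is labeled $x\,\underline{\triangleright}\,y$ and the incoming over-arc is labeled $y\,\overline{\triangleright}\,x$. The number of legitimate labelings of a diagram of $K$ by $X$ does not depend on the diagram (a known fact); it is denoted $col_X(K)$.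
   Formalization: With the stated crossing rule the number of labelings can depend on the diagram; the bound is proved for the rule with "incoming" and "outgoing" swapped on the over-arc, and for the stated rule whenever the number is the same for all diagrams of K. *)

theory Defs
  imports "HOL-Analysis.Analysis"
begin

section \<open>Smooth maps and diffeomorphisms of the plane\<close>

text \<open>All iterated directional derivatives exist and are differentiable everywhere; between
  finite-dimensional spaces this is the class of infinitely differentiable maps.\<close>

coinductive smooth :: "('a::real_normed_vector \<Rightarrow> 'b::real_normed_vector) \<Rightarrow> bool" where
  smoothI: "\<lbrakk>\<And>x. (f has_derivative f' x) (at x); \<And>v. smooth (\<lambda>x. f' x v)\<rbrakk> \<Longrightarrow> smooth f"

text \<open>The plane is the type \<^typ>\<open>complex\<close>; \<open>wedge u v\<close> is the determinant with columns
  \<open>u\<close>, \<open>v\<close>.\<close>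

definition wedge :: "complex \<Rightarrow> complex \<Rightarrow> real" where
  "wedge u v = Re u * Im v - Im u * Re v"

definition plane_diffeo :: "(complex \<Rightarrow> complex) \<Rightarrow> bool" where
  "plane_diffeo \<phi> \<longleftrightarrow> bij \<phi> \<and> smooth \<phi> \<and> smooth (inv \<phi>)"

definition oriented_plane_diffeo :: "(complex \<Rightarrow> complex) \<Rightarrow> bool" where
  "oriented_plane_diffeo \<phi> \<longleftrightarrow> plane_diffeo \<phi> \<and>
     (\<forall>z. 0 < wedge (frechet_derivative \<phi> (at z) 1) (frechet_derivative \<phi> (at z) \<i>))"


section \<open>Virtual knot diagrams\<close>

abbreviation circle :: "complex set" where
  "circle \<equiv> sphere 0 1"

text \<open>The circle is oriented counterclockwise. Only the values of a curve on \<^term>\<open>circle\<close> matter.\<close>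

definition velocity :: "(complex \<Rightarrow> complex) \<Rightarrow> complex \<Rightarrow> complex" where
  "velocity c p = vector_derivative (\<lambda>t. c (p * cis t)) (at 0)"

definition double_point :: "(complex \<Rightarrow> complex) \<Rightarrow> complex \<Rightarrow> complex \<Rightarrow> bool" where
  "double_point c p q \<longleftrightarrow> p \<in> circle \<and> q \<in> circle \<and> p \<noteq> q \<and> c p = c q"

definition generic_immersion :: "(complex \<Rightarrow> complex) \<Rightarrow> bool" where
  "generic_immersion c \<longleftrightarrow>
     smooth (\<lambda>t::real. c (cis t)) \<and>
     (\<forall>p\<in>circle. velocity c p \<noteq> 0) \<and>
     finite {(p, q). double_point c p q} \<and>
     (\<forall>p q r. double_point c p q \<and> double_point c p r \<longrightarrow> q = r) \<and>
     (\<forall>p q. double_point c p q \<longrightarrow> wedge (velocity c p) (velocity c q) \<noteq> 0)"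

text \<open>\<open>over_pts\<close> is the set of points of the circle at which the curve runs over another strand.
  A double point is classical if one of its two preimages lies in this set, virtual if none does.\<close>

record vdiagram =
  curve :: "complex \<Rightarrow> complex"
  over_pts :: "complex set"

definition is_diagram :: "vdiagram \<Rightarrow> bool" where
  "is_diagram D \<longleftrightarrow>
     generic_immersion (curve D) \<and>
     over_pts D \<subseteq> {p. \<exists>q. double_point (curve D) p q} \<and>
     (\<forall>p q. double_point (curve D) p q \<longrightarrow> \<not> (p \<in> over_pts D \<and> q \<in> over_pts D))"

definition classical_crossing :: "vdiagram \<Rightarrow> complex \<Rightarrow> complex \<Rightarrow> bool" where
  \<comment> \<open>over strand at \<open>p\<close>, under strand at \<open>q\<close>\<close>
  "classical_crossing D p q \<longleftrightarrow> double_point (curve D) p q \<and> p \<in> over_pts D"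

definition positive :: "vdiagram \<Rightarrow> complex \<Rightarrow> complex \<Rightarrow> bool" where
  \<comment> \<open>the usual sign: the pair (over direction, under direction) is a positively oriented basis\<close>
  "positive D p q \<longleftrightarrow> 0 < wedge (velocity (curve D) p) (velocity (curve D) q)"


section \<open>Generalized Reidemeister moves\<close>

definition planar_isotopic :: "vdiagram \<Rightarrow> vdiagram \<Rightarrow> bool" where
  "planar_isotopic D D' \<longleftrightarrow>
     (\<exists>H :: real \<Rightarrow> complex \<Rightarrow> complex.
        smooth (\<lambda>(s, z). H s z) \<and> (\<forall>s. plane_diffeo (H s)) \<and> H 0 = id \<and>
        (\<forall>p\<in>circle. curve D' p = H 1 (curve D p)) \<and> over_pts D' = over_pts D)"

text \<open>Change of parameter by an orientation preserving diffeomorphism of the circle, given by its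
  lift to the real line.\<close>

definition reparametrized :: "vdiagram \<Rightarrow> vdiagram \<Rightarrow> bool" where
  "reparametrized D D' \<longleftrightarrow>
     (\<exists>f :: real \<Rightarrow> real.
        smooth f \<and> (\<forall>t. 0 < deriv f t) \<and> (\<forall>t. f (t + 2 * pi) = f t + 2 * pi) \<and>
        (\<forall>t. curve D' (cis t) = curve D (cis (f t)) \<and>
             (cis t \<in> over_pts D' \<longleftrightarrow> cis (f t) \<in> over_pts D)))"

text \<open>A pair \<open>I = (a, b)\<close> of angles stands for the arc of the circle from \<open>cis a\<close> to \<open>cis b\<close>.\<close>

definition closed_arc :: "real \<times> real \<Rightarrow> complex set" where
  "closed_arc I = cis ` {fst I..snd I}"

definition open_arc :: "real \<times> real \<Rightarrow> complex set" where
  "open_arc I = cis ` {fst I<..<snd I}"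

text \<open>The diagrams \<open>D\<close> and \<open>D'\<close> coincide outside a disc. The disc is the preimage of the square
  under the chart \<open>\<phi>\<close>, it meets both diagrams in the strands parametrized by the arcs in \<open>\<I>\<close>,
  and no crossing lies on its boundary.\<close>

definition agree_outside ::
    "(complex \<Rightarrow> complex) \<Rightarrow> (real \<times> real) set \<Rightarrow> vdiagram \<Rightarrow> vdiagram \<Rightarrow> bool" where
  "agree_outside \<phi> \<I> D D' \<longleftrightarrow>
     oriented_plane_diffeo \<phi> \<and>
     (\<forall>I\<in>\<I>. fst I < snd I \<and> snd I < fst I + 2 * pi) \<and>
     pairwise (\<lambda>I J. closed_arc I \<inter> closed_arc J = {}) \<I> \<and>
     (\<forall>E\<in>{D, D'}.
        {p \<in> circle. \<phi> (curve E p) \<in> cbox (Complex (-1) (-1)) (Complex 1 1)} = \<Union>(closed_arc ` \<I>) \<and>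
        {p \<in> circle. \<phi> (curve E p) \<in> box (Complex (-1) (-1)) (Complex 1 1)} = \<Union>(open_arc ` \<I>) \<and>
        (\<forall>I\<in>\<I>. \<forall>q. \<not> double_point (curve E) (cis (fst I)) q
                    \<and> \<not> double_point (curve E) (cis (snd I)) q)) \<and>
     (\<forall>p \<in> circle - \<Union>(closed_arc ` \<I>).
        curve D' p = curve D p \<and> (p \<in> over_pts D' \<longleftrightarrow> p \<in> over_pts D))"

definition crossings ::
    "(complex \<Rightarrow> complex) \<Rightarrow> real \<times> real \<Rightarrow> real \<times> real \<Rightarrow> (complex \<times> complex) set" where
  "crossings c I J = {(p, q). p \<in> closed_arc I \<and> q \<in> closed_arc J \<and> double_point c p q}"

text \<open>In the chart \<open>\<phi>\<close>, the strand is a graph over the horizontal axis running across the square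
  between its left and right sides; \<open>\<sigma>\<close> is \<open>1\<close> if it runs to the right and \<open>-1\<close> if to the left.\<close>

definition graph_strand ::
    "(complex \<Rightarrow> complex) \<Rightarrow> (complex \<Rightarrow> complex) \<Rightarrow> real \<times> real \<Rightarrow> bool" where
  "graph_strand \<phi> c I \<longleftrightarrow>
     (\<exists>\<sigma>\<in>{1, -1}.
        Re (\<phi> (c (cis (fst I)))) = - \<sigma> \<and> Re (\<phi> (c (cis (snd I)))) = \<sigma> \<and>
        (\<forall>t\<in>{fst I..snd I}.
           0 < \<sigma> * Re (vector_derivative (\<lambda>u. \<phi> (c (cis u))) (at t)) \<and>
           \<bar>Im (\<phi> (c (cis t)))\<bar> < 1))"

definition strand_over :: "vdiagram \<Rightarrow> real \<times> real \<Rightarrow> real \<times> real \<Rightarrow> bool" where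
  "strand_over D I J \<longleftrightarrow> (\<forall>(p, q) \<in> crossings (curve D) I J. p \<in> over_pts D)"

definition strands_virtual :: "vdiagram \<Rightarrow> real \<times> real \<Rightarrow> real \<times> real \<Rightarrow> bool" where
  "strands_virtual D I J \<longleftrightarrow>
     (\<forall>(p, q) \<in> crossings (curve D) I J. p \<notin> over_pts D \<and> q \<notin> over_pts D)"

text \<open>A strand without crossings is replaced by a strand with exactly one self-crossing, of any type.
  The set \<^const>\<open>crossings\<close> consists of ordered pairs, so a self-crossing contributes two elements.\<close>

definition reidemeister1 :: "vdiagram \<Rightarrow> vdiagram \<Rightarrow> bool" where
  "reidemeister1 D D' \<longleftrightarrow>
     (\<exists>\<phi> I. agree_outside \<phi> {I} D D' \<and>
        crossings (curve D) I I = {} \<and> card (crossings (curve D') I I) = 2)"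

text \<open>Two disjoint strands are replaced by two strands crossing exactly twice; either one strand is
  over at both crossings (classical move) or both crossings are virtual (virtual move).\<close>

definition reidemeister2 :: "vdiagram \<Rightarrow> vdiagram \<Rightarrow> bool" where
  "reidemeister2 D D' \<longleftrightarrow>
     (\<exists>\<phi> I J. I \<noteq> J \<and> agree_outside \<phi> {I, J} D D' \<and>
        (\<forall>E\<in>{D, D'}. \<forall>L\<in>{I, J}. graph_strand \<phi> (curve E) L) \<and>
        crossings (curve D) I J = {} \<and> card (crossings (curve D') I J) = 2 \<and>
        (strand_over D' I J \<or> strands_virtual D' I J))"

text \<open>Three strands, any two of which cross exactly once, before and after the move. As the ends of
  the strands are fixed, up to isotopy of the disc there are just the two triangles interchanged by
  the move. The three alternatives are the classical move (\<open>I\<close> over \<open>J\<close> over \<open>K\<close>), the virtual move,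
  and the mixed move (\<open>I\<close> with only virtual crossings passes the classical crossing of \<open>J\<close>
  and \<open>K\<close>).\<close>

definition reidemeister3 :: "vdiagram \<Rightarrow> vdiagram \<Rightarrow> bool" where
  "reidemeister3 D D' \<longleftrightarrow>
     (\<exists>\<phi> I J K. distinct [I, J, K] \<and> agree_outside \<phi> {I, J, K} D D' \<and>
        (\<forall>E\<in>{D, D'}. (\<forall>L\<in>{I, J, K}. graph_strand \<phi> (curve E) L) \<and>
           card (crossings (curve E) I J) = 1 \<and>
           card (crossings (curve E) I K) = 1 \<and>
           card (crossings (curve E) J K) = 1) \<and>
        ((\<forall>E\<in>{D, D'}. strand_over E I J \<and> strand_over E I K \<and> strand_over E J K) \<or>
         (\<forall>E\<in>{D, D'}. strands_virtual E I J \<and> strands_virtual E I K \<and> strands_virtual E J K) \<or>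
         (\<forall>E\<in>{D, D'}. strands_virtual E I J \<and> strands_virtual E I K \<and> strand_over E J K)))"

definition move :: "vdiagram \<Rightarrow> vdiagram \<Rightarrow> bool" where
  "move D D' \<longleftrightarrow> is_diagram D \<and> is_diagram D' \<and>
     (planar_isotopic D D' \<or> reparametrized D D' \<or>
      reidemeister1 D D' \<or> reidemeister2 D D' \<or> reidemeister3 D D')"

definition virtual_knots :: "vdiagram set set" where
  "virtual_knots =
     {D. is_diagram D} // {(D, D'). is_diagram D \<and> is_diagram D' \<and> equivclp move D D'}"


section \<open>The second bridge number\<close>

definition height :: "vdiagram \<Rightarrow> complex \<Rightarrow> real \<Rightarrow> real" where
  \<comment> \<open>height along the curve, in the angular coordinate centred at \<open>p\<close>\<close>
  "height D p t = Im (curve D (p * cis t))"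

definition local_maxima :: "vdiagram \<Rightarrow> complex set" where
  "local_maxima D = {p \<in> circle. eventually (\<lambda>t. height D p t \<le> height D p 0) (at 0)}"

definition local_minima :: "vdiagram \<Rightarrow> complex set" where
  "local_minima D = {p \<in> circle. eventually (\<lambda>t. height D p t \<ge> height D p 0) (at 0)}"

text \<open>That maxima and minima are then equal in number is automatic.\<close>

definition morse_position :: "vdiagram \<Rightarrow> bool" where
  "morse_position D \<longleftrightarrow>
     finite (local_maxima D) \<and> finite (local_minima D) \<and>
     (\<forall>p \<in> local_maxima D \<union> local_minima D.
        deriv (deriv (height D p)) 0 \<noteq> 0 \<and> (\<forall>q. \<not> double_point (curve D) p q))"

definition b2 :: "vdiagram set \<Rightarrow> nat" where
  "b2 K = (LEAST m. \<exists>D\<in>K. morse_position D \<and> card (local_maxima D) = m)"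


section \<open>Biquandles and labelings\<close>

text \<open>\<open>ov x y\<close> and \<open>un x y\<close> are the operations written with overlined and underlined triangles.\<close>

locale biquandle =
  fixes X :: "'x set" and ov un :: "'x \<Rightarrow> 'x \<Rightarrow> 'x"
  assumes diagonal: "x \<in> X \<Longrightarrow> ov x x = un x x"
    and bij_ov: "y \<in> X \<Longrightarrow> bij_betw (\<lambda>x. ov x y) X X"
    and bij_un: "y \<in> X \<Longrightarrow> bij_betw (\<lambda>x. un x y) X X"
    and bij_S: "bij_betw (\<lambda>(x, y). (ov y x, un x y)) (X \<times> X) (X \<times> X)"
    and exchange1: "\<lbrakk>x \<in> X; y \<in> X; z \<in> X\<rbrakk> \<Longrightarrow> ov (ov x y) (ov z y) = ov (ov x z) (un y z)"
    and exchange2: "\<lbrakk>x \<in> X; y \<in> X; z \<in> X\<rbrakk> \<Longrightarrow> ov (un x y) (un z y) = un (ov x z) (ov y z)"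
    and exchange3: "\<lbrakk>x \<in> X; y \<in> X; z \<in> X\<rbrakk> \<Longrightarrow> un (un x y) (un z y) = un (un x z) (ov y z)"

definition short_arcs :: "vdiagram \<Rightarrow> complex set set" where
  "short_arcs D =
     components (circle - {p. \<exists>q. classical_crossing D p q \<or> classical_crossing D q p})"

definition arc_in :: "vdiagram \<Rightarrow> complex \<Rightarrow> complex set" where
  "arc_in D p = (THE A. A \<in> short_arcs D \<and> eventually (\<lambda>t. p * cis t \<in> A) (at_left 0))"

definition arc_out :: "vdiagram \<Rightarrow> complex \<Rightarrow> complex set" where
  "arc_out D p = (THE A. A \<in> short_arcs D \<and> eventually (\<lambda>t. p * cis t \<in> A) (at_right 0))"

text \<open>Two readings of the crossing relation. In the first one the operations take as arguments the
  labels of the incoming under-arc and the outgoing over-arc at a positive crossing, and dually at a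
  negative one; these two arcs lie on the same side of the crossing, and the biquandle
  axioms express that the number of labelings is invariant under the moves.\<close>

definition labelings ::
    "'x set \<Rightarrow> ('x \<Rightarrow> 'x \<Rightarrow> 'x) \<Rightarrow> ('x \<Rightarrow> 'x \<Rightarrow> 'x) \<Rightarrow> vdiagram \<Rightarrow> (complex set \<Rightarrow> 'x) set" where
  "labelings X ov un D =
     {L \<in> short_arcs D \<rightarrow>\<^sub>E X. \<forall>p q. classical_crossing D p q \<longrightarrow>
        (if positive D p q
         then L (arc_out D q) = un (L (arc_in D q)) (L (arc_out D p)) \<and>
              L (arc_in D p) = ov (L (arc_out D p)) (L (arc_in D q))
         else L (arc_in D q) = un (L (arc_out D q)) (L (arc_in D p)) \<and>
              L (arc_out D p) = ov (L (arc_in D p)) (L (arc_out D q)))}"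

text \<open>In the second one the arguments are the labels of the two incoming arcs at a positive crossing
  and of the two outgoing arcs at a negative one. For quandles (\<open>ov x y = x\<close>) the two agree, but in
  general this count is not invariant: let \<open>X\<close> have three elements and put
  \<open>ov x y = un x y = \<pi> x\<close> for a 3-cycle \<open>\<pi>\<close>; then the unknot diagram with one positive
  kink has no labelings, whereas the round circle has three.\<close>

definition labelings_both_in ::
    "'x set \<Rightarrow> ('x \<Rightarrow> 'x \<Rightarrow> 'x) \<Rightarrow> ('x \<Rightarrow> 'x \<Rightarrow> 'x) \<Rightarrow> vdiagram \<Rightarrow> (complex set \<Rightarrow> 'x) set" where
  "labelings_both_in X ov un D =
     {L \<in> short_arcs D \<rightarrow>\<^sub>E X. \<forall>p q. classical_crossing D p q \<longrightarrow>
        (if positive D p q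
         then L (arc_out D q) = un (L (arc_in D q)) (L (arc_in D p)) \<and>
              L (arc_out D p) = ov (L (arc_in D p)) (L (arc_in D q))
         else L (arc_in D q) = un (L (arc_out D q)) (L (arc_out D p)) \<and>
              L (arc_in D p) = ov (L (arc_out D p)) (L (arc_out D q)))}"

end

theory Submission
  imports Defs
begin

text \<open>
  The bound splits into a statement about one diagram and an invariance statement.

  One diagram. Let \<open>D\<close> be in Morse position. A labeling of \<open>D\<close> is determined by the labels at the
  local maxima of the height (\<open>colorings_eqI_local_maxima\<close>), so there are at most
  \<open>card X ^ card (local_maxima D)\<close> of them (\<open>card_colorings_le\<close>). Indeed, suppose that two labelings
  agree at the maxima, and look at a highest point \<open>p\<close> of the closure of the set where they differ.
  No double point is a local maximum, so each of the two strands through a crossing at the height of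
  \<open>p\<close> has higher points arbitrarily close to the crossing on at least one side, and there the labelings
  agree. By the invertibility axioms one end
  of the over strand and one end of the under strand determine the two other ends
  (\<open>corner_determined\<close>), whichever ends they are and in both readings of the crossing relation.
  Hence the labelings agree around \<open>p\<close> after all.

  Existence of such a diagram. The number \<open>b2 K\<close> is attained because every class contains a diagram
  in Morse position (\<open>morse_position_exists\<close>): a shear of the plane, which is isotopic to the
  identity, makes the height generic by Sard's theorem in dimension one.

  Invariance. For the first reading the number of labelings is the same for all diagrams of \<open>K\<close>
  (\<open>card_colorings_equivalent\<close>), so the bound for one diagram suffices; for the second reading the
  theorem assumes it. It is convenient to replace labelings of short arcs by
  \<^emph>\<open>colorings\<close>, which are right-continuous step functions on the circle
  (\<open>card_labelings_by_eq\<close>). They only depend on the classical crossings and their signs, which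
  settles planar isotopies and changes of parameter. For a move inside a disc, colorings can be cut
  and glued along the boundary of the disc (\<open>card_colorings_tangle\<close>). It remains to see that
  the strands inside the disc before and after the move admit the same labels at their ends, and that
  these determine the labels in between. For the first two moves this is \<open>kink_over_first\<close>,
  \<open>kink_under_first\<close> and \<open>crossing_rel_cancel\<close>. For the third move, the labels of the two triangles
  fit together on the edges of a cube, whose faces are the crossings and which exists by the exchange
  laws; the two triangles are the three faces at two opposite corners (\<open>triangle_flip\<close>).

  The geometric input for the last two moves is obtained by writing the strands as graphs of
  functions (\<open>strand_chart\<close>): the sign of a crossing is determined by the directions of the strands and
  by the sign of the derivative of the difference of the two functions, and the
  intermediate value theorem relates that sign to the vertical order of the ends.
\<close>

section \<open>Crossing relations\<close>

text \<open>A crossing rule relates the sign of a crossing (\<^const>\<open>True\<close> for positive) and the labels of the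
  incoming under-arc, the outgoing under-arc, the incoming over-arc and the outgoing over-arc, in this
  order. The two readings of the labeling condition are two such rules.\<close>

type_synonym 'x crossing_rule = "bool \<Rightarrow> 'x \<Rightarrow> 'x \<Rightarrow> 'x \<Rightarrow> 'x \<Rightarrow> bool"

definition crossing_rel ::
    "('x \<Rightarrow> 'x \<Rightarrow> 'x) \<Rightarrow> ('x \<Rightarrow> 'x \<Rightarrow> 'x) \<Rightarrow> 'x crossing_rule" where
  "crossing_rel ov un pos ui uo oi ot \<longleftrightarrow>
     (if pos then uo = un ui ot \<and> oi = ov ot ui else ui = un uo oi \<and> ot = ov oi uo)"

definition crossing_rel_both_in ::
    "('x \<Rightarrow> 'x \<Rightarrow> 'x) \<Rightarrow> ('x \<Rightarrow> 'x \<Rightarrow> 'x) \<Rightarrow> 'x crossing_rule" where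
  "crossing_rel_both_in ov un pos ui uo oi ot \<longleftrightarrow>
     (if pos then uo = un ui oi \<and> ot = ov oi ui else ui = un uo ot \<and> oi = ov ot uo)"

text \<open>One end of the under strand and one end of the over strand determine the labels of the two
  other ends.\<close>

definition corner_determined :: "'x set \<Rightarrow> 'x crossing_rule \<Rightarrow> bool" where
  "corner_determined X R \<longleftrightarrow>
     (\<forall>pos. \<forall>a\<in>X. \<forall>b\<in>X. \<forall>c\<in>X. \<forall>d\<in>X. \<forall>a'\<in>X. \<forall>b'\<in>X. \<forall>c'\<in>X. \<forall>d'\<in>X.
        R pos a b c d \<longrightarrow> R pos a' b' c' d' \<longrightarrow> a = a' \<or> b = b' \<longrightarrow> c = c' \<or> d = d' \<longrightarrow>
        a = a' \<and> b = b' \<and> c = c' \<and> d = d')"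

text \<open>The invertibility axioms of a biquandle. They also hold for the trivial operations, by which
  virtual crossings are treated on the same footing as classical ones.\<close>

definition switch_ops :: "'x set \<Rightarrow> ('x \<Rightarrow> 'x \<Rightarrow> 'x) \<Rightarrow> ('x \<Rightarrow> 'x \<Rightarrow> 'x) \<Rightarrow> bool" where
  "switch_ops X ov un \<longleftrightarrow>
     (\<forall>y\<in>X. bij_betw (\<lambda>x. ov x y) X X) \<and> (\<forall>y\<in>X. bij_betw (\<lambda>x. un x y) X X) \<and>
     bij_betw (\<lambda>(x, y). (ov y x, un x y)) (X \<times> X) (X \<times> X)"

lemma (in biquandle) switch_ops_biquandle: "switch_ops X ov un"
  unfolding switch_ops_def using bij_ov bij_un bij_S by blast

lemma switch_ops_trivial: "switch_ops X (\<lambda>x y. x) (\<lambda>x y. x)"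
proof -
  have "bij_betw (\<lambda>(x, y). (y, x)) (X \<times> X) (X \<times> X)"
    by (rule bij_betw_byWitness[where f'="\<lambda>(x, y). (y, x)"]) auto
  then show ?thesis
    unfolding switch_ops_def by (auto simp: bij_betw_def)
qed

lemma switch_ops_closed:
  assumes "switch_ops X ov un" "x \<in> X" "y \<in> X"
  shows "ov x y \<in> X" "un x y \<in> X"
  using assms unfolding switch_ops_def by (auto dest!: bspec[of X] simp: bij_betw_def)

lemma switch_ops_inj:
  assumes "switch_ops X ov un" "x \<in> X" "y \<in> X" "x' \<in> X" "y' \<in> X"
  shows "ov x y = ov x' y \<Longrightarrow> x = x'" "un x y = un x' y \<Longrightarrow> x = x'"
    "ov y x = ov y' x' \<Longrightarrow> un x y = un x' y' \<Longrightarrow> x = x' \<and> y = y'"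
proof -
  show "ov x y = ov x' y \<Longrightarrow> x = x'" "un x y = un x' y \<Longrightarrow> x = x'"
    using assms unfolding switch_ops_def bij_betw_def inj_on_def by blast+
  assume "ov y x = ov y' x'" "un x y = un x' y'"
  moreover have "inj_on (\<lambda>(x, y). (ov y x, un x y)) (X \<times> X)"
    using assms unfolding switch_ops_def bij_betw_def by blast
  ultimately show "x = x' \<and> y = y'"
    using inj_onD[of "\<lambda>(x, y). (ov y x, un x y)" "X \<times> X" "(x, y)" "(x', y')"] assms by auto
qed

lemma switch_ops_surj:
  assumes "switch_ops X ov un" "z \<in> X" "y \<in> X"
  shows "\<exists>x\<in>X. ov x y = z" "\<exists>x\<in>X. un x y = z" "\<exists>x\<in>X. \<exists>w\<in>X. ov w x = z \<and> un x w = y"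
proof -
  have "(\<lambda>x. ov x y) ` X = X" "(\<lambda>x. un x y) ` X = X"
    "(\<lambda>(x, y). (ov y x, un x y)) ` (X \<times> X) = X \<times> X"
    using assms unfolding switch_ops_def bij_betw_def by blast+
  moreover have "(z, y) \<in> X \<times> X"
    using assms by blast
  ultimately have *: "z \<in> (\<lambda>x. ov x y) ` X" "z \<in> (\<lambda>x. un x y) ` X"
    "(z, y) \<in> (\<lambda>(x, y). (ov y x, un x y)) ` (X \<times> X)"
    using assms by simp_all
  show "\<exists>x\<in>X. ov x y = z"
    using *(1) by blast
  show "\<exists>x\<in>X. un x y = z"
    using *(2) by blast
  show "\<exists>x\<in>X. \<exists>w\<in>X. ov w x = z \<and> un x w = y"
    using *(3) by clarsimp blast
qed

lemma switch_ops_corner: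
  assumes ops: "switch_ops X ov un" and X: "x \<in> X" "y \<in> X" "x' \<in> X" "y' \<in> X"
    and eq: "x = x' \<or> un x y = un x' y'" "y = y' \<or> ov y x = ov y' x'"
  shows "x = x' \<and> y = y'"
proof -
  note inj = switch_ops_inj[OF ops]
  show ?thesis
    using eq
  proof (elim disjE)
    assume "x = x'" "ov y x = ov y' x'"
    then show ?thesis using inj(1)[of y x y' x'] X by simp
  next
    assume "un x y = un x' y'" "y = y'"
    then show ?thesis using inj(2)[of x y x' y'] X by simp
  next
    assume "un x y = un x' y'" "ov y x = ov y' x'"
    then show ?thesis using inj(3)[of x y x' y'] X by simp
  qed simp
qed

lemma crossing_rel_corner_determined:
  assumes "switch_ops X ov un"
  shows "corner_determined X (crossing_rel ov un)"
  unfolding corner_determined_def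
proof (intro allI ballI impI)
  fix pos a b c d a' b' c' d'
  assume X: "a \<in> X" "b \<in> X" "c \<in> X" "d \<in> X" "a' \<in> X" "b' \<in> X" "c' \<in> X" "d' \<in> X"
    and R: "crossing_rel ov un pos a b c d" "crossing_rel ov un pos a' b' c' d'"
    and eq: "a = a' \<or> b = b'" "c = c' \<or> d = d'"
  show "a = a' \<and> b = b' \<and> c = c' \<and> d = d'"
  proof (cases pos)
    case True
    have "a = a' \<and> d = d'"
      by (rule switch_ops_corner[OF assms X(1,4,5,8)]) (use R eq True in \<open>auto simp: crossing_rel_def\<close>)
    then show ?thesis using R True by (simp add: crossing_rel_def)
  next
    case False
    have "b = b' \<and> c = c'"
      by (rule switch_ops_corner[OF assms X(2,3,6,7)]) (use R eq False in \<open>auto simp: crossing_rel_def\<close>)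
    then show ?thesis using R False by (simp add: crossing_rel_def)
  qed
qed

lemma crossing_rel_both_in_corner_determined:
  assumes "switch_ops X ov un"
  shows "corner_determined X (crossing_rel_both_in ov un)"
  unfolding corner_determined_def
proof (intro allI ballI impI)
  fix pos a b c d a' b' c' d'
  assume X: "a \<in> X" "b \<in> X" "c \<in> X" "d \<in> X" "a' \<in> X" "b' \<in> X" "c' \<in> X" "d' \<in> X"
    and R: "crossing_rel_both_in ov un pos a b c d" "crossing_rel_both_in ov un pos a' b' c' d'"
    and eq: "a = a' \<or> b = b'" "c = c' \<or> d = d'"
  show "a = a' \<and> b = b' \<and> c = c' \<and> d = d'"
  proof (cases pos)
    case True
    have "a = a' \<and> c = c'"
      by (rule switch_ops_corner[OF assms X(1,3,5,7)]) (use R eq True in \<open>auto simp: crossing_rel_both_in_def\<close>)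
    then show ?thesis using R True by (simp add: crossing_rel_both_in_def)
  next
    case False
    have "b = b' \<and> d = d'"
      by (rule switch_ops_corner[OF assms X(2,4,6,8)]) (use R eq False in \<open>auto simp: crossing_rel_both_in_def\<close>)
    then show ?thesis using R False by (simp add: crossing_rel_both_in_def)
  qed
qed

text \<open>The relation \<^const>\<open>crossing_rel\<close> without orientations: \<open>a True\<close> and \<open>a False\<close> are the labels of the over
  strand to the right and to the left of the under strand, and \<open>b True\<close> and \<open>b False\<close> those of the
  under strand to the right and to the left of the over strand.\<close>

definition face ::
    "'x set \<Rightarrow> ('x \<Rightarrow> 'x \<Rightarrow> 'x) \<Rightarrow> ('x \<Rightarrow> 'x \<Rightarrow> 'x) \<Rightarrow> (bool \<Rightarrow> 'x) \<Rightarrow> (bool \<Rightarrow> 'x) \<Rightarrow> bool" where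
  "face X ov un a b \<longleftrightarrow> range a \<subseteq> X \<and> range b \<subseteq> X \<and>
     a False = ov (a True) (b True) \<and> b False = un (b True) (a True)"

lemma faceD: "face X ov un a b \<Longrightarrow> a r \<in> X \<and> b r \<in> X"
  unfolding face_def by blast

lemma bool_fun_eqI:
  fixes f g :: "bool \<Rightarrow> 'x"
  assumes "f r = g r" "f (\<not> r) = g (\<not> r)"
  shows "f = g"
proof
  fix s show "f s = g s"
    using assms by (cases "s = r") auto
qed

lemma face_if_mem:
  assumes "face X ov un (\<lambda>s. if s = p then a else a') (\<lambda>s. if s = q then b else b')"
  shows "a \<in> X" "a' \<in> X" "b \<in> X" "b' \<in> X"
  using faceD[OF assms, of p] faceD[OF assms, of "\<not> p"] faceD[OF assms, of q] faceD[OF assms, of "\<not> q"]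
  by auto

lemma face_unique:
  assumes ops: "switch_ops X ov un" and f: "face X ov un a b" "face X ov un a' b'"
    and eq: "a r = a' r" "b s = b' s"
  shows "a = a' \<and> b = b'"
proof -
  have mem: "a t \<in> X" "b t \<in> X" "a' t \<in> X" "b' t \<in> X" for t
    using f faceD by metis+
  have "b True = b' True \<and> a True = a' True"
    by (rule switch_ops_corner[OF ops]) (use eq f mem in \<open>cases r; cases s; simp add: face_def\<close>)+
  then show ?thesis
    using f unfolding face_def by (auto intro!: bool_fun_eqI[where r=True])
qed

lemma face_exists:
  assumes ops: "switch_ops X ov un" and "x \<in> X" "y \<in> X"
  shows "\<exists>a b. face X ov un a b \<and> a r = x \<and> b s = y"
proof -
  have mk: "face X ov un (\<lambda>t. if t then u else ov u v) (\<lambda>t. if t then v else un v u)"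
    if "u \<in> X" "v \<in> X" for u v
    using that switch_ops_closed[OF ops] unfolding face_def by auto
  have "\<exists>u\<in>X. \<exists>v\<in>X. (if r then u else ov u v) = x \<and> (if s then v else un v u) = y"
  proof (cases r)
    case True
    then show ?thesis using switch_ops_surj(2)[OF ops assms(3,2)] assms(2,3) by (cases s) auto
  next
    case False
    then show ?thesis
      using switch_ops_surj(1)[OF ops assms(2,3)] switch_ops_surj(3)[OF ops assms(2,3)] assms(2,3)
      by (cases s) auto
  qed
  then show ?thesis
    using mk by blast
qed

text \<open>At a positive crossing the over strand passes from the left to the right of the under strand,
  and the under strand from the right to the left of the over strand; at a negative crossing it is
  the other way round.\<close>

lemma crossing_rel_face_iff:
  assumes "ui \<in> X" "uo \<in> X" "oi \<in> X" "ot \<in> X"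
  shows "crossing_rel ov un pos ui uo oi ot \<longleftrightarrow>
    face X ov un (\<lambda>s. if s = pos then ot else oi) (\<lambda>s. if s = pos then ui else uo)"
  using assms unfolding crossing_rel_def face_def by (auto split: if_splits)

lemma crossing_rel_flip:
  "crossing_rel ov un (\<not> pos) ui uo oi ot \<longleftrightarrow> crossing_rel ov un pos uo ui ot oi"
  unfolding crossing_rel_def by auto

lemma crossing_rel_exists:
  assumes ops: "switch_ops X ov un" and X: "x \<in> X" "y \<in> X"
  shows "\<exists>u\<in>X. \<exists>v\<in>X. crossing_rel ov un pos x u y v"
    "\<exists>u\<in>X. \<exists>v\<in>X. crossing_rel ov un pos u x y v"
proof -
  obtain a b where f: "face X ov un a b" "a (\<not> pos) = y" "b pos = x"
    using face_exists[OF ops X(2,1)] by blast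
  have "crossing_rel ov un pos x (b (\<not> pos)) y (a pos)"
    using f by (cases pos) (simp_all add: crossing_rel_def face_def)
  then show "\<exists>u\<in>X. \<exists>v\<in>X. crossing_rel ov un pos x u y v"
    using faceD[OF f(1)] by blast
next
  obtain a b where f: "face X ov un a b" "a (\<not> pos) = y" "b (\<not> pos) = x"
    using face_exists[OF ops X(2,1)] by blast
  have "crossing_rel ov un pos (b pos) x y (a pos)"
    using f by (cases pos) (simp_all add: crossing_rel_def face_def)
  then show "\<exists>u\<in>X. \<exists>v\<in>X. crossing_rel ov un pos u x y v"
    using faceD[OF f(1)] by blast
qed

lemma (in biquandle) diagonal_surj:
  assumes "finite X" "y \<in> X"
  shows "\<exists>x\<in>X. ov x x = y"
proof -
  have "inj_on (\<lambda>x. ov x x) X"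
  proof (rule inj_onI)
    fix x z assume "x \<in> X" "z \<in> X" "ov x x = ov z z"
    then show "x = z"
      using switch_ops_inj(3)[OF switch_ops_biquandle, of x x z z] diagonal by simp
  qed
  moreover have "(\<lambda>x. ov x x) ` X \<subseteq> X"
    using switch_ops_closed[OF switch_ops_biquandle] by blast
  ultimately have "(\<lambda>x. ov x x) ` X = X"
    using assms(1) by (intro endo_inj_surj)
  then have "y \<in> (\<lambda>x. ov x x) ` X"
    using assms(2) by simp
  then show ?thesis
    by blast
qed

text \<open>The map \<open>S\<close> takes the diagonal onto the diagonal, so only diagonal pairs are sent to it.\<close>

lemma (in biquandle) diagonal_unique:
  assumes "finite X" "x \<in> X" "y \<in> X" "ov y x = un x y"
  shows "x = y"
proof -
  obtain z where z: "z \<in> X" "ov z z = ov y x"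
    using diagonal_surj[OF assms(1) switch_ops_closed(1)[OF switch_ops_biquandle assms(3,2)]] by blast
  have "ov y x = ov z z" "un x y = un z z"
    using z diagonal[OF z(1)] assms(4) by simp_all
  then have "x = z \<and> y = z"
    by (rule switch_ops_inj(3)[OF switch_ops_biquandle assms(2,3) z(1,1)])
  then show ?thesis by simp
qed

text \<open>The labels \<open>a\<close>, \<open>b\<close>, \<open>c\<close> along a strand with one self-crossing that runs over first: the ends carry
  the same label, and this label determines the one of the loop.\<close>

lemma (in biquandle) kink_over_first:
  assumes fin: "finite X" and X: "a \<in> X"
  shows "\<exists>!b. b \<in> X \<and> crossing_rel ov un pos b a a b"
    "\<lbrakk>b \<in> X; c \<in> X; crossing_rel ov un pos b c a b\<rbrakk> \<Longrightarrow> a = c"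
proof -
  show "\<exists>!b. b \<in> X \<and> crossing_rel ov un pos b a a b"
  proof (cases pos)
    case True
    obtain b where b: "b \<in> X" "ov b b = a"
      using diagonal_surj[OF fin X] by blast
    show ?thesis
    proof (rule ex1I)
      show "b \<in> X \<and> crossing_rel ov un pos b a a b"
        using b True diagonal by (simp add: crossing_rel_def)
    next
      fix b' assume b': "b' \<in> X \<and> crossing_rel ov un pos b' a a b'"
      then show "b' = b"
        using switch_ops_inj(3)[OF switch_ops_biquandle, of b' b' b b] b diagonal True
        by (simp add: crossing_rel_def)
    qed
  next
    case False
    then show ?thesis
      using switch_ops_closed[OF switch_ops_biquandle] X diagonal by (auto simp: crossing_rel_def)
  qed
  show "a = c" if "b \<in> X" "c \<in> X" "crossing_rel ov un pos b c a b"
    using that(3) diagonal[OF that(1)] diagonal_unique[OF fin that(2) X]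
    by (auto simp: crossing_rel_def split: if_splits)
qed

lemma (in biquandle) kink_under_first:
  assumes fin: "finite X" and X: "a \<in> X"
  shows "\<exists>!b. b \<in> X \<and> crossing_rel ov un pos a b b a"
    "\<lbrakk>b \<in> X; c \<in> X; crossing_rel ov un pos a b b c\<rbrakk> \<Longrightarrow> a = c"
proof -
  have flip: "crossing_rel ov un pos a b b c = crossing_rel ov un (\<not> pos) b a c b" for b c
    unfolding crossing_rel_flip ..
  show "\<exists>!b. b \<in> X \<and> crossing_rel ov un pos a b b a"
    unfolding flip by (rule kink_over_first[OF fin X])
  show "a = c" if "b \<in> X" "c \<in> X" "crossing_rel ov un pos a b b c"
    using kink_over_first(2)[OF fin that(2,1) X, symmetric] that(3) unfolding flip by simp
qed

section \<open>The cube of a triple crossing\<close>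

text \<open>Three strands, the first over the second over the third, where each pair has operations of its
  own, trivial ones for virtual crossings (first and second: \<open>o1\<close>, \<open>u1\<close>; first and third: \<open>o2\<close>, \<open>u2\<close>; second and third: \<open>o3\<close>, \<open>u3\<close>). The
  assumptions are the exchange laws, read off from the two ways in which a strand can pass
  from the right to the left of both others.\<close>

locale yang_baxter =
  fixes X :: "'x set" and o1 u1 o2 u2 o3 u3 :: "'x \<Rightarrow> 'x \<Rightarrow> 'x"
  assumes ops1: "switch_ops X o1 u1" and ops2: "switch_ops X o2 u2" and ops3: "switch_ops X o3 u3"
    and yb1: "\<lbrakk>x \<in> X; y \<in> X; z \<in> X\<rbrakk> \<Longrightarrow> o2 (o1 x y) (u3 z y) = o1 (o2 x z) (o3 y z)"
    and yb2: "\<lbrakk>x \<in> X; y \<in> X; z \<in> X\<rbrakk> \<Longrightarrow> o3 (u1 y x) (u2 z x) = u1 (o3 y z) (o2 x z)"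
    and yb3: "\<lbrakk>x \<in> X; y \<in> X; z \<in> X\<rbrakk> \<Longrightarrow> u3 (u2 z x) (u1 y x) = u2 (u3 z y) (o1 x y)"
begin

text \<open>A segment of a strand is specified by its sides with respect to the two other strands
  (\<^const>\<open>True\<close> for right): \<open>i\<close> labels the first strand, by its sides of the second and the third; \<open>j\<close> the
  second, by its sides of the first and the third; \<open>k\<close> the third, by its sides of the first and the
  second. So the labels sit on the twelve edges of a cube, and each face is a crossing of two strands
  on a given side of the third one.\<close>

definition cube :: "(bool \<Rightarrow> bool \<Rightarrow> 'x) \<Rightarrow> (bool \<Rightarrow> bool \<Rightarrow> 'x) \<Rightarrow> (bool \<Rightarrow> bool \<Rightarrow> 'x) \<Rightarrow> bool" where
  "cube i j k \<longleftrightarrow>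
     (\<forall>s. face X o1 u1 (\<lambda>t. i t s) (\<lambda>r. j r s)) \<and>
     (\<forall>t. face X o2 u2 (\<lambda>s. i t s) (\<lambda>r. k r t)) \<and>
     (\<forall>r. face X o3 u3 (\<lambda>s. j r s) (\<lambda>t. k r t))"

text \<open>The three labels at the corner on the side \<open>r\<close> of the first, \<open>t\<close> of the second and \<open>s\<close> of the
  third strand can be prescribed.\<close>

definition corner_extends :: "bool \<Rightarrow> bool \<Rightarrow> bool \<Rightarrow> bool" where
  "corner_extends r t s \<longleftrightarrow>
     (\<forall>x\<in>X. \<forall>y\<in>X. \<forall>z\<in>X. \<exists>i j k. cube i j k \<and> i t s = x \<and> j r s = y \<and> k r t = z)"

lemma corner_extends_True: "corner_extends True True True"
  unfolding corner_extends_def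
proof (intro ballI)
  fix x y z assume X: "x \<in> X" "y \<in> X" "z \<in> X"
  note cl = switch_ops_closed[OF ops1] switch_ops_closed[OF ops2] switch_ops_closed[OF ops3]
  \<comment> \<open>each edge is computed from the corner on the right side of all strands;
    where a face gives a second value, an exchange law identifies the two\<close>
  define i where "i t s = (if t then (if s then x else o2 x z)
    else if s then o1 x y else o1 (o2 x z) (o3 y z))" for t s
  define j where "j r s = (if r then (if s then y else o3 y z)
    else if s then u1 y x else u1 (o3 y z) (o2 x z))" for r s
  define k where "k r t = (if r then (if t then z else u3 z y)
    else if t then u2 z x else u2 (u3 z y) (o1 x y))" for r t
  have "cube i j k"
    unfolding cube_def face_def i_def j_def k_def
    using X cl yb1 yb2 yb3 by (auto simp: all_bool_eq)
  moreover have "i True True = x" "j True True = y" "k True True = z"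
    by (simp_all add: i_def j_def k_def)
  ultimately show "\<exists>i j k. cube i j k \<and> i True True = x \<and> j True True = y \<and> k True True = z"
    by blast
qed

lemma corner_extends_flip:
  assumes "corner_extends r t s"
  shows "corner_extends (\<not> r) t s" "corner_extends r (\<not> t) s" "corner_extends r t (\<not> s)"
proof -
  show "corner_extends (\<not> r) t s"
    unfolding corner_extends_def
  proof (intro ballI)
    fix x y z assume X: "x \<in> X" "y \<in> X" "z \<in> X"
    obtain a b where f1: "face X o1 u1 a b" "a t = x" "b (\<not> r) = y"
      using face_exists[OF ops1 X(1,2)] by blast
    obtain c d where f2: "face X o2 u2 c d" "c s = x" "d (\<not> r) = z"
      using face_exists[OF ops2 X(1,3)] by blast
    have "b r \<in> X" "d r \<in> X" using f1 f2 faceD by metis+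
    then obtain i j k where c: "cube i j k" "i t s = x" "j r s = b r" "k r t = d r"
      using assms X unfolding corner_extends_def by blast
    have "(\<lambda>r. j r s) = b"
      using face_unique[OF ops1 _ f1(1), of "\<lambda>t. i t s" "\<lambda>r. j r s" t r] c f1 unfolding cube_def by simp
    moreover have "(\<lambda>r. k r t) = d"
      using face_unique[OF ops2 _ f2(1), of "\<lambda>s. i t s" "\<lambda>r. k r t" s r] c f2 unfolding cube_def by simp
    ultimately have "j (\<not> r) s = y" "k (\<not> r) t = z"
      using f1(3) f2(3) by (metis)+
    then show "\<exists>i j k. cube i j k \<and> i t s = x \<and> j (\<not> r) s = y \<and> k (\<not> r) t = z"
      using c by blast
  qed
  show "corner_extends r (\<not> t) s"
    unfolding corner_extends_def
  proof (intro ballI)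
    fix x y z assume X: "x \<in> X" "y \<in> X" "z \<in> X"
    obtain a b where f1: "face X o1 u1 a b" "a (\<not> t) = x" "b r = y"
      using face_exists[OF ops1 X(1,2)] by blast
    obtain c d where f2: "face X o3 u3 c d" "c s = y" "d (\<not> t) = z"
      using face_exists[OF ops3 X(2,3)] by blast
    have "a t \<in> X" "d t \<in> X" using f1 f2 faceD by metis+
    then obtain i j k where c: "cube i j k" "i t s = a t" "j r s = y" "k r t = d t"
      using assms X unfolding corner_extends_def by blast
    have "(\<lambda>t. i t s) = a"
      using face_unique[OF ops1 _ f1(1), of "\<lambda>t. i t s" "\<lambda>r. j r s" t r] c f1 unfolding cube_def by simp
    moreover have "(\<lambda>t. k r t) = d"
      using face_unique[OF ops3 _ f2(1), of "\<lambda>s. j r s" "\<lambda>t. k r t" s t] c f2 unfolding cube_def by simp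
    ultimately have "i (\<not> t) s = x" "k r (\<not> t) = z"
      using f1(2) f2(3) by (metis)+
    then show "\<exists>i j k. cube i j k \<and> i (\<not> t) s = x \<and> j r s = y \<and> k r (\<not> t) = z"
      using c by blast
  qed
  show "corner_extends r t (\<not> s)"
    unfolding corner_extends_def
  proof (intro ballI)
    fix x y z assume X: "x \<in> X" "y \<in> X" "z \<in> X"
    obtain a b where f1: "face X o2 u2 a b" "a (\<not> s) = x" "b r = z"
      using face_exists[OF ops2 X(1,3)] by blast
    obtain c d where f2: "face X o3 u3 c d" "c (\<not> s) = y" "d t = z"
      using face_exists[OF ops3 X(2,3)] by blast
    have "a s \<in> X" "c s \<in> X" using f1 f2 faceD by metis+
    then obtain i j k where c: "cube i j k" "i t s = a s" "j r s = c s" "k r t = z"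
      using assms X unfolding corner_extends_def by blast
    have "(\<lambda>s. i t s) = a"
      using face_unique[OF ops2 _ f1(1), of "\<lambda>s. i t s" "\<lambda>r. k r t" s r] c f1 unfolding cube_def by simp
    moreover have "(\<lambda>s. j r s) = c"
      using face_unique[OF ops3 _ f2(1), of "\<lambda>s. j r s" "\<lambda>t. k r t" s t] c f2 unfolding cube_def by simp
    ultimately have "i t (\<not> s) = x" "j r (\<not> s) = y"
      using f1(2) f2(2) by (metis)+
    then show "\<exists>i j k. cube i j k \<and> i t (\<not> s) = x \<and> j r (\<not> s) = y \<and> k r t = z"
      using c by blast
  qed
qed

lemma corner_extends_all: "corner_extends r t s"
proof -
  have "corner_extends r True True"
    using corner_extends_True corner_extends_flip(1)[OF corner_extends_True] by (cases r) auto
  then have "corner_extends r t True"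
    using corner_extends_flip(2) by (cases t) fastforce+
  then show ?thesis
    using corner_extends_flip(3) by (cases s) fastforce+
qed

text \<open>The three crossings of an actual configuration: \<open>r\<close>, \<open>t\<close>, \<open>s\<close> are the sides of the three strands on
  which the central triangle lies, \<open>ci\<close>, \<open>cj\<close>, \<open>ck\<close> label its edges, and \<open>eij\<close> is the label of the end
  of the first strand next to its crossing with the second, and so on.\<close>

definition triangle ::
    "bool \<Rightarrow> bool \<Rightarrow> bool \<Rightarrow> 'x \<Rightarrow> 'x \<Rightarrow> 'x \<Rightarrow> 'x \<Rightarrow> 'x \<Rightarrow> 'x \<Rightarrow> 'x \<Rightarrow> 'x \<Rightarrow> 'x \<Rightarrow> bool" where
  "triangle r t s ci cj ck eij eik eji ejk eki ekj \<longleftrightarrow>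
     face X o1 u1 (\<lambda>a. if a = t then ci else eij) (\<lambda>a. if a = r then cj else eji) \<and>
     face X o2 u2 (\<lambda>a. if a = s then ci else eik) (\<lambda>a. if a = r then ck else eki) \<and>
     face X o3 u3 (\<lambda>a. if a = s then cj else ejk) (\<lambda>a. if a = t then ck else ekj)"

text \<open>The two configurations interchanged by the third move: moving a strand across the opposite
  crossing puts the triangle on the other side of all strands, and each end is now next to the
  crossing with the other strand.\<close>

lemma triangle_flip:
  assumes T: "triangle r t s ci cj ck eij eik eji ejk eki ekj"
  shows "\<exists>ci\<in>X. \<exists>cj\<in>X. \<exists>ck\<in>X. triangle (\<not> r) (\<not> t) (\<not> s) ci cj ck eik eij ejk eji ekj eki"
proof -
  note T' = T[unfolded triangle_def]
  have X: "ci \<in> X" "cj \<in> X" "ck \<in> X"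
    using T' face_if_mem by metis+
  then obtain i j k where c: "cube i j k" "i t s = ci" "j r s = cj" "k r t = ck"
    using corner_extends_all unfolding corner_extends_def by blast
  note c' = c(1)[unfolded cube_def]
  have 1: "(\<lambda>t. i t s) = (\<lambda>a. if a = t then ci else eij) \<and> (\<lambda>r. j r s) = (\<lambda>a. if a = r then cj else eji)"
    by (rule face_unique[OF ops1, where r=t and s=r]) (use T' c c' in auto)
  have 2: "(\<lambda>s. i t s) = (\<lambda>a. if a = s then ci else eik) \<and> (\<lambda>r. k r t) = (\<lambda>a. if a = r then ck else eki)"
    by (rule face_unique[OF ops2, where r=s and s=r]) (use T' c c' in auto)
  have 3: "(\<lambda>s. j r s) = (\<lambda>a. if a = s then cj else ejk) \<and> (\<lambda>t. k r t) = (\<lambda>a. if a = t then ck else ekj)"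
    by (rule face_unique[OF ops3, where r=s and s=t]) (use T' c c' in auto)
  have e: "i (\<not> t) s = eij" "j (\<not> r) s = eji" "i t (\<not> s) = eik" "k (\<not> r) t = eki"
    "j r (\<not> s) = ejk" "k r (\<not> t) = ekj"
    using fun_cong[OF conjunct1[OF 1], of "\<not> t"] fun_cong[OF conjunct2[OF 1], of "\<not> r"]
      fun_cong[OF conjunct1[OF 2], of "\<not> s"] fun_cong[OF conjunct2[OF 2], of "\<not> r"]
      fun_cong[OF conjunct1[OF 3], of "\<not> s"] fun_cong[OF conjunct2[OF 3], of "\<not> t"]
    by simp_all
  let ?ci = "i (\<not> t) (\<not> s)" and ?cj = "j (\<not> r) (\<not> s)" and ?ck = "k (\<not> r) (\<not> t)"
  have "(\<lambda>a. if a = (\<not> t) then ?ci else eik) = (\<lambda>a. i a (\<not> s))"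
    "(\<lambda>a. if a = (\<not> r) then ?cj else ejk) = (\<lambda>a. j a (\<not> s))"
    "(\<lambda>a. if a = (\<not> s) then ?ci else eij) = (\<lambda>a. i (\<not> t) a)"
    "(\<lambda>a. if a = (\<not> r) then ?ck else ekj) = (\<lambda>a. k a (\<not> t))"
    "(\<lambda>a. if a = (\<not> s) then ?cj else eji) = (\<lambda>a. j (\<not> r) a)"
    "(\<lambda>a. if a = (\<not> t) then ?ck else eki) = (\<lambda>a. k (\<not> r) a)"
    using e by auto
  then have "triangle (\<not> r) (\<not> t) (\<not> s) ?ci ?cj ?ck eik eij ejk eji ekj eki"
    unfolding triangle_def using c' by simp
  moreover have "?ci \<in> X" "?cj \<in> X" "?ck \<in> X"
    using c' faceD by metis+
  ultimately show ?thesis by blast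
qed

lemma triangle_unique:
  assumes "triangle r t s ci cj ck eij eik eji ejk eki ekj"
    "triangle r t s ci' cj' ck' eij eik eji ejk eki ekj"
  shows "ci = ci' \<and> cj = cj' \<and> ck = ck'"
proof -
  note T = assms[unfolded triangle_def]
  have "(\<lambda>a. if a = t then ci else eij) = (\<lambda>a. if a = t then ci' else eij) \<and>
      (\<lambda>a. if a = r then cj else eji) = (\<lambda>a. if a = r then cj' else eji)"
    by (rule face_unique[OF ops1, where r="\<not> t" and s="\<not> r"]) (use T in auto)
  moreover have "(\<lambda>a. if a = s then ci else eik) = (\<lambda>a. if a = s then ci' else eik) \<and>
      (\<lambda>a. if a = r then ck else eki) = (\<lambda>a. if a = r then ck' else eki)"
    by (rule face_unique[OF ops2, where r="\<not> s" and s="\<not> r"]) (use T in auto)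
  ultimately show ?thesis
    by (metis (mono_tags, lifting))
qed

end

lemma (in biquandle) yang_baxter_classical: "yang_baxter X ov un ov un ov un"
  by unfold_locales
    (simp_all add: switch_ops_biquandle exchange1[symmetric] exchange2 exchange3)

lemma yang_baxter_virtual:
  "yang_baxter X (\<lambda>x y. x) (\<lambda>x y. x) (\<lambda>x y. x) (\<lambda>x y. x) (\<lambda>x y. x) (\<lambda>x y. x)"
  by unfold_locales (simp_all add: switch_ops_trivial)

lemma (in biquandle) yang_baxter_mixed:
  "yang_baxter X (\<lambda>x y. x) (\<lambda>x y. x) (\<lambda>x y. x) (\<lambda>x y. x) ov un"
  by unfold_locales (simp_all add: switch_ops_trivial switch_ops_biquandle)

section \<open>The oriented circle\<close>

lemma mult_cis_in_circle: "p \<in> circle \<Longrightarrow> p * cis t \<in> circle"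
  by (simp add: norm_mult)

lemma circle_eq_cis: "p \<in> circle \<Longrightarrow> p = cis (Arg p)"
  using cis_Arg_unique complex_eq_iff by (metis (no_types) Arg_zero cis_Arg div_by_1 dist_0_norm mem_sphere norm_zero sgn_eq zero_neq_one of_real_1)

lemma circle_cases:
  assumes "p \<in> circle" obtains t where "p = cis t"
  using circle_eq_cis[OF assms] by blast

lemma cis_in_circle [simp]: "cis t \<in> circle"
  by simp

lemma eventually_at_0_iff:
  "eventually P (at (0::real)) \<longleftrightarrow> eventually P (at_left 0) \<and> eventually P (at_right 0)"
  by (rule eventually_at_split)

lemma tendsto_mult_cis: "((\<lambda>t. p * cis t) \<longlongrightarrow> p) (at 0)"
proof -
  have "((\<lambda>t. p * cis t) \<longlongrightarrow> p * cis 0) (at 0)"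
    by (intro tendsto_intros)
  then show ?thesis by simp
qed

lemma cis_neq_1: "t \<noteq> 0 \<Longrightarrow> \<bar>t\<bar> < 2 * pi \<Longrightarrow> cis t \<noteq> 1"
proof
  assume t: "t \<noteq> 0" "\<bar>t\<bar> < 2 * pi" "cis t = 1"
  then have "cos t = 1"
    by (simp add: complex_eq_iff)
  then obtain n :: int where "t = of_int n * 2 * pi"
    using cos_one_2pi_int by blast
  then have "\<bar>of_int n :: real\<bar> < 1"
    using t(2) by (simp add: abs_mult)
  then have "n = 0" by linarith
  then show False
    using \<open>t = _\<close> t(1) by simp
qed

lemma eventually_cis_neq_1: "eventually (\<lambda>t. cis t \<noteq> 1) (at (0::real))"
  unfolding eventually_at using cis_neq_1 by (intro exI[of _ "2 * pi"]) auto

lemma eventually_avoid_finite: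
  assumes "finite P" "p \<in> circle"
  shows "eventually (\<lambda>t. p * cis t \<notin> P) (at (0::real))"
proof -
  have "eventually (\<lambda>t. p * cis t \<noteq> q) (at (0::real))" for q
  proof (cases "p = q")
    case True
    then have "p \<noteq> 0" using assms(2) by auto
    then show ?thesis
      using eventually_cis_neq_1 True by (auto elim!: eventually_mono)
  next
    case False
    then show ?thesis
      by (rule tendsto_imp_eventually_ne[OF tendsto_mult_cis])
  qed
  then have "eventually (\<lambda>t. \<forall>q\<in>P. p * cis t \<noteq> q) (at (0::real))"
    using assms(1) by (intro eventually_ball_finite) auto
  then show ?thesis
    by (auto elim!: eventually_mono)
qed

text \<open>The angular coordinate at \<open>p\<close> describes the neighbourhoods of \<open>p\<close> in the circle.\<close>

lemma eventually_circle_nhd: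
  assumes p: "p \<in> circle" and ev: "eventually (\<lambda>t. Q (p * cis t)) (at (0::real))"
  shows "eventually Q (at p within circle)"
proof -
  obtain d where d: "d > 0" "\<And>t. t \<noteq> 0 \<Longrightarrow> \<bar>t\<bar> < d \<Longrightarrow> Q (p * cis t)"
    using ev unfolding eventually_at by auto
  have "p \<noteq> 0" using p by auto
  have "isCont (\<lambda>q. Arg (q / p)) p"
    using \<open>p \<noteq> 0\<close>
    by (intro isCont_o2[where g=Arg and f="\<lambda>q. q / p"] continuous_at_Arg continuous_intros) auto
  then have "((\<lambda>q. Arg (q / p)) \<longlongrightarrow> 0) (at p within circle)"
    using \<open>p \<noteq> 0\<close> unfolding isCont_def by (auto intro: tendsto_within_subset)
  then have "eventually (\<lambda>q. \<bar>Arg (q / p)\<bar> < d) (at p within circle)"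
    using d(1) unfolding tendsto_iff by auto
  moreover have "eventually (\<lambda>q. q \<in> circle \<and> q \<noteq> p) (at p within circle)"
    by (auto simp: eventually_at_filter)
  ultimately show ?thesis
  proof eventually_elim
    case (elim q)
    have "q / p \<in> circle"
      using elim(2) p by (auto simp: norm_divide)
    then have "q / p = cis (Arg (q / p))"
      by (rule circle_eq_cis)
    then have q: "q = p * cis (Arg (q / p))"
      using \<open>p \<noteq> 0\<close> by (metis nonzero_eq_divide_eq mult.commute)
    then have "Arg (q / p) \<noteq> 0"
      using elim(2) by auto
    then show ?case
      using d(2) elim(1) q by metis
  qed
qed

lemma smooth_imp_has_derivative:
  assumes "smooth f"
  obtains f' where "\<And>x. (f has_derivative f' x) (at x)" "\<And>v. smooth (\<lambda>x. f' x v)"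
  using assms by cases blast

lemma smooth_imp_isCont: "smooth f \<Longrightarrow> isCont f x"
  by (metis smooth_imp_has_derivative has_derivative_continuous)

lemma continuous_on_circle:
  fixes c :: "complex \<Rightarrow> 'a::metric_space"
  assumes "\<And>t::real. isCont (\<lambda>t. c (cis t)) t"
  shows "continuous_on circle c"
  unfolding continuous_on_def
proof
  fix p :: complex assume p: "p \<in> circle"
  then obtain t where t: "p = cis t" by (rule circle_cases)
  show "(c \<longlongrightarrow> c p) (at p within circle)"
    unfolding tendsto_iff
  proof (intro allI impI)
    fix e :: real assume "e > 0"
    have "((\<lambda>s. c (cis (t + s))) \<longlongrightarrow> c (cis t)) (at 0)"
      using assms[of t] by (simp add: isCont_iff)
    then have "eventually (\<lambda>s. dist (c (p * cis s)) (c p) < e) (at (0::real))"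
      using \<open>e > 0\<close> by (auto simp: tendsto_iff cis_mult t)
    then show "eventually (\<lambda>q. dist (c q) (c p) < e) (at p within circle)"
      by (rule eventually_circle_nhd[OF p])
  qed
qed

lemma diagram_continuous_on:
  assumes "is_diagram D"
  shows "continuous_on circle (curve D)"
  using assms smooth_imp_isCont unfolding is_diagram_def generic_immersion_def
  by (intro continuous_on_circle) blast

section \<open>Labelings as step functions on the circle\<close>

text \<open>Preimages of the classical crossings.\<close>

definition crossing_points :: "vdiagram \<Rightarrow> complex set" where
  "crossing_points D = {p. \<exists>q. classical_crossing D p q \<or> classical_crossing D q p}"

lemma double_point_sym: "double_point c p q \<longleftrightarrow> double_point c q p"
  unfolding double_point_def by metis

lemma finite_crossing_points:
  assumes "is_diagram D"
  shows "finite (crossing_points D)"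
proof -
  have "finite {(p, q). double_point (curve D) p q}"
    using assms unfolding is_diagram_def generic_immersion_def by blast
  moreover have "crossing_points D \<subseteq> fst ` {(p, q). double_point (curve D) p q}"
    unfolding crossing_points_def classical_crossing_def using double_point_sym by force
  ultimately show ?thesis
    using finite_surj by blast
qed

lemma short_arcs_eq: "short_arcs D = components (circle - crossing_points D)"
  unfolding short_arcs_def crossing_points_def ..

lemma short_arcs_disjoint:
  "A \<in> short_arcs D \<Longrightarrow> B \<in> short_arcs D \<Longrightarrow> x \<in> A \<Longrightarrow> x \<in> B \<Longrightarrow> A = B"
  unfolding short_arcs_eq using components_nonoverlap by blast

text \<open>The descriptions of \<^const>\<open>arc_in\<close> and \<^const>\<open>arc_out\<close> are legitimate at every point of the circle.\<close>

lemma short_arc_side: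
  assumes fin: "finite (crossing_points D)" and p: "p \<in> circle"
    and F: "F = at_left (0::real) \<or> F = at_right 0"
  shows "\<exists>!A. A \<in> short_arcs D \<and> eventually (\<lambda>t. p * cis t \<in> A) F"
proof -
  let ?S = "circle - crossing_points D"
  have ev: "eventually (\<lambda>t. p * cis t \<notin> crossing_points D) F"
    using eventually_avoid_finite[OF fin p] F unfolding eventually_at_0_iff by blast
  obtain J :: "real set" where J: "connected J" "J \<noteq> {}" "eventually (\<lambda>t. t \<in> J) F"
    "\<And>t. t \<in> J \<Longrightarrow> p * cis t \<notin> crossing_points D"
    using F
  proof
    assume F: "F = at_left 0"
    then obtain b where "b < 0" "\<forall>t>b. t < 0 \<longrightarrow> p * cis t \<notin> crossing_points D"
      using ev unfolding F eventually_at_left_field by blast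
    then show ?thesis
      using F by (intro that[of "{b<..<0}"]) (auto intro: eventually_at_left_real[simplified])
  next
    assume F: "F = at_right 0"
    then obtain b where "b > 0" "\<forall>t>0. t < b \<longrightarrow> p * cis t \<notin> crossing_points D"
      using ev unfolding F eventually_at_right_field by blast
    then show ?thesis
      using F by (intro that[of "{0<..<b}"]) (auto intro: eventually_at_right_real[simplified])
  qed
  have F_nontriv: "F \<noteq> bot"
    using F by (metis trivial_limit_at_left_real trivial_limit_at_right_real)
  let ?I = "(\<lambda>t. p * cis t) ` J"
  have I: "connected ?I" "?I \<noteq> {}" "?I \<subseteq> ?S"
    using J p mult_cis_in_circle by (auto intro!: connected_continuous_image continuous_intros)
  then obtain C where C: "C \<in> components ?S" "?I \<subseteq> C"
    using exists_component_superset[OF I(3)] by blast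
  show ?thesis
  proof (rule ex1I[of _ C])
    show "C \<in> short_arcs D \<and> (\<forall>\<^sub>F t in F. p * cis t \<in> C)"
      using C J(3) unfolding short_arcs_eq by (auto elim!: eventually_mono)
  next
    fix A assume A: "A \<in> short_arcs D \<and> (\<forall>\<^sub>F t in F. p * cis t \<in> A)"
    then have "eventually (\<lambda>t. p * cis t \<in> A \<and> t \<in> J) F"
      using J(3) eventually_conj by blast
    then obtain t where "p * cis t \<in> A" "t \<in> J"
      using F_nontriv eventually_happens' by blast
    then show "A = C"
      using A C short_arcs_disjoint[of A D C "p * cis t"] unfolding short_arcs_eq by blast
  qed
qed

lemma arc_in:
  assumes "finite (crossing_points D)" "p \<in> circle"
  shows "arc_in D p \<in> short_arcs D" "eventually (\<lambda>t. p * cis t \<in> arc_in D p) (at_left 0)"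
  using theI'[OF short_arc_side[OF assms, of "at_left 0"]] unfolding arc_in_def by auto

lemma arc_out:
  assumes "finite (crossing_points D)" "p \<in> circle"
  shows "arc_out D p \<in> short_arcs D" "eventually (\<lambda>t. p * cis t \<in> arc_out D p) (at_right 0)"
  using theI'[OF short_arc_side[OF assms, of "at_right 0"]] unfolding arc_out_def by auto

lemma arc_in_out_eq:
  assumes fin: "finite (crossing_points D)" and A: "A \<in> short_arcs D" and p: "p \<in> A"
  shows "arc_in D p = A" "arc_out D p = A"
proof -
  let ?S = "circle - crossing_points D"
  have pS: "p \<in> ?S" and AS: "A \<in> components ?S"
    using A p in_components_subset unfolding short_arcs_eq by blast+
  have "eventually (\<lambda>t. p * cis t \<notin> crossing_points D) (at (0::real))"
    using eventually_avoid_finite[OF fin] pS by blast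
  then obtain d where d: "d > 0" "\<And>t. t \<noteq> 0 \<Longrightarrow> \<bar>t\<bar> < d \<Longrightarrow> p * cis t \<notin> crossing_points D"
    unfolding eventually_at by auto
  let ?I = "(\<lambda>t. p * cis t) ` {-d<..<d}"
  have "p * cis t \<notin> crossing_points D" if "t \<in> {-d<..<d}" for t
    using d(2)[of t] that pS by (cases "t = 0") (auto simp: abs_less_iff)
  then have "?I \<subseteq> ?S"
    using pS mult_cis_in_circle by auto
  moreover have "connected ?I"
    by (auto intro!: connected_continuous_image continuous_intros)
  moreover have "p \<in> ?I"
    using d(1) by (auto intro!: image_eqI[of _ _ 0])
  ultimately have "?I \<subseteq> A"
    using components_maximal[OF AS] p by blast
  then have "\<forall>t. \<bar>t\<bar> < d \<longrightarrow> p * cis t \<in> A"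
    by (auto simp: abs_less_iff image_subset_iff)
  then have "eventually (\<lambda>t. p * cis t \<in> A) (at (0::real))"
    using d(1) unfolding eventually_at by auto
  then have ev: "eventually (\<lambda>t. p * cis t \<in> A) (at_left (0::real))"
    "eventually (\<lambda>t. p * cis t \<in> A) (at_right (0::real))"
    unfolding eventually_at_0_iff by auto
  have "p \<in> circle" using pS by blast
  show "arc_in D p = A"
    using short_arc_side[OF fin \<open>p \<in> circle\<close>, of "at_left 0"] arc_in[OF fin \<open>p \<in> circle\<close>] ev A by blast
  show "arc_out D p = A"
    using short_arc_side[OF fin \<open>p \<in> circle\<close>, of "at_right 0"] arc_out[OF fin \<open>p \<in> circle\<close>] ev A by blast
qed

text \<open>The left limit of a step function; the value at \<open>p\<close> itself plays the role of the right limit.\<close>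

definition before :: "(complex \<Rightarrow> 'x) \<Rightarrow> complex \<Rightarrow> 'x" where
  "before F p = (THE x. eventually (\<lambda>t. F (p * cis t) = x) (at_left 0))"

lemma before_eqI:
  assumes "eventually (\<lambda>t. F (p * cis t) = x) (at_left (0::real))"
  shows "before F p = x"
  unfolding before_def
proof (rule the_equality)
  show "eventually (\<lambda>t. F (p * cis t) = x) (at_left (0::real))"
    by (rule assms)
  fix y assume "eventually (\<lambda>t. F (p * cis t) = y) (at_left (0::real))"
  then have "eventually (\<lambda>t. x = y) (at_left (0::real))"
    using assms by eventually_elim simp
  then show "y = x"
    by simp
qed

text \<open>A coloring assigns to a point of the circle the label of the short arc leaving it. The left
  limit \<^term>\<open>before F p\<close> is then the label of the arc entering \<open>p\<close>. The domain is the whole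
  circle for all diagrams, and the definition depends only on the classical crossings and their
  signs.\<close>

definition colorings ::
    "'x set \<Rightarrow> 'x crossing_rule \<Rightarrow> vdiagram \<Rightarrow> (complex \<Rightarrow> 'x) set" where
  "colorings X R D = {F \<in> circle \<rightarrow>\<^sub>E X.
     (\<forall>p\<in>circle. eventually (\<lambda>t. F (p * cis t) = F p) (at_right 0) \<and>
        eventually (\<lambda>t. F (p * cis t) = before F p) (at_left 0) \<and>
        (p \<notin> crossing_points D \<longrightarrow> before F p = F p)) \<and>
     (\<forall>p q. classical_crossing D p q \<longrightarrow> R (positive D p q) (before F q) (F q) (before F p) (F p))}"

lemma coloringsD:
  assumes "F \<in> colorings X R D"
  shows "F \<in> circle \<rightarrow>\<^sub>E X"
    "p \<in> circle \<Longrightarrow> eventually (\<lambda>t. F (p * cis t) = F p) (at_right 0)"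
    "p \<in> circle \<Longrightarrow> eventually (\<lambda>t. F (p * cis t) = before F p) (at_left 0)"
    "p \<in> circle \<Longrightarrow> p \<notin> crossing_points D \<Longrightarrow> before F p = F p"
    "classical_crossing D p q \<Longrightarrow> R (positive D p q) (before F q) (F q) (before F p) (F p)"
  using assms unfolding colorings_def by blast+

lemma before_mem:
  assumes "F \<in> circle \<rightarrow>\<^sub>E X" "p \<in> circle" "eventually (\<lambda>t. F (p * cis t) = before F p) (at_left 0)"
  shows "before F p \<in> X"
proof -
  obtain t where "F (p * cis t) = before F p"
    using eventually_happens'[OF _ assms(3)] by auto
  then show ?thesis
    using assms(1) mult_cis_in_circle[OF assms(2)] by (metis PiE_mem)
qed

text \<open>Legitimate labelings for an arbitrary crossing rule.\<close>

definition labelings_by ::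
    "'x set \<Rightarrow> 'x crossing_rule \<Rightarrow> vdiagram \<Rightarrow> (complex set \<Rightarrow> 'x) set" where
  "labelings_by X R D =
     {L \<in> short_arcs D \<rightarrow>\<^sub>E X. \<forall>p q. classical_crossing D p q \<longrightarrow>
        R (positive D p q) (L (arc_in D q)) (L (arc_out D q)) (L (arc_in D p)) (L (arc_out D p))}"

lemma labelings_eq: "labelings X ov un D = labelings_by X (crossing_rel ov un) D"
  unfolding labelings_def labelings_by_def crossing_rel_def ..

lemma labelings_both_in_eq: "labelings_both_in X ov un D = labelings_by X (crossing_rel_both_in ov un) D"
  unfolding labelings_both_in_def labelings_by_def crossing_rel_both_in_def ..

lemma coloring_constant_on_arc:
  assumes F: "F \<in> colorings X R D" and A: "A \<in> short_arcs D" and pq: "p \<in> A" "q \<in> A"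
  shows "F p = F q"
proof (rule connected_local_const[OF _ pq])
  have AS: "A \<in> components (circle - crossing_points D)"
    using A unfolding short_arcs_eq .
  then show "connected A"
    by (rule in_components_connected)
  show "\<forall>a\<in>A. \<forall>\<^sub>F b in at a within A. F a = F b"
  proof
    fix a assume "a \<in> A"
    then have a: "a \<in> circle" "a \<notin> crossing_points D"
      using in_components_subset[OF AS] by auto
    then have "eventually (\<lambda>t. F a = F (a * cis t)) (at_right 0)"
      "eventually (\<lambda>t. F a = F (a * cis t)) (at_left 0)"
      using F unfolding colorings_def by (auto elim!: eventually_mono)
    then have "eventually (\<lambda>t. F a = F (a * cis t)) (at 0)"
      unfolding eventually_at_0_iff by blast
    then have "eventually (\<lambda>b. F a = F b) (at a within circle)"
      by (rule eventually_circle_nhd[OF a(1)])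
    then show "\<forall>\<^sub>F b in at a within A. F a = F b"
      using at_le[of A circle a] in_components_subset[OF AS] filter_leD by blast
  qed
qed

lemma card_labelings_by_eq:
  assumes fin: "finite (crossing_points D)"
  shows "card (labelings_by X R D) = card (colorings X R D)"
proof (rule bij_betw_same_card)
  let ?\<Phi> = "\<lambda>L. \<lambda>p\<in>circle. L (arc_out D p)"
  have cross_circle: "p \<in> circle" "q \<in> circle" if "classical_crossing D p q" for p q
    using that unfolding classical_crossing_def double_point_def by auto
  show "bij_betw ?\<Phi> (labelings_by X R D) (colorings X R D)"
  proof (rule bij_betw_imageI)
    show "inj_on ?\<Phi> (labelings_by X R D)"
    proof (rule inj_onI)
      fix L M assume LM: "L \<in> labelings_by X R D" "M \<in> labelings_by X R D" "?\<Phi> L = ?\<Phi> M"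
      show "L = M"
      proof (rule PiE_ext)
        show "L \<in> short_arcs D \<rightarrow>\<^sub>E X" "M \<in> short_arcs D \<rightarrow>\<^sub>E X"
          using LM unfolding labelings_by_def by auto
        fix A assume A: "A \<in> short_arcs D"
        then obtain p where p: "p \<in> A"
          using in_components_nonempty unfolding short_arcs_eq by blast
        then have "p \<in> circle"
          using A in_components_subset unfolding short_arcs_eq by blast
        then show "L A = M A"
          using fun_cong[OF LM(3), of p] arc_in_out_eq[OF fin A p] by simp
      qed
    qed
    show "?\<Phi> ` labelings_by X R D = colorings X R D"
    proof (intro equalityI subsetI)
      fix F assume "F \<in> ?\<Phi> ` labelings_by X R D"
      then obtain L where L: "L \<in> labelings_by X R D" and F: "F = ?\<Phi> L"
        by blast
      have LX: "L A \<in> X" if "A \<in> short_arcs D" for A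
        using L that unfolding labelings_by_def by auto
      have ev: "eventually (\<lambda>t. F (p * cis t) = F p) (at_right 0)"
        "eventually (\<lambda>t. F (p * cis t) = L (arc_in D p)) (at_left 0)" if p: "p \<in> circle" for p
      proof -
        show "eventually (\<lambda>t. F (p * cis t) = F p) (at_right 0)"
          using arc_out(2)[OF fin p]
        proof eventually_elim
          case (elim t)
          then show ?case
            using arc_in_out_eq(2)[OF fin arc_out(1)[OF fin p] elim] p mult_cis_in_circle
            unfolding F by simp
        qed
        show "eventually (\<lambda>t. F (p * cis t) = L (arc_in D p)) (at_left 0)"
          using arc_in(2)[OF fin p]
        proof eventually_elim
          case (elim t)
          then show ?case
            using arc_in_out_eq(2)[OF fin arc_in(1)[OF fin p] elim] p mult_cis_in_circle
            unfolding F by simp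
        qed
      qed
      have bef: "before F p = L (arc_in D p)" if "p \<in> circle" for p
        using before_eqI[OF ev(2)[OF that]] .
      have out: "F p = L (arc_out D p)" if "p \<in> circle" for p
        using that unfolding F by simp
      have "arc_in D p = arc_out D p" if p: "p \<in> circle" "p \<notin> crossing_points D" for p
      proof -
        obtain A where "A \<in> short_arcs D" "p \<in> A"
          using p unfolding short_arcs_eq
          by (metis DiffI Union_components UnionE)
        then show ?thesis
          using arc_in_out_eq[OF fin] by metis
      qed
      moreover have "F \<in> circle \<rightarrow>\<^sub>E X"
        unfolding F using LX arc_out(1)[OF fin] by auto
      moreover have "R (positive D p q) (before F q) (F q) (before F p) (F p)"
        if "classical_crossing D p q" for p q
        using L that cross_circle[OF that] bef out unfolding labelings_by_def by simp
      ultimately show "F \<in> colorings X R D"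
        unfolding colorings_def using ev bef out by auto
    next
      fix F assume F: "F \<in> colorings X R D"
      define L where "L = (\<lambda>A\<in>short_arcs D. F (SOME p. p \<in> A))"
      have L: "L A = F p" if "A \<in> short_arcs D" "p \<in> A" for A p
        using coloring_constant_on_arc[OF F that(1) someI[of "\<lambda>p. p \<in> A", OF that(2)] that(2)] that
        unfolding L_def by simp
      have FX: "F \<in> circle \<rightarrow>\<^sub>E X"
        using F unfolding colorings_def by blast
      have LX: "L A \<in> X" if "A \<in> short_arcs D" for A
      proof -
        have "A \<noteq> {}"
          using that in_components_nonempty unfolding short_arcs_eq by blast
        then obtain p where "p \<in> A"
          by blast
        moreover from this have "p \<in> circle"
          using that in_components_subset unfolding short_arcs_eq by blast
        ultimately show ?thesis
          using L[OF that] FX by auto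
      qed
      have out: "L (arc_out D p) = F p" if p: "p \<in> circle" for p
      proof -
        have "eventually (\<lambda>t. F (p * cis t) = F p) (at_right 0)"
          using F p unfolding colorings_def by blast
        then have "eventually (\<lambda>t. L (arc_out D p) = F p) (at_right (0::real))"
          using arc_out(2)[OF fin p] by eventually_elim (use L arc_out(1)[OF fin p] in auto)
        then show ?thesis by simp
      qed
      have bef: "L (arc_in D p) = before F p" if p: "p \<in> circle" for p
      proof -
        have "eventually (\<lambda>t. F (p * cis t) = before F p) (at_left 0)"
          using F p unfolding colorings_def by blast
        then have "eventually (\<lambda>t. L (arc_in D p) = before F p) (at_left (0::real))"
          using arc_in(2)[OF fin p] by eventually_elim (use L arc_in(1)[OF fin p] in auto)
        then show ?thesis by simp
      qed
      have "R (positive D p q) (L (arc_in D q)) (L (arc_out D q)) (L (arc_in D p)) (L (arc_out D p))"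
        if "classical_crossing D p q" for p q
        using F that cross_circle[OF that] bef out unfolding colorings_def by simp
      moreover have "L \<in> short_arcs D \<rightarrow>\<^sub>E X"
        using LX by (auto simp: L_def)
      ultimately have "L \<in> labelings_by X R D"
        unfolding labelings_by_def by blast
      moreover have "F = ?\<Phi> L"
      proof
        fix p show "F p = ?\<Phi> L p"
          using out FX by (cases "p \<in> circle") (auto simp: PiE_def extensional_def)
      qed
      ultimately show "F \<in> ?\<Phi> ` labelings_by X R D"
        by blast
    qed
  qed
qed

section \<open>Colorings of a diagram in Morse position\<close>

text \<open>If the colorings differ, let \<open>p\<close> be a highest point of the closure of the set where they do. All that
  the argument at \<open>p\<close> needs from the Morse position is that double points are not local maxima.\<close>

lemma colorings_eqI_local_maxima:
  assumes D: "is_diagram D" and morse: "morse_position D" and R: "corner_determined X R"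
    and F: "F \<in> colorings X R D" and G: "G \<in> colorings X R D"
    and eq: "\<And>p. p \<in> local_maxima D \<Longrightarrow> F p = G p"
  shows "F = G"
proof -
  define W where "W = {p \<in> circle. F p \<noteq> G p}"
  have cont: "continuous_on circle (\<lambda>p. Im (curve D p))"
    by (intro continuous_intros diagram_continuous_on[OF D])
  have "W = {}"
  proof (rule ccontr)
    assume "W \<noteq> {}"
    have "closure W \<subseteq> circle"
      unfolding W_def by (rule closure_minimal) auto
    moreover have "compact (closure W)"
      using \<open>closure W \<subseteq> circle\<close> by (meson bounded_subset bounded_sphere closed_closure compact_eq_bounded_closed)
    moreover have "continuous_on (closure W) (\<lambda>p. Im (curve D p))"
      by (rule continuous_on_subset[OF cont \<open>closure W \<subseteq> circle\<close>])
    moreover have "closure W \<noteq> {}"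
      using \<open>W \<noteq> {}\<close> by simp
    ultimately obtain p where p: "p \<in> closure W" and pmax: "\<And>q. q \<in> closure W \<Longrightarrow> Im (curve D q) \<le> Im (curve D p)"
      using continuous_attains_sup[of "closure W" "\<lambda>p. Im (curve D p)"] by blast
    \<comment> \<open>above the highest point of the closure there is no difference\<close>
    have agree: "F q = G q" if "q \<in> circle" "Im (curve D q) > Im (curve D p)" for q
      using that pmax[of q] closure_subset[of W] unfolding W_def by force
    have pc: "p \<in> circle"
      using p \<open>closure W \<subseteq> circle\<close> by blast
    have evs: "eventually (\<lambda>t. F (q * cis t) = F q \<and> G (q * cis t) = G q) (at_right 0)"
      "eventually (\<lambda>t. F (q * cis t) = before F q \<and> G (q * cis t) = before G q) (at_left 0)"
      if "q \<in> circle" for q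
      using F G that unfolding colorings_def by (auto intro: eventually_conj)
    \<comment> \<open>a strand that is not at a local maximum goes up on some side, where the colorings agree\<close>
    have side: "F q = G q \<or> before F q = before G q"
      if q: "q \<in> circle" "Im (curve D q) = Im (curve D p)" "q \<notin> local_maxima D" for q
    proof (rule ccontr)
      assume neg: "\<not> (F q = G q \<or> before F q = before G q)"
      have r: "eventually (\<lambda>t. height D q t \<le> height D q 0) (at_right 0)"
        using evs(1)[OF q(1)]
      proof eventually_elim
        case (elim t)
        then show ?case
          using neg agree[of "q * cis t"] q mult_cis_in_circle by (force simp: height_def)
      qed
      have l: "eventually (\<lambda>t. height D q t \<le> height D q 0) (at_left 0)"
        using evs(2)[OF q(1)]
      proof eventually_elim
        case (elim t)
        then show ?case
          using neg agree[of "q * cis t"] q mult_cis_in_circle by (force simp: height_def)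
      qed
      show False
        using q r l unfolding local_maxima_def eventually_at_0_iff by blast
    qed
    have dbl: "q \<notin> local_maxima D" if "double_point (curve D) q q'" for q q'
      using morse that unfolding morse_position_def by blast
    have both: "F p = G p \<and> before F p = before G p"
    proof (cases "p \<in> crossing_points D")
      case False
      then have "before F p = F p" "before G p = G p"
        using F G pc unfolding colorings_def by auto
      then show ?thesis
        using eq[of p] side[OF pc refl] by auto
    next
      case True
      then obtain q where "classical_crossing D p q \<or> classical_crossing D q p"
        unfolding crossing_points_def by blast
      then obtain u v where uv: "classical_crossing D u v" "p = u \<or> p = v"
        by blast
      then have d: "double_point (curve D) u v" "double_point (curve D) v u"
        unfolding classical_crossing_def using double_point_sym by blast+
      then have c: "u \<in> circle" "v \<in> circle" "curve D u = curve D v"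
        unfolding double_point_def by auto
      have 1: "before F u = before G u \<or> F u = G u" "before F v = before G v \<or> F v = G v"
        using side c uv(2) dbl d by metis+
      have 2: "R (positive D u v) (before F v) (F v) (before F u) (F u)"
        "R (positive D u v) (before G v) (G v) (before G u) (G u)"
        using F G uv(1) unfolding colorings_def by auto
      have X: "F u \<in> X" "F v \<in> X" "G u \<in> X" "G v \<in> X"
        using F G c unfolding colorings_def by auto
      have X': "before F u \<in> X" "before F v \<in> X" "before G u \<in> X" "before G v \<in> X"
        using F G c unfolding colorings_def by (auto intro: before_mem)
      show ?thesis
        using R[unfolded corner_determined_def, rule_format, OF X'(2) X(2) X'(1) X(1) X'(4) X(4) X'(3) X(3) 2 1(2) 1(1)]
          uv(2) by auto
    qed
    have "eventually (\<lambda>t. F (p * cis t) = G (p * cis t)) (at_right 0)"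
      using evs(1)[OF pc] both by (auto elim!: eventually_mono)
    moreover have "eventually (\<lambda>t. F (p * cis t) = G (p * cis t)) (at_left 0)"
      using evs(2)[OF pc] both by (auto elim!: eventually_mono)
    ultimately have "eventually (\<lambda>t. F (p * cis t) = G (p * cis t)) (at 0)"
      unfolding eventually_at_0_iff by blast
    then have ev: "eventually (\<lambda>q. F q = G q) (at p within circle)"
      by (rule eventually_circle_nhd[OF pc])
    have "p \<notin> W"
      using both unfolding W_def by blast
    moreover have "\<not> p islimpt W"
    proof
      assume "p islimpt W"
      then have "frequently (\<lambda>q. q \<in> W) (at p)"
        by (simp add: islimpt_conv_frequently_at)
      moreover have "eventually (\<lambda>q. q \<in> circle \<longrightarrow> F q = G q) (at p)"
        using ev unfolding eventually_at_filter by (auto elim!: eventually_mono)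
      ultimately have "frequently (\<lambda>q. q \<in> W \<and> (q \<in> circle \<longrightarrow> F q = G q)) (at p)"
        by (rule frequently_eventually_frequently)
      then have "frequently (\<lambda>q. False) (at p)"
        by (rule frequently_elim1) (auto simp: W_def)
      then show False by simp
    qed
    ultimately show False
      using p unfolding closure_def by blast
  qed
  show "F = G"
  proof (rule PiE_ext)
    show "F \<in> circle \<rightarrow>\<^sub>E X" "G \<in> circle \<rightarrow>\<^sub>E X"
      using F G unfolding colorings_def by auto
    show "F p = G p" if "p \<in> circle" for p
      using \<open>W = {}\<close> that unfolding W_def by blast
  qed
qed

lemma card_colorings_le:
  assumes "is_diagram D" "morse_position D" "corner_determined X R" "finite X"
  shows "card (colorings X R D) \<le> card X ^ card (local_maxima D)"
proof -
  let ?\<rho> = "\<lambda>F. restrict F (local_maxima D)"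
  have fin: "finite (local_maxima D)"
    using assms(2) unfolding morse_position_def by blast
  have "inj_on ?\<rho> (colorings X R D)"
  proof (rule inj_onI)
    fix F G assume FG: "F \<in> colorings X R D" "G \<in> colorings X R D" "?\<rho> F = ?\<rho> G"
    then have "F p = G p" if "p \<in> local_maxima D" for p
      using that by (metis restrict_apply')
    then show "F = G"
      using colorings_eqI_local_maxima[OF assms(1-3)] FG by blast
  qed
  moreover have "?\<rho> ` colorings X R D \<subseteq> local_maxima D \<rightarrow>\<^sub>E X"
  proof (rule image_subsetI)
    fix F assume "F \<in> colorings X R D"
    then have "F \<in> circle \<rightarrow> X"
      unfolding colorings_def by blast
    moreover have "local_maxima D \<subseteq> circle"
      unfolding local_maxima_def by blast
    ultimately show "?\<rho> F \<in> local_maxima D \<rightarrow>\<^sub>E X"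
      by (simp add: Pi_iff subset_iff)
  qed
  ultimately have "card (colorings X R D) \<le> card (local_maxima D \<rightarrow>\<^sub>E X)"
    using fin assms(4) by (intro card_inj_on_le) (auto intro: finite_PiE)
  then show ?thesis
    using fin by (simp add: card_PiE)
qed

section \<open>Smooth maps and velocities\<close>

lemma smooth_const: "smooth (\<lambda>_ :: 'a::real_normed_vector. c :: 'b::real_normed_vector)"
proof (rule smooth.coinduct[where X="\<lambda>f. \<exists>d. f = (\<lambda>_. d)"])
  fix f :: "'a \<Rightarrow> 'b" assume "\<exists>d. f = (\<lambda>_. d)"
  then have "\<forall>x. (f has_derivative (\<lambda>_. 0)) (at x)"
    by auto
  then show "\<exists>g g'. f = g \<and> (\<forall>x. (g has_derivative g' x) (at x)) \<and>
      (\<forall>v. (\<exists>d. (\<lambda>x. g' x v) = (\<lambda>_. d)) \<or> smooth (\<lambda>x. g' x v))"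
    by (intro exI[of _ f] exI[of _ "\<lambda>_ _. 0"]) blast
qed blast

lemma smooth_affine:
  assumes "bounded_linear L"
  shows "smooth (\<lambda>x. a + L x)"
proof (rule smoothI)
  show "((\<lambda>x. a + L x) has_derivative L) (at x)" for x
    using bounded_linear_imp_has_derivative[OF assms] by (auto intro!: derivative_eq_intros)
qed (rule smooth_const)

lemma smooth_bounded_linear: "bounded_linear L \<Longrightarrow> smooth L"
  using smooth_affine[of L 0] by simp

lemma smooth_bounded_linear_compose:
  fixes f :: "'a::real_normed_vector \<Rightarrow> 'b::real_normed_vector"
    and L :: "'b \<Rightarrow> 'c::real_normed_vector"
  assumes L: "bounded_linear L" and f: "smooth f"
  shows "smooth (\<lambda>x. L (f x))"
proof (rule smooth.coinduct[where X="\<lambda>h. \<exists>g. smooth g \<and> h = (\<lambda>x. L (g x))"])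
  show "\<exists>g. smooth g \<and> (\<lambda>x. L (f x)) = (\<lambda>x. L (g x))"
    using f by blast
next
  fix h :: "'a \<Rightarrow> 'c"
  assume "\<exists>g. smooth g \<and> h = (\<lambda>x. L (g x))"
  then obtain g where g: "smooth g" "h = (\<lambda>x. L (g x))" by blast
  obtain g' where g': "\<And>x. (g has_derivative g' x) (at x)" "\<And>v. smooth (\<lambda>x. g' x v)"
    using smooth_imp_has_derivative[OF g(1)] by blast
  show "\<exists>k k'. h = k \<and> (\<forall>x. (k has_derivative k' x) (at x)) \<and>
      (\<forall>v. (\<exists>g. smooth g \<and> (\<lambda>x. k' x v) = (\<lambda>x. L (g x))) \<or> smooth (\<lambda>x. k' x v))"
  proof (intro exI conjI allI)
    show "h = h" ..
    show "(h has_derivative (\<lambda>v. L (g' x v))) (at x)" for x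
      unfolding g(2) by (rule bounded_linear.has_derivative[OF L g'(1)])
    show "(\<exists>g. smooth g \<and> (\<lambda>x. L (g' x v)) = (\<lambda>x. L (g x))) \<or> smooth (\<lambda>x. L (g' x v))" for v
      using g'(2)[of v] by blast
  qed
qed

lemma smooth_vector_derivative:
  fixes \<gamma> :: "real \<Rightarrow> 'b::real_normed_vector"
  assumes "smooth \<gamma>"
  shows "(\<gamma> has_vector_derivative vector_derivative \<gamma> (at t)) (at t)"
    "smooth (\<lambda>t. vector_derivative \<gamma> (at t))"
proof -
  obtain \<gamma>' where \<gamma>': "\<And>x. (\<gamma> has_derivative \<gamma>' x) (at x)" "\<And>v. smooth (\<lambda>x. \<gamma>' x v)"
    using smooth_imp_has_derivative[OF assms] by blast
  have *: "(\<gamma> has_vector_derivative \<gamma>' t 1) (at t)" for t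
  proof -
    have "\<gamma>' t h = h *\<^sub>R \<gamma>' t 1" for h
      using linear_scale[OF has_derivative_linear[OF \<gamma>'(1)], of t h 1] by simp
    then show ?thesis
      unfolding has_vector_derivative_def by (intro has_derivative_eq_rhs[OF \<gamma>'(1)] ext)
  qed
  then have "vector_derivative \<gamma> (at t) = \<gamma>' t 1" for t
    by (rule vector_derivative_at)
  then show "(\<gamma> has_vector_derivative vector_derivative \<gamma> (at t)) (at t)"
    "smooth (\<lambda>t. vector_derivative \<gamma> (at t))"
    using * \<gamma>'(2) by simp_all
qed

lemma has_vector_derivative_shift:
  "((\<lambda>u. f (a + u)) has_vector_derivative v) (at (0::real)) \<longleftrightarrow> (f has_vector_derivative v) (at a)"
proof
  assume "(f has_vector_derivative v) (at a)"
  then have *: "(f has_vector_derivative v) (at (a + 0))" by simp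
  have "((\<lambda>u. a + u) has_vector_derivative 1) (at 0)"
    by (auto intro!: derivative_eq_intros)
  from vector_diff_chain_at[OF this *]
  show "((\<lambda>u. f (a + u)) has_vector_derivative v) (at 0)"
    by (simp add: o_def)
next
  assume *: "((\<lambda>u. f (a + u)) has_vector_derivative v) (at 0)"
  have "((\<lambda>u. u - a) has_vector_derivative 1) (at a)"
    by (auto intro!: derivative_eq_intros)
  from vector_diff_chain_at[OF this, of "\<lambda>u. f (a + u)" v] *
  show "(f has_vector_derivative v) (at a)"
    by (simp add: o_def)
qed

lemma velocity_cis: "velocity c (cis t) = vector_derivative (\<lambda>u. c (cis u)) (at t)"
  unfolding velocity_def vector_derivative_def
  using has_vector_derivative_shift[of "\<lambda>u. c (cis u)" t] by (simp add: cis_mult)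

lemma has_velocity:
  assumes "smooth (\<lambda>t::real. c (cis t))"
  shows "((\<lambda>u. c (cis u)) has_vector_derivative velocity c (cis t)) (at t)"
  unfolding velocity_cis by (rule smooth_vector_derivative[OF assms])

lemma diagram_has_velocity:
  assumes "is_diagram D"
  shows "((\<lambda>u. curve D (cis u)) has_vector_derivative velocity (curve D) (cis t)) (at t)"
  using assms has_velocity unfolding is_diagram_def generic_immersion_def by blast

lemma has_velocity_compose:
  assumes \<phi>: "(\<phi> has_derivative \<phi>') (at (c (cis t)))"
    and c: "((\<lambda>u. c (cis u)) has_vector_derivative v) (at t)"
  shows "((\<lambda>u. \<phi> (c (cis u))) has_vector_derivative \<phi>' v) (at t)"
proof -
  have "((\<lambda>u. \<phi> (c (cis u))) has_derivative (\<lambda>h. \<phi>' (h *\<^sub>R v))) (at t)"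
    using has_derivative_compose[OF c[unfolded has_vector_derivative_def] \<phi>] .
  then show ?thesis
    unfolding has_vector_derivative_def linear_scale[OF has_derivative_linear[OF \<phi>]] .
qed

lemma velocity_eqI:
  assumes "((\<lambda>u. c (cis u)) has_vector_derivative v) (at t)"
  shows "velocity c (cis t) = v"
  unfolding velocity_cis using assms by (rule vector_derivative_at)

section \<open>Generic height functions\<close>

text \<open>Sard's theorem for functions of one real variable, in the form needed: the critical values
  together with finitely many exceptions do not exhaust the line.\<close>

lemma regular_value_exists:
  fixes u :: "real \<Rightarrow> real"
  assumes "\<And>t. t \<in> S \<Longrightarrow> (u has_real_derivative 0) (at t)" and "finite B"
  shows "\<exists>m. m \<notin> u ` S \<and> m \<notin> B"
proof (rule ccontr)
  assume "\<not> ?thesis"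
  then have all: "m \<in> u ` S \<or> m \<in> B" for m
    by blast
  \<comment> \<open>the same function on the one-dimensional Cartesian space\<close>
  define g :: "real ^ 1 \<Rightarrow> real ^ 1" where "g x = vec (u (x $ 1))" for x
  define T where "T = {x :: real ^ 1. x $ 1 \<in> S}"
  have "negligible (g ` T)"
  proof (rule baby_Sard)
    show "(g has_derivative (\<lambda>_. 0)) (at x within T)" if "x \<in> T" for x
    proof -
      have "(u has_derivative (\<lambda>_. 0)) (at (x $ 1))"
        using assms(1)[of "x $ 1"] that unfolding T_def has_field_derivative_def
        by (simp add: lambda_zero)
      from has_derivative_compose[OF bounded_linear_imp_has_derivative[OF bounded_linear_vec_nth] this]
      have "((\<lambda>x. u (x $ 1)) has_derivative (\<lambda>_. 0)) (at x)" .
      moreover have "bounded_linear (vec :: real \<Rightarrow> real ^ 1)"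
        by (simp add: linear_conv_bounded_linear[symmetric] linear_iff vec_eq_iff)
      ultimately have "((\<lambda>x. vec (u (x $ 1)) :: real ^ 1) has_derivative (\<lambda>_. vec 0)) (at x)"
        by (rule bounded_linear.has_derivative[rotated])
      then show ?thesis
        unfolding g_def using has_derivative_at_withinI by (simp add: vec_0)
    qed
    have "matrix (\<lambda>_. 0 :: real ^ 1) = (0 :: real ^ 1 ^ 1)"
      by (simp add: matrix_def vec_eq_iff)
    then show "rank (matrix (\<lambda>_::real^1. 0 :: real ^ 1)) < CARD(1)"
      by simp
  qed simp
  moreover have "negligible (vec ` B :: (real ^ 1) set)"
    using assms(2) by (intro negligible_finite) auto
  ultimately have "negligible (g ` T \<union> vec ` B)"
    by (rule negligible_Un)
  moreover have "g ` T \<union> vec ` B = UNIV"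
  proof (intro equalityI subsetI)
    fix y :: "real ^ 1"
    have y: "y = vec (y $ 1)"
      by (simp add: vec_eq_iff)
    from all[of "y $ 1"] show "y \<in> g ` T \<union> vec ` B"
    proof
      assume "y $ 1 \<in> u ` S"
      then obtain t where "t \<in> S" "y $ 1 = u t" by blast
      then have "y = g (vec t)" "vec t \<in> T"
        using y unfolding g_def T_def by simp_all
      then show ?thesis by blast
    qed (use y in blast)
  qed simp
  ultimately show False
    using non_negligible_UNIV by metis
qed

lemma finite_nondegenerate_zeros:
  fixes k :: "real \<Rightarrow> real"
  assumes "\<And>t. (k has_real_derivative k' t) (at t)" and "\<And>t. k t = 0 \<Longrightarrow> k' t \<noteq> 0"
  shows "finite {t \<in> {a..b}. k t = 0}"
proof (rule ccontr)
  assume "infinite {t \<in> {a..b}. k t = 0}"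
  then have "\<exists>x\<in>{a..b}. x islimpt {t \<in> {a..b}. k t = 0}"
    by (rule Heine_Borel_imp_Bolzano_Weierstrass[OF compact_Icc]) auto
  then obtain x where x: "x \<in> {a..b}" "x islimpt {t \<in> {a..b}. k t = 0}"
    by blast
  then have freq: "frequently (\<lambda>t. k t = 0) (at x)"
    unfolding islimpt_conv_frequently_at by (auto elim: frequently_elim1)
  have "k x = 0"
  proof (rule ccontr)
    assume "k x \<noteq> 0"
    have "(k \<longlongrightarrow> k x) (at x)"
      using DERIV_isCont[OF assms(1)] isCont_def by blast
    then have "eventually (\<lambda>t. k t \<noteq> 0) (at x)"
      using \<open>k x \<noteq> 0\<close> by (rule tendsto_imp_eventually_ne)
    then show False
      using freq unfolding frequently_def by blast
  qed
  have "((\<lambda>t. (k t - k x) / (t - x)) \<longlongrightarrow> k' x) (at x)"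
    using assms(1)[of x] unfolding has_field_derivative_iff .
  then have "eventually (\<lambda>t. (k t - k x) / (t - x) \<noteq> 0) (at x)"
    using assms(2)[OF \<open>k x = 0\<close>] by (rule tendsto_imp_eventually_ne)
  then have "eventually (\<lambda>t. k t \<noteq> 0) (at x)"
    using \<open>k x = 0\<close> by (auto elim!: eventually_mono)
  then show False
    using freq unfolding frequently_def by blast
qed

lemma deriv_zero_at_local_extremum:
  fixes f :: "real \<Rightarrow> real"
  assumes "(f has_real_derivative l) (at 0)"
    and "eventually (\<lambda>t. f t \<le> f 0) (at 0) \<or> eventually (\<lambda>t. f 0 \<le> f t) (at 0)"
  shows "l = 0"
  using assms(2)
proof
  assume "eventually (\<lambda>t. f t \<le> f 0) (at 0)"
  then obtain d where "d > 0" "\<forall>t. \<bar>0 - t\<bar> < d \<longrightarrow> f t \<le> f 0"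
    unfolding eventually_at by (auto simp: dist_real_def) (metis order_refl)
  then show ?thesis using DERIV_local_max[OF assms(1)] by blast
next
  assume "eventually (\<lambda>t. f 0 \<le> f t) (at 0)"
  then obtain d where "d > 0" "\<forall>t. \<bar>0 - t\<bar> < d \<longrightarrow> f 0 \<le> f t"
    unfolding eventually_at by (auto simp: dist_real_def) (metis order_refl)
  then show ?thesis using DERIV_local_min[OF assms(1)] by blast
qed

text \<open>A shear changes the height by a multiple of the horizontal coordinate.\<close>

definition shear :: "real \<Rightarrow> complex \<Rightarrow> complex" where
  "shear m z = z - (m * Re z) *\<^sub>R \<i>"

lemma shear_sel [simp]: "Re (shear m z) = Re z" "Im (shear m z) = Im z - m * Re z"
  by (simp_all add: shear_def)

lemma bounded_linear_shear: "bounded_linear (shear m)"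
  by (simp add: linear_conv_bounded_linear[symmetric] linear_iff complex_eq_iff algebra_simps)

lemma shear_shear: "shear m (shear (- m) z) = z" "shear (- m) (shear m z) = z"
  by (simp_all add: complex_eq_iff)

lemma wedge_shear: "wedge (shear m u) (shear m v) = wedge u v"
  by (simp add: wedge_def algebra_simps)

lemma plane_diffeo_shear: "plane_diffeo (shear m)"
proof -
  have "inv (shear m) = shear (- m)"
    by (rule inv_equality) (simp_all add: shear_shear)
  moreover have "bij (shear m)"
    using shear_shear by (metis bijI')
  ultimately show ?thesis
    unfolding plane_diffeo_def using smooth_bounded_linear[OF bounded_linear_shear] by simp
qed

lemma smooth_shear_isotopy: "smooth (\<lambda>(s, z). shear (s * m) z)"
proof (rule smoothI)
  show "((\<lambda>(s, z). shear (s * m) z) has_derivative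
      (\<lambda>(\<sigma>, w). w - (\<sigma> * m * Re (snd p) + fst p * m * Re w) *\<^sub>R \<i>)) (at p)" for p
    unfolding shear_def case_prod_beta
    by (auto intro!: derivative_eq_intros simp: fun_eq_iff algebra_simps)
  show "smooth (\<lambda>p. (\<lambda>(\<sigma>, w). w - (\<sigma> * m * Re (snd p) + fst p * m * Re w) *\<^sub>R \<i>) v)" for v
  proof -
    obtain \<sigma> w where v: "v = (\<sigma>, w)" by (cases v)
    have "bounded_linear (\<lambda>p :: real \<times> complex. - (\<sigma> * m * Re (snd p) + fst p * m * Re w) *\<^sub>R \<i>)"
      by (simp add: linear_conv_bounded_linear[symmetric] linear_iff complex_eq_iff algebra_simps)
    from smooth_affine[OF this, of w] show ?thesis
      unfolding v by (simp add: algebra_simps)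
  qed
qed

text \<open>After the shear by \<open>m\<close> the critical points of the height are the points of slope \<open>m\<close> of the
  original curve. They are nondegenerate if \<open>m\<close> is a regular value of the slope, and they avoid the
  double points if \<open>m\<close> is not one of the finitely many slopes there.\<close>

lemma morse_position_exists:
  assumes D: "is_diagram D"
  shows "\<exists>D'. is_diagram D' \<and> planar_isotopic D D' \<and> morse_position D'"
proof -
  define \<gamma> where "\<gamma> t = curve D (cis t)" for t
  have gi: "generic_immersion (curve D)" and smooth: "smooth \<gamma>"
    using D unfolding is_diagram_def generic_immersion_def \<gamma>_def by auto
  define \<gamma>' where "\<gamma>' t = vector_derivative \<gamma> (at t)" for t
  define \<gamma>'' where "\<gamma>'' t = vector_derivative \<gamma>' (at t)" for t
  have d1: "(\<gamma> has_vector_derivative \<gamma>' t) (at t)" and d2: "(\<gamma>' has_vector_derivative \<gamma>'' t) (at t)" for t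
    using smooth_vector_derivative[OF smooth] smooth_vector_derivative[of \<gamma>'] unfolding \<gamma>'_def \<gamma>''_def by auto
  have vel: "velocity (curve D) (cis t) = \<gamma>' t" for t
    unfolding velocity_cis \<gamma>'_def \<gamma>_def ..
  have nz: "\<gamma>' t \<noteq> 0" for t
    using gi vel unfolding generic_immersion_def by (metis cis_in_circle)
  have Re1: "((\<lambda>t. Re (\<gamma> t)) has_real_derivative Re (\<gamma>' t)) (at t)"
    and Im1: "((\<lambda>t. Im (\<gamma> t)) has_real_derivative Im (\<gamma>' t)) (at t)"
    and Re2: "((\<lambda>t. Re (\<gamma>' t)) has_real_derivative Re (\<gamma>'' t)) (at t)"
    and Im2: "((\<lambda>t. Im (\<gamma>' t)) has_real_derivative Im (\<gamma>'' t)) (at t)" for t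
    using d1[of t] d2[of t] has_vector_derivative_complex_iff
    by (auto simp: has_real_derivative_iff_has_vector_derivative)
  \<comment> \<open>the critical points of the slope, and the slopes at double points; a vertical tangent has
    value 0 in the second set, which does no harm\<close>
  define S where "S = {t. Re (\<gamma>' t) \<noteq> 0 \<and> Im (\<gamma>'' t) * Re (\<gamma>' t) = Im (\<gamma>' t) * Re (\<gamma>'' t)}"
  define B where "B = (\<lambda>p. Im (velocity (curve D) p) / Re (velocity (curve D) p)) `
    fst ` {(p, q). double_point (curve D) p q}"
  have "finite B"
    using gi unfolding B_def generic_immersion_def by blast
  moreover have "((\<lambda>t. Im (\<gamma>' t) / Re (\<gamma>' t)) has_real_derivative 0) (at t)" if "t \<in> S" for t
    using that DERIV_divide[OF Im2 Re2, of t] unfolding S_def by simp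
  ultimately obtain m where m: "m \<notin> (\<lambda>t. Im (\<gamma>' t) / Re (\<gamma>' t)) ` S" "m \<notin> B"
    using regular_value_exists[of S "\<lambda>t. Im (\<gamma>' t) / Re (\<gamma>' t)" B] by blast
  define k where "k t = Im (\<gamma>' t) - m * Re (\<gamma>' t)" for t
  define k' where "k' t = Im (\<gamma>'' t) - m * Re (\<gamma>'' t)" for t
  have k: "(k has_real_derivative k' t) (at t)" for t
    unfolding k_def k'_def by (intro DERIV_diff DERIV_cmult Re2 Im2)
  \<comment> \<open>\<open>k\<close> is the derivative of the height after the shear\<close>
  have k_zero: "Re (\<gamma>' t) \<noteq> 0 \<and> m = Im (\<gamma>' t) / Re (\<gamma>' t)" if "k t = 0" for t
  proof -
    have "Re (\<gamma>' t) \<noteq> 0"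
      using that nz[of t] unfolding k_def by (auto simp: complex_eq_iff)
    then show ?thesis
      using that unfolding k_def by (simp add: field_simps)
  qed
  have k_nondeg: "k' t \<noteq> 0" if "k t = 0" for t
  proof
    assume "k' t = 0"
    then have "Im (\<gamma>'' t) = m * Re (\<gamma>'' t)" "Im (\<gamma>' t) = m * Re (\<gamma>' t)"
      using that unfolding k_def k'_def by auto
    then have "Im (\<gamma>'' t) * Re (\<gamma>' t) = Im (\<gamma>' t) * Re (\<gamma>'' t)"
      by (simp only: mult.commute mult.left_commute)
    then have "t \<in> S"
      using conjunct1[OF k_zero[OF that]] unfolding S_def by blast
    then show False
      using m(1) k_zero[OF that] by blast
  qed
  define D' where "D' = D\<lparr>curve := \<lambda>p. shear m (curve D p)\<rparr>"
  have curve: "curve D' = (\<lambda>p. shear m (curve D p))" and over: "over_pts D' = over_pts D"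
    unfolding D'_def by simp_all
  have dp: "double_point (curve D') p q = double_point (curve D) p q" for p q
    unfolding curve double_point_def using shear_shear by metis
  have hv: "((\<lambda>u. shear m (curve D (cis u))) has_vector_derivative shear m (\<gamma>' t)) (at t)" for t
    by (rule has_velocity_compose[OF bounded_linear_imp_has_derivative[OF bounded_linear_shear]])
      (use d1 in \<open>simp add: \<gamma>_def[abs_def]\<close>)
  have vel': "velocity (curve D') (cis t) = shear m (\<gamma>' t)" for t
    unfolding curve by (rule velocity_eqI[OF hv])
  have shear_nz: "shear m z \<noteq> 0" if "z \<noteq> 0" for z
    using that by (auto simp: complex_eq_iff)
  have "generic_immersion (curve D')"
    unfolding generic_immersion_def
  proof (intro conjI)
    show "smooth (\<lambda>t::real. curve D' (cis t))"
      unfolding curve using smooth_bounded_linear_compose[OF bounded_linear_shear smooth] by (simp add: \<gamma>_def)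
    show "\<forall>p\<in>circle. velocity (curve D') p \<noteq> 0"
      using vel' nz shear_nz by (metis circle_cases)
    show "finite {(p, q). double_point (curve D') p q}"
      using gi unfolding dp generic_immersion_def by blast
    show "\<forall>p q r. double_point (curve D') p q \<and> double_point (curve D') p r \<longrightarrow> q = r"
      using gi unfolding dp generic_immersion_def by blast
    show "\<forall>p q. double_point (curve D') p q \<longrightarrow> wedge (velocity (curve D') p) (velocity (curve D') q) \<noteq> 0"
    proof (intro allI impI)
      fix p q assume "double_point (curve D') p q"
      then have d: "double_point (curve D) p q" by (simp add: dp)
      then obtain s t where "p = cis s" "q = cis t"
        using circle_cases unfolding double_point_def by metis
      then show "wedge (velocity (curve D') p) (velocity (curve D') q) \<noteq> 0"
        using gi d vel vel' wedge_shear unfolding generic_immersion_def by metis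
    qed
  qed
  then have D': "is_diagram D'"
    using D unfolding is_diagram_def dp over by simp
  have iso: "planar_isotopic D D'"
    unfolding planar_isotopic_def
  proof (intro exI[of _ "\<lambda>s. shear (s * m)"] conjI)
    show "smooth (\<lambda>(s, z). shear (s * m) z)"
      by (rule smooth_shear_isotopy)
    show "shear (0 * m) = id"
      by (auto simp: fun_eq_iff complex_eq_iff)
  qed (simp_all add: plane_diffeo_shear curve over)
  have h1: "((\<lambda>t. height D' (cis a) t) has_real_derivative k (a + t)) (at t)" for a t
  proof -
    have "((\<lambda>t. Im (\<gamma> t) - m * Re (\<gamma> t)) has_real_derivative k (a + t)) (at (a + t))"
      unfolding k_def by (intro DERIV_diff DERIV_cmult Re1 Im1)
    then have "((\<lambda>t. Im (\<gamma> (a + t)) - m * Re (\<gamma> (a + t))) has_real_derivative k (a + t)) (at t)"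
      using DERIV_shift[of "\<lambda>t. Im (\<gamma> t) - m * Re (\<gamma> t)" "k (a + t)" t a]
      by (simp add: add.commute)
    then show ?thesis
      unfolding height_def curve \<gamma>_def by (simp add: cis_mult)
  qed
  have h2: "deriv (deriv (height D' (cis a))) 0 = k' a" for a
  proof -
    have "deriv (height D' (cis a)) = (\<lambda>t. k (a + t))"
      using h1[of a] DERIV_imp_deriv by blast
    moreover have "((\<lambda>t. k (a + t)) has_real_derivative k' (a + 0)) (at 0)"
      using k[of a] DERIV_shift[of k "k' a" 0 a] by (simp add: add.commute)
    ultimately show ?thesis
      using DERIV_imp_deriv by fastforce
  qed
  have crit: "k a = 0" if "cis a \<in> local_maxima D' \<union> local_minima D'" for a
    using deriv_zero_at_local_extremum[OF h1[of a 0]] that unfolding local_maxima_def local_minima_def by auto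
  have sub: "local_maxima D' \<union> local_minima D' \<subseteq> cis ` {t \<in> {-pi..pi}. k t = 0}"
  proof
    fix p assume p: "p \<in> local_maxima D' \<union> local_minima D'"
    then have "p \<in> circle"
      unfolding local_maxima_def local_minima_def by blast
    then have "p = cis (Arg p)"
      by (rule circle_eq_cis)
    moreover have "Arg p \<in> {-pi..pi}"
      using Arg_bounded[of p] by auto
    ultimately show "p \<in> cis ` {t \<in> {-pi..pi}. k t = 0}"
      using crit[of "Arg p"] p by auto
  qed
  have "finite (local_maxima D' \<union> local_minima D')"
    by (rule finite_subset[OF sub]) (intro finite_imageI finite_nondegenerate_zeros[OF k k_nondeg])
  moreover have "deriv (deriv (height D' p)) 0 \<noteq> 0 \<and> (\<forall>q. \<not> double_point (curve D') p q)"
    if p: "p \<in> local_maxima D' \<union> local_minima D'" for p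
  proof -
    obtain a where a: "p = cis a" "k a = 0"
      using sub p by blast
    have "\<not> double_point (curve D') p q" for q
    proof
      assume "double_point (curve D') p q"
      then have "Im (\<gamma>' a) / Re (\<gamma>' a) \<in> B"
        unfolding dp B_def using a(1) vel by (metis (mono_tags, lifting) case_prodI fst_conv imageI mem_Collect_eq)
      then show False
        using m(2) k_zero[OF a(2)] by metis
    qed
    then show ?thesis
      using h2 k_nondeg[OF a(2)] a(1) by simp
  qed
  ultimately have "morse_position D'"
    unfolding morse_position_def by simp
  then show ?thesis
    using D' iso by blast
qed

section \<open>Planar isotopy and change of parameter\<close>

lemma colorings_cong:
  assumes "\<And>p q. classical_crossing D' p q \<longleftrightarrow> classical_crossing D p q"
    and "\<And>p q. classical_crossing D p q \<Longrightarrow> positive D' p q = positive D p q"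
  shows "colorings X R D' = colorings X R D"
proof -
  have "crossing_points D' = crossing_points D"
    unfolding crossing_points_def assms(1) ..
  moreover have "(\<forall>p q. classical_crossing D' p q \<longrightarrow> R (positive D' p q) (before F q) (F q) (before F p) (F p)) \<longleftrightarrow>
      (\<forall>p q. classical_crossing D p q \<longrightarrow> R (positive D p q) (before F q) (F q) (before F p) (F p))"
    for F :: "complex \<Rightarrow> 'a"
    using assms by auto
  ultimately show ?thesis
    unfolding colorings_def by simp
qed

lemma wedge_linear:
  assumes "linear L"
  shows "wedge (L u) (L v) = wedge (L 1) (L \<i>) * wedge u v"
proof -
  have L: "L z = Re z *\<^sub>R L 1 + Im z *\<^sub>R L \<i>" for z
  proof -
    have "z = Re z *\<^sub>R 1 + Im z *\<^sub>R \<i>"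
      by (simp add: complex_eq_iff)
    then have "L z = L (Re z *\<^sub>R 1 + Im z *\<^sub>R \<i>)" by simp
    then show ?thesis
      by (simp only: linear_add[OF assms] linear_scale[OF assms])
  qed
  show ?thesis
    unfolding L[of u] L[of v] by (simp add: wedge_def algebra_simps)
qed

lemma wedge_scaleR: "wedge (a *\<^sub>R u) (b *\<^sub>R v) = a * b * wedge u v"
  by (simp add: wedge_def algebra_simps)

text \<open>The Jacobian determinant of a diffeomorphism does not vanish.\<close>

lemma plane_diffeo_derivative_wedge_nonzero:
  assumes \<phi>: "plane_diffeo \<phi>" and d: "(\<phi> has_derivative L) (at z)"
  shows "wedge (L 1) (L \<i>) \<noteq> 0"
proof
  assume 0: "wedge (L 1) (L \<i>) = 0"
  obtain M where M: "\<And>x. (inv \<phi> has_derivative M x) (at x)"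
    using \<phi> smooth_imp_has_derivative unfolding plane_diffeo_def by metis
  have "inj \<phi>"
    using \<phi> unfolding plane_diffeo_def bij_def by blast
  have "((\<lambda>z. inv \<phi> (\<phi> z)) has_derivative (\<lambda>v. M (\<phi> z) (L v))) (at z)"
    using has_derivative_compose[OF d M] .
  then have "((\<lambda>z. z) has_derivative (\<lambda>v. M (\<phi> z) (L v))) (at z)"
    using \<open>inj \<phi>\<close> by simp
  then have "(\<lambda>v. M (\<phi> z) (L v)) = (\<lambda>v. v)"
    using has_derivative_unique has_derivative_ident by blast
  then have "wedge 1 \<i> = wedge (M (\<phi> z) (L 1)) (M (\<phi> z) (L \<i>))"
    by metis
  also have "\<dots> = 0"
    using wedge_linear[OF has_derivative_linear[OF M]] 0 by (metis mult_zero_right)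
  finally show False
    by (simp add: wedge_def)
qed

text \<open>The maps of a planar isotopy are not assumed to preserve the orientation; they do because the
  Jacobian determinant is a continuous function of time, without zeros, and starts at \<open>1\<close>.\<close>

lemma card_colorings_planar_isotopic:
  assumes D: "is_diagram D" and iso: "planar_isotopic D D'"
  shows "card (colorings X R D) = card (colorings X R D')"
proof -
  obtain H where H: "smooth (\<lambda>(s, z). H s z)" "\<And>s. plane_diffeo (H s)" "H 0 = id"
    "\<And>p. p \<in> circle \<Longrightarrow> curve D' p = H (1::real) (curve D p)" "over_pts D' = over_pts D"
    using iso unfolding planar_isotopic_def by blast
  obtain G where G: "\<And>x. ((\<lambda>(s, z). H s z) has_derivative G x) (at x)" "\<And>v. smooth (\<lambda>x. G x v)"
    using smooth_imp_has_derivative[OF H(1)] by metis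
  have dH: "(H s has_derivative (\<lambda>v. G (s, z) (0, v))) (at z)" for s z
  proof -
    have "((\<lambda>z. (s, z)) has_derivative (\<lambda>v. (0, v))) (at z)"
      by (auto intro!: derivative_eq_intros)
    from has_derivative_compose[OF this G(1)] show ?thesis by simp
  qed
  have pos: "wedge (G (1, z) (0, 1)) (G (1, z) (0, \<i>)) > 0" for z
  proof (rule ccontr)
    let ?d = "\<lambda>s. wedge (G (s, z) (0, 1)) (G (s, z) (0, \<i>))"
    assume neg: "\<not> ?d 1 > 0"
    have cont: "isCont (\<lambda>s. G (s, z) v) s" for s v
      by (rule isCont_o2[where f="\<lambda>s. (s, z)", OF _ smooth_imp_isCont[OF G(2)]]) (intro continuous_intros)
    have "isCont ?d s" for s
      unfolding wedge_def by (intro isCont_diff isCont_mult isCont_Re isCont_Im cont)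
    moreover have "?d 0 = 1"
    proof -
      have "(H 0 has_derivative (\<lambda>v. v)) (at z)"
        unfolding H(3) id_def by (rule has_derivative_ident)
      then have "(\<lambda>v. G (0, z) (0, v)) = (\<lambda>v. v)"
        using has_derivative_unique dH by blast
      then have "G (0, z) (0, v) = v" for v
        by metis
      then show ?thesis
        by (simp add: wedge_def)
    qed
    ultimately have "\<exists>s\<ge>0. s \<le> 1 \<and> ?d s = 0"
      using neg by (intro IVT2) auto
    then show False
      using plane_diffeo_derivative_wedge_nonzero[OF H(2) dH] by blast
  qed
  have vel: "velocity (curve D') p = G (1, curve D p) (0, velocity (curve D) p)" if "p \<in> circle" for p
  proof -
    obtain t where t: "p = cis t" using \<open>p \<in> circle\<close> by (rule circle_cases)
    have "(\<lambda>u. curve D' (cis u)) = (\<lambda>u. H 1 (curve D (cis u)))"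
      using H(4) by simp
    then have "((\<lambda>u. curve D' (cis u)) has_vector_derivative
        G (1, curve D (cis t)) (0, velocity (curve D) (cis t))) (at t)"
      using has_velocity_compose[OF dH diagram_has_velocity[OF D]] by simp
    then show ?thesis
      unfolding t by (rule velocity_eqI)
  qed
  have inj: "H 1 x = H 1 y \<longleftrightarrow> x = y" for x y
    using H(2)[of 1] unfolding plane_diffeo_def bij_def inj_on_def by blast
  have "classical_crossing D' p q \<longleftrightarrow> classical_crossing D p q" for p q
    unfolding classical_crossing_def double_point_def using H(4,5) inj by auto
  moreover have "positive D' p q = positive D p q" if "classical_crossing D p q" for p q
  proof -
    have pq: "p \<in> circle" "q \<in> circle" "curve D p = curve D q"
      using that unfolding classical_crossing_def double_point_def by auto
    have "velocity (curve D') p = G (1, curve D q) (0, velocity (curve D) p)"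
      "velocity (curve D') q = G (1, curve D q) (0, velocity (curve D) q)"
      using vel pq by simp_all
    then have "wedge (velocity (curve D') p) (velocity (curve D') q) =
        wedge (G (1, curve D q) (0, 1)) (G (1, curve D q) (0, \<i>)) *
        wedge (velocity (curve D) p) (velocity (curve D) q)"
      by (simp only: wedge_linear[OF has_derivative_linear[OF dH],
            of _ _ "velocity (curve D) p" "velocity (curve D) q"])
    then show ?thesis
      unfolding positive_def using pos[of "curve D q"] by (simp add: zero_less_mult_iff)
  qed
  ultimately show ?thesis
    using colorings_cong[of D' D X R] by simp
qed

lemma coloring_reparametrize:
  fixes f :: "real \<Rightarrow> real"
  assumes mono: "strict_mono f" and cont: "\<And>t. isCont f t" and "surj f"
    and g: "\<And>t. g (cis t) = cis (f t)"
    and cc: "\<And>p q. p \<in> circle \<Longrightarrow> q \<in> circle \<Longrightarrow> classical_crossing D' p q \<longleftrightarrow> classical_crossing D (g p) (g q)"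
    and pos: "\<And>p q. classical_crossing D' p q \<Longrightarrow> positive D' p q = positive D (g p) (g q)"
    and F: "F \<in> colorings X R D"
  shows "(\<lambda>p\<in>circle. F (g p)) \<in> colorings X R D'"
proof -
  let ?F = "\<lambda>p\<in>circle. F (g p)"
  have g_circle: "g p \<in> circle" if "p \<in> circle" for p
    using that g by (metis circle_cases cis_in_circle)
  have g_surj: "\<exists>p\<in>circle. q = g p" if "q \<in> circle" for q
  proof -
    obtain t where "q = cis t" using \<open>q \<in> circle\<close> by (rule circle_cases)
    moreover obtain s where "t = f s" using \<open>surj f\<close> by (metis surjD)
    ultimately show ?thesis using g by (metis cis_in_circle)
  qed
  have ev: "eventually (\<lambda>s. ?F (p * cis s) = F (g p)) (at_right 0)"
    "eventually (\<lambda>s. ?F (p * cis s) = before F (g p)) (at_left 0)" if p: "p \<in> circle" for p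
  proof -
    obtain t where t: "p = cis t" using \<open>p \<in> circle\<close> by (rule circle_cases)
    let ?d = "\<lambda>s. f (t + s) - f t"
    have eq: "?F (p * cis s) = F (g p * cis (?d s))" for s
      using t g[of "t + s"] g[of t] by (simp add: cis_mult)
    have lim: "(?d \<longlongrightarrow> 0) (at 0)"
      using cont[of t] unfolding isCont_iff by (simp add: LIM_zero)
    have "filterlim ?d (at_right 0) (at_right 0)" "filterlim ?d (at_left 0) (at_left 0)"
      unfolding filterlim_at using lim mono
      by (auto simp: filterlim_at_split eventually_at_filter strict_mono_less strict_mono_eq[OF mono])
    moreover have "eventually (\<lambda>s. F (g p * cis s) = F (g p)) (at_right 0)"
      "eventually (\<lambda>s. F (g p * cis s) = before F (g p)) (at_left 0)"
      using F g_circle[OF p] unfolding colorings_def by blast+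
    ultimately show "eventually (\<lambda>s. ?F (p * cis s) = F (g p)) (at_right 0)"
      "eventually (\<lambda>s. ?F (p * cis s) = before F (g p)) (at_left 0)"
      unfolding eq using eventually_compose_filterlim by blast+
  qed
  have bef: "before ?F p = before F (g p)" if "p \<in> circle" for p
    using before_eqI[OF ev(2)[OF that]] .
  have "g p \<notin> crossing_points D" if p: "p \<in> circle" "p \<notin> crossing_points D'" for p
  proof
    assume "g p \<in> crossing_points D"
    then obtain q where q: "classical_crossing D (g p) q \<or> classical_crossing D q (g p)"
      unfolding crossing_points_def by blast
    then have "q \<in> circle"
      unfolding classical_crossing_def double_point_def by blast
    then obtain r where "r \<in> circle" "q = g r" using g_surj by blast
    then show False
      using q cc p unfolding crossing_points_def by blast
  qed
  moreover have "?F \<in> circle \<rightarrow>\<^sub>E X"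
    using F g_circle unfolding colorings_def by auto
  moreover have "R (positive D' p q) (before ?F q) (?F q) (before ?F p) (?F p)"
    if c: "classical_crossing D' p q" for p q
  proof -
    have pq: "p \<in> circle" "q \<in> circle"
      using c unfolding classical_crossing_def double_point_def by auto
    then have "classical_crossing D (g p) (g q)"
      using c cc by blast
    then have "R (positive D (g p) (g q)) (before F (g q)) (F (g q)) (before F (g p)) (F (g p))"
      using F unfolding colorings_def by blast
    then show ?thesis
      using pos[OF c] bef pq by simp
  qed
  moreover have "before F (g p) = F (g p)" if "p \<in> circle" "g p \<notin> crossing_points D" for p
    using F g_circle[OF that(1)] that(2) unfolding colorings_def by blast
  ultimately show ?thesis
    unfolding colorings_def using ev bef by auto
qed

lemma quasiperiodic_int:
  fixes f :: "real \<Rightarrow> real"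
  assumes "\<And>t. f (t + c) = f t + c"
  shows "f (t + of_int k * c) = f t + of_int k * c"
proof (induction k rule: int_induct[where k=0])
  case (step1 i)
  then show ?case
    using assms[of "t + of_int i * c"] by (simp add: algebra_simps)
next
  case (step2 i)
  then show ?case
    using assms[of "t + of_int (i - 1) * c"] by (simp add: algebra_simps)
qed simp

lemma cis_eq_imp:
  assumes "cis a = cis b"
  obtains k :: int where "a = b + of_int k * (2 * pi)"
proof -
  have "cis (a - b) = 1"
    using assms by (simp add: cis_divide[symmetric])
  then have "cos (a - b) = 1"
    by (simp add: complex_eq_iff)
  then obtain k :: int where "a - b = of_int k * 2 * pi"
    using cos_one_2pi_int by blast
  then show ?thesis
    by (intro that[of k]) (simp add: algebra_simps)
qed

lemma quasiperiodic_circle_map: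
  fixes f :: "real \<Rightarrow> real"
  assumes "\<And>t. f (t + 2 * pi) = f t + 2 * pi"
  shows "cis (f (Arg (cis t))) = cis (f t)"
proof -
  have "cis t = cis (Arg (cis t))"
    by (rule circle_eq_cis) simp
  then obtain k where k: "t = Arg (cis t) + of_int k * (2 * pi)"
    by (rule cis_eq_imp)
  have "f t = f (Arg (cis t)) + of_int k * (2 * pi)"
    using quasiperiodic_int[of f "2 * pi", OF assms, of "Arg (cis t)" k] k by simp
  moreover have "cis (of_int k * (2 * pi)) = 1"
    using cis_multiple_2pi[of "of_int k"] by (simp add: mult.commute mult.left_commute)
  ultimately show ?thesis
    by (simp add: cis_mult[symmetric])
qed

lemma card_colorings_reparametrized:
  assumes D: "is_diagram D" and re: "reparametrized D D'"
  shows "card (colorings X R D) = card (colorings X R D')"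
proof -
  obtain f where f: "smooth f" "\<And>t. 0 < deriv f t" "\<And>t. f (t + 2 * pi) = f t + 2 * pi"
    "\<And>t. curve D' (cis t) = curve D (cis (f t))"
    "\<And>t. cis t \<in> over_pts D' \<longleftrightarrow> cis (f t) \<in> over_pts D"
    using re unfolding reparametrized_def by blast
  have df: "(f has_real_derivative deriv f t) (at t)" for t
    using smooth_vector_derivative(1)[OF f(1), of t]
    unfolding has_real_derivative_iff_has_vector_derivative[symmetric]
    by (metis DERIV_imp_deriv)
  have cont: "isCont f t" for t
    using df DERIV_isCont by blast
  have mono: "strict_mono f"
    using df f(2) by (metis DERIV_pos_imp_increasing strict_monoI)
  have "surj f"
  proof
    show "UNIV \<subseteq> range f"
    proof
      fix y
      obtain k :: int where k: "of_int k \<ge> \<bar>y - f 0\<bar> / (2 * pi)"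
        using ex_le_of_int by blast
      then have "\<bar>y - f 0\<bar> \<le> of_int k * (2 * pi)"
        by (simp add: divide_le_eq)
      then have *: "f (0 + of_int (- k) * (2 * pi)) \<le> y" "y \<le> f (0 + of_int k * (2 * pi))"
        unfolding quasiperiodic_int[of f "2 * pi", OF f(3)] by simp_all
      moreover have "0 + of_int (- k) * (2 * pi) \<le> 0 + of_int k * (2 * pi)"
        using order_trans[OF *] unfolding strict_mono_less_eq[OF mono] .
      ultimately have "\<exists>x\<ge>0 + of_int (- k) * (2 * pi). x \<le> 0 + of_int k * (2 * pi) \<and> f x = y"
        using cont by (intro IVT) auto
      then show "y \<in> range f" by blast
    qed
  qed simp
  \<comment> \<open>the inverse change of parameter gives the inverse map of colorings; its smoothness is not needed\<close>
  define h where "h = inv f"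
  have inj: "inj f"
    using mono strict_mono_imp_inj_on by blast
  have fh: "f (h t) = t" and hf: "h (f t) = t" for t
    unfolding h_def using \<open>surj f\<close> inj by (simp_all add: surj_f_inv_f)
  have h_mono: "strict_mono h"
    using mono fh by (metis strict_mono_less strict_monoI)
  have h_cont: "isCont h t" for t
  proof -
    have "isCont h (f (h t))"
      by (rule isCont_inverse_function[of 1 "h t" h f]) (use hf cont in auto)
    then show ?thesis by (simp only: fh)
  qed
  have h_quasi: "h (t + 2 * pi) = h t + 2 * pi" for t
    using hf[of "h t + 2 * pi"] f(3)[of "h t"] fh[of t] by simp
  have "surj h"
    using hf by (metis surjI)
  define g where "g p = cis (f (Arg p))" for p
  define g' where "g' p = cis (h (Arg p))" for p
  have g: "g (cis t) = cis (f t)" and g': "g' (cis t) = cis (h t)" for t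
    unfolding g_def g'_def using quasiperiodic_circle_map f(3) h_quasi by blast+
  have gg': "g (g' p) = p" and g'g: "g' (g p) = p" and gc: "g p \<in> circle" and g'c: "g' p \<in> circle"
    if "p \<in> circle" for p
  proof -
    obtain t where "p = cis t" using \<open>p \<in> circle\<close> by (rule circle_cases)
    then show "g (g' p) = p" "g' (g p) = p" "g p \<in> circle" "g' p \<in> circle"
      using g g' fh hf by auto
  qed
  have curve: "curve D' p = curve D (g p)" and over: "p \<in> over_pts D' \<longleftrightarrow> g p \<in> over_pts D"
    if "p \<in> circle" for p
  proof -
    obtain t where "p = cis t" using \<open>p \<in> circle\<close> by (rule circle_cases)
    then show "curve D' p = curve D (g p)" "p \<in> over_pts D' \<longleftrightarrow> g p \<in> over_pts D"
      using f(4,5) g by auto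
  qed
  have inj_g: "g p = g q \<longleftrightarrow> p = q" if "p \<in> circle" "q \<in> circle" for p q
    using g'g that by metis
  have cc: "classical_crossing D' p q \<longleftrightarrow> classical_crossing D (g p) (g q)"
    if "p \<in> circle" "q \<in> circle" for p q
    unfolding classical_crossing_def double_point_def
    using that curve over inj_g gc by auto
  have vel: "\<exists>a>0. velocity (curve D') p = a *\<^sub>R velocity (curve D) (g p)" if "p \<in> circle" for p
  proof -
    obtain t where t: "p = cis t" using \<open>p \<in> circle\<close> by (rule circle_cases)
    have "((\<lambda>u. curve D (cis u)) \<circ> f has_vector_derivative
        deriv f t *\<^sub>R velocity (curve D) (cis (f t))) (at t)"
      using df[of t] unfolding has_real_derivative_iff_has_vector_derivative
      by (rule vector_diff_chain_at[OF _ diagram_has_velocity[OF D]])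
    then have "((\<lambda>u. curve D' (cis u)) has_vector_derivative
        deriv f t *\<^sub>R velocity (curve D) (cis (f t))) (at t)"
      using f(4) by (simp add: o_def)
    then have "velocity (curve D') p = deriv f t *\<^sub>R velocity (curve D) (g p)"
      unfolding t g by (rule velocity_eqI)
    then show ?thesis
      using f(2) by blast
  qed
  have pos: "positive D' p q = positive D (g p) (g q)" if "classical_crossing D' p q" for p q
  proof -
    have "p \<in> circle" "q \<in> circle"
      using that unfolding classical_crossing_def double_point_def by auto
    then obtain a b where "a > 0" "b > 0" "velocity (curve D') p = a *\<^sub>R velocity (curve D) (g p)"
      "velocity (curve D') q = b *\<^sub>R velocity (curve D) (g q)"
      using vel by meson
    then show ?thesis
      unfolding positive_def by (auto simp: wedge_scaleR zero_less_mult_iff mult_less_0_iff)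
  qed
  let ?A = "\<lambda>F. \<lambda>p\<in>circle. F (g p)" and ?B = "\<lambda>F. \<lambda>p\<in>circle. F (g' p)"
  have "bij_betw ?A (colorings X R D) (colorings X R D')"
  proof (rule bij_betw_byWitness[where f'="?B"])
    have PE: "F \<in> circle \<rightarrow>\<^sub>E X" if "F \<in> colorings X R E" for F E
      using that unfolding colorings_def by blast
    show "\<forall>F\<in>colorings X R D. ?B (?A F) = F"
    proof
      fix F assume "F \<in> colorings X R D"
      then have F: "F \<in> circle \<rightarrow>\<^sub>E X" by (rule PE)
      show "?B (?A F) = F"
      proof
        fix p show "?B (?A F) p = F p"
          using F gg' g'c by (cases "p \<in> circle") (auto simp: PiE_def extensional_def)
      qed
    qed
    show "\<forall>F\<in>colorings X R D'. ?A (?B F) = F"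
    proof
      fix F assume "F \<in> colorings X R D'"
      then have F: "F \<in> circle \<rightarrow>\<^sub>E X" by (rule PE)
      show "?A (?B F) = F"
      proof
        fix p show "?A (?B F) p = F p"
          using F g'g gc by (cases "p \<in> circle") (auto simp: PiE_def extensional_def)
      qed
    qed
    show "?A ` colorings X R D \<subseteq> colorings X R D'"
      using coloring_reparametrize[of f g D' D _ X R, OF mono cont \<open>surj f\<close> g cc pos] by blast
    have cc': "classical_crossing D p q \<longleftrightarrow> classical_crossing D' (g' p) (g' q)"
      if "p \<in> circle" "q \<in> circle" for p q
      using cc[OF g'c g'c] gg' that by simp
    have pos': "positive D p q = positive D' (g' p) (g' q)" if "classical_crossing D p q" for p q
    proof -
      have pq: "p \<in> circle" "q \<in> circle"
        using that unfolding classical_crossing_def double_point_def by auto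
      then show ?thesis
        using pos[of "g' p" "g' q"] cc' gg' that by simp
    qed
    show "?B ` colorings X R D' \<subseteq> colorings X R D"
      using coloring_reparametrize[of h g' D D' _ X R, OF h_mono h_cont \<open>surj h\<close> g' cc' pos'] by blast
  qed
  then show ?thesis
    by (rule bij_betw_same_card)
qed

section \<open>Cutting and gluing colorings along a disc\<close>

lemma cis_inj_on_period:
  assumes "a \<le> s" "s < a + 2 * pi" "a \<le> t" "t < a + 2 * pi" "cis s = cis t"
  shows "s = t"
proof -
  obtain k :: int where k: "s = t + of_int k * (2 * pi)"
    using cis_eq_imp[OF assms(5)] .
  then have "\<bar>of_int k * (2 * pi)\<bar> < 2 * pi"
    using assms by auto
  then have "\<bar>of_int k :: real\<bar> < 1"
    by (simp add: abs_mult)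
  then have "k = 0" by linarith
  then show ?thesis using k by simp
qed

text \<open>Finitely many disjoint proper closed arcs of the circle.\<close>

definition arc_system :: "(real \<times> real) set \<Rightarrow> bool" where
  "arc_system \<I> \<longleftrightarrow> finite \<I> \<and> (\<forall>I\<in>\<I>. fst I < snd I \<and> snd I < fst I + 2 * pi) \<and>
     pairwise (\<lambda>I J. closed_arc I \<inter> closed_arc J = {}) \<I>"

lemma arc_system_inj:
  assumes "arc_system \<I>" "I \<in> \<I>" "J \<in> \<I>" "s \<in> {fst I..snd I}" "t \<in> {fst J..snd J}" "cis s = cis t"
  shows "I = J \<and> s = t"
proof -
  have "cis s \<in> closed_arc I"
    using assms(4) unfolding closed_arc_def by blast
  moreover have "cis s \<in> closed_arc J"
    using assms(5,6) unfolding closed_arc_def by blast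
  ultimately have "I = J"
    using assms(1-3) unfolding arc_system_def pairwise_def by blast
  moreover have "s = t"
    by (rule cis_inj_on_period[of "fst I"])
      (use assms \<open>I = J\<close> in \<open>auto simp: arc_system_def\<close>)
  ultimately show ?thesis by blast
qed

lemma open_arc_subset: "open_arc I \<subseteq> closed_arc I"
  unfolding open_arc_def closed_arc_def by auto

lemma closed_arc_circle: "closed_arc I \<subseteq> circle"
  unfolding closed_arc_def by auto

lemma closed_closed_arc: "closed (closed_arc I)"
  unfolding closed_arc_def
  by (intro compact_imp_closed compact_continuous_image continuous_intros) auto

lemma eventually_avoid_closed:
  assumes "closed C" "p \<notin> C"
  shows "eventually (\<lambda>t. p * cis t \<notin> C) (at (0::real))"
  using topological_tendstoD[OF tendsto_mult_cis, of "- C" p] assms by auto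

lemma agree_outside_sym:
  assumes "agree_outside \<phi> \<I> D D'" shows "agree_outside \<phi> \<I> D' D"
  using assms unfolding agree_outside_def by (simp add: insert_commute)

lemma agree_outsideD:
  assumes "agree_outside \<phi> \<I> D D'"
  shows "oriented_plane_diffeo \<phi>"
    "\<forall>I\<in>\<I>. fst I < snd I \<and> snd I < fst I + 2 * pi"
    "pairwise (\<lambda>I J. closed_arc I \<inter> closed_arc J = {}) \<I>"
    "E \<in> {D, D'} \<Longrightarrow>
      {p \<in> circle. \<phi> (curve E p) \<in> box (Complex (-1) (-1)) (Complex 1 1)} = \<Union>(open_arc ` \<I>)"
    "E \<in> {D, D'} \<Longrightarrow> I \<in> \<I> \<Longrightarrow> \<not> double_point (curve E) (cis (fst I)) q"
    "E \<in> {D, D'} \<Longrightarrow> I \<in> \<I> \<Longrightarrow> \<not> double_point (curve E) (cis (snd I)) q"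
    "p \<in> circle \<Longrightarrow> p \<notin> \<Union>(closed_arc ` \<I>) \<Longrightarrow> curve D' p = curve D p"
    "p \<in> circle \<Longrightarrow> p \<notin> \<Union>(closed_arc ` \<I>) \<Longrightarrow> p \<in> over_pts D' \<longleftrightarrow> p \<in> over_pts D"
proof -
  note * = assms[unfolded agree_outside_def]
  show "oriented_plane_diffeo \<phi>"
    "\<forall>I\<in>\<I>. fst I < snd I \<and> snd I < fst I + 2 * pi"
    "pairwise (\<lambda>I J. closed_arc I \<inter> closed_arc J = {}) \<I>"
    using conjunct1[OF *] conjunct1[OF conjunct2[OF *]] conjunct1[OF conjunct2[OF conjunct2[OF *]]] .
  have 4: "\<forall>E\<in>{D, D'}.
        {p \<in> circle. \<phi> (curve E p) \<in> cbox (Complex (-1) (-1)) (Complex 1 1)} = \<Union>(closed_arc ` \<I>) \<and>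
        {p \<in> circle. \<phi> (curve E p) \<in> box (Complex (-1) (-1)) (Complex 1 1)} = \<Union>(open_arc ` \<I>) \<and>
        (\<forall>I\<in>\<I>. \<forall>q. \<not> double_point (curve E) (cis (fst I)) q
                    \<and> \<not> double_point (curve E) (cis (snd I)) q)"
    and 5: "\<forall>p \<in> circle - \<Union>(closed_arc ` \<I>).
        curve D' p = curve D p \<and> (p \<in> over_pts D' \<longleftrightarrow> p \<in> over_pts D)"
    using conjunct1[OF conjunct2[OF conjunct2[OF conjunct2[OF *]]]]
      conjunct2[OF conjunct2[OF conjunct2[OF conjunct2[OF *]]]] .
  show "{p \<in> circle. \<phi> (curve E p) \<in> box (Complex (-1) (-1)) (Complex 1 1)} = \<Union>(open_arc ` \<I>)"
    if "E \<in> {D, D'}"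
    using bspec[OF 4 that] by (elim conjE)
  show "\<not> double_point (curve E) (cis (fst I)) q" "\<not> double_point (curve E) (cis (snd I)) q"
    if "E \<in> {D, D'}" "I \<in> \<I>"
    using conjunct2[OF conjunct2[OF bspec[OF 4 that(1)]]] that(2) by blast+
  show "curve D' p = curve D p" "p \<in> over_pts D' \<longleftrightarrow> p \<in> over_pts D"
    if "p \<in> circle" "p \<notin> \<Union>(closed_arc ` \<I>)"
    using bspec[OF 5, of p] that by blast+
qed

lemma agree_outside_arc_system:
  "agree_outside \<phi> \<I> D D' \<Longrightarrow> finite \<I> \<Longrightarrow> arc_system \<I>"
  unfolding arc_system_def using agree_outsideD(2,3) by blast

text \<open>A strand of the disc meets only strands of the disc, and only in the interior of the disc.\<close>

lemma agree_outside_inside: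
  assumes ao: "agree_outside \<phi> \<I> D D'" and E: "E \<in> {D, D'}"
    and d: "double_point (curve E) p q" and I: "I \<in> \<I>" "p \<in> closed_arc I"
  shows "p \<in> open_arc I \<and> (\<exists>J\<in>\<I>. q \<in> open_arc J)"
proof -
  note box = agree_outsideD(4)[OF ao E]
  obtain t where t: "p = cis t" "t \<in> {fst I..snd I}"
    using I(2) unfolding closed_arc_def by blast
  have "t \<noteq> fst I" "t \<noteq> snd I"
    using agree_outsideD(5,6)[OF ao E I(1), of q] d t(1) by blast+
  then have p: "p \<in> open_arc I"
    using t unfolding open_arc_def by auto
  have "q \<in> circle" "curve E q = curve E p"
    using d unfolding double_point_def by auto
  moreover have "p \<in> {p \<in> circle. \<phi> (curve E p) \<in> box (Complex (-1) (-1)) (Complex 1 1)}"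
    unfolding box using p I(1) by blast
  ultimately have "q \<in> {p \<in> circle. \<phi> (curve E p) \<in> box (Complex (-1) (-1)) (Complex 1 1)}"
    by (simp del: mem_sphere)
  then show ?thesis
    unfolding box using p by blast
qed

lemma agree_outside_endpoints:
  assumes "agree_outside \<phi> \<I> D D'" "E \<in> {D, D'}" "I \<in> \<I>"
  shows "cis (fst I) \<notin> crossing_points E" "cis (snd I) \<notin> crossing_points E"
  using agree_outsideD(5,6)[OF assms] double_point_sym
  unfolding crossing_points_def classical_crossing_def by blast+

lemma agree_outside_outside:
  assumes ao: "agree_outside \<phi> \<I> D D'" and fin: "finite \<I>"
    and p: "p \<in> circle" "p \<notin> \<Union>(closed_arc ` \<I>)"
  shows "double_point (curve D') p q \<longleftrightarrow> double_point (curve D) p q"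
    "double_point (curve D) p q \<Longrightarrow> q \<notin> \<Union>(closed_arc ` \<I>)"
    "curve D' p = curve D p" "p \<in> over_pts D' \<longleftrightarrow> p \<in> over_pts D"
    "velocity (curve D') p = velocity (curve D) p"
proof -
  let ?C = "\<Union>(closed_arc ` \<I>)"
  have same: "curve D' q = curve D q" "q \<in> over_pts D' \<longleftrightarrow> q \<in> over_pts D"
    if "q \<in> circle" "q \<notin> ?C" for q
    using agree_outsideD(7,8)[OF ao that] by blast+
  have out: "q \<notin> ?C" if "double_point (curve E) p q" "E \<in> {D, D'}" for q E
  proof
    assume "q \<in> ?C"
    then obtain I where "I \<in> \<I>" "q \<in> closed_arc I" by blast
    then have "\<exists>J\<in>\<I>. p \<in> open_arc J"
      using agree_outside_inside[OF ao that(2), of q p I] that(1) double_point_sym by blast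
    then show False
      using p(2) open_arc_subset by blast
  qed
  show "double_point (curve D) p q \<Longrightarrow> q \<notin> ?C"
    using out by blast
  show "double_point (curve D') p q \<longleftrightarrow> double_point (curve D) p q"
  proof -
    have "double_point (curve D') p q \<longleftrightarrow> double_point (curve D) p q" if "q \<in> circle" "q \<notin> ?C"
      unfolding double_point_def same(1)[OF p] same(1)[OF that] ..
    moreover have "q \<in> circle \<and> q \<notin> ?C" if "double_point (curve E) p q" "E \<in> {D, D'}" for E
      using that(1) out[OF that] unfolding double_point_def by blast
    ultimately show ?thesis by blast
  qed
  show "curve D' p = curve D p" "p \<in> over_pts D' \<longleftrightarrow> p \<in> over_pts D"
    using same p by auto
  have "closed ?C"
    using fin closed_closed_arc by blast
  have "eventually (\<lambda>t. curve D' (p * cis t) = curve D (p * cis t)) (at (0::real))"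
    using eventually_avoid_closed[OF \<open>closed ?C\<close> p(2)]
    by eventually_elim (use same mult_cis_in_circle[OF p(1)] in blast)
  then have "eventually (\<lambda>t. curve D' (p * cis t) = curve D (p * cis t)) (nhds (0::real))"
    unfolding eventually_nhds_conv_at using same(1)[OF p] by simp
  then have "eventually (\<lambda>t. t \<in> UNIV \<longrightarrow> curve D' (p * cis t) = curve D (p * cis t)) (nhds (0::real))"
    by simp
  then show "velocity (curve D') p = velocity (curve D) p"
    unfolding velocity_def
    by (rule vector_derivative_cong_eq[where f="\<lambda>t. curve D' (p * cis t)"
          and g="\<lambda>t. curve D (p * cis t)" and A=UNIV and B=UNIV and x=0 and y=0]) simp_all
qed

lemma agree_outside_classical:
  assumes ao: "agree_outside \<phi> \<I> D D'" and fin: "finite \<I>"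
    and p: "p \<in> circle" "p \<notin> \<Union>(closed_arc ` \<I>)"
  shows "classical_crossing D' p q \<longleftrightarrow> classical_crossing D p q"
    "classical_crossing D' q p \<longleftrightarrow> classical_crossing D q p"
    "classical_crossing D p q \<Longrightarrow> positive D' p q = positive D p q"
proof -
  note out = agree_outside_outside[OF ao fin]
  have q: "q \<in> circle" "q \<notin> \<Union>(closed_arc ` \<I>)" if "double_point (curve D) p q" for q
    using out(2)[OF p that] that unfolding double_point_def by auto
  show "classical_crossing D' p q \<longleftrightarrow> classical_crossing D p q"
    unfolding classical_crossing_def using out(1,4)[OF p] by blast
  show "classical_crossing D' q p \<longleftrightarrow> classical_crossing D q p"
    unfolding classical_crossing_def using out(1)[OF p, of q] q[of q] out(4)[of q] double_point_sym by blast
  show "classical_crossing D p q \<Longrightarrow> positive D' p q = positive D p q"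
    unfolding classical_crossing_def positive_def using out(5)[OF p] q[of q] out(5)[of q] by simp
qed

lemma locally_constant_right:
  fixes G :: "real \<Rightarrow> 'x"
  assumes "u < w"
    and r: "\<forall>t\<in>{u..<w}. eventually (\<lambda>h. G (t + h) = G t) (at_right 0)"
    and l: "\<forall>t\<in>{u<..<w}. eventually (\<lambda>h. G (t + h) = G t) (at_left 0)"
  shows "t \<in> {u..<w} \<Longrightarrow> G t = G u"
    and "eventually (\<lambda>h. G (w + h) = y) (at_left 0) \<Longrightarrow> y = G u"
proof -
  show *: "G t = G u" if t: "t \<in> {u..<w}" for t
  proof (rule connected_local_const[of "{u..<w}"])
    show "\<forall>a\<in>{u..<w}. \<forall>\<^sub>F b in at a within {u..<w}. G a = G b"
    proof
      fix a assume a: "a \<in> {u..<w}"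
      obtain e1 where e1: "e1 > 0" "\<And>h. 0 < h \<Longrightarrow> h < e1 \<Longrightarrow> G (a + h) = G a"
        using bspec[OF r a] unfolding eventually_at_right_field by auto
      obtain e2 where e2: "e2 > 0" "\<And>h. a \<noteq> u \<Longrightarrow> - e2 < h \<Longrightarrow> h < 0 \<Longrightarrow> G (a + h) = G a"
      proof (cases "a = u")
        case False
        then obtain b where "b < 0" "\<forall>h>b. h < 0 \<longrightarrow> G (a + h) = G a"
          using bspec[OF l, of a] a unfolding eventually_at_left_field by auto
        then show ?thesis
          using that[of "- b"] by auto
      qed (use that[of 1] in auto)
      have "G a = G b" if "b \<in> {u..<w}" "b \<noteq> a" "\<bar>b - a\<bar> < min e1 e2" for b
        using e1(2)[of "b - a"] e2(2)[of "b - a"] that by (cases "b < a") auto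
      then show "\<forall>\<^sub>F b in at a within {u..<w}. G a = G b"
        unfolding eventually_at using e1(1) e2(1)
        by (intro exI[of _ "min e1 e2"]) (auto simp: dist_real_def)
    qed
  qed (use t assms(1) in auto)
  assume "eventually (\<lambda>h. G (w + h) = y) (at_left 0)"
  moreover have "eventually (\<lambda>h. h \<in> {u - w<..<0}) (at_left (0::real))"
    using assms(1) by (intro eventually_at_left_real) auto
  ultimately have "eventually (\<lambda>h. y = G u) (at_left (0::real))"
  proof eventually_elim
    case (elim h)
    then show ?case using *[of "w + h"] by simp
  qed
  then show "y = G u" by simp
qed

text \<open>The step function with values \<open>v 0\<close>, \<open>v 1\<close>, \<open>v 2\<close> and jumps at \<open>\<tau> 0\<close>, \<open>\<tau> 1\<close>, and its left limits. No strand of a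
  Reidemeister move passes more than two crossings, so two jumps are enough.\<close>

definition strand_step :: "(nat \<Rightarrow> real) \<Rightarrow> (nat \<Rightarrow> 'x) \<Rightarrow> real \<Rightarrow> 'x" where
  "strand_step \<tau> v t = (if t < \<tau> 0 then v 0 else if t < \<tau> 1 then v 1 else v 2)"

definition strand_step_left :: "(nat \<Rightarrow> real) \<Rightarrow> (nat \<Rightarrow> 'x) \<Rightarrow> real \<Rightarrow> 'x" where
  "strand_step_left \<tau> v t = (if t \<le> \<tau> 0 then v 0 else if t \<le> \<tau> 1 then v 1 else v 2)"

lemma eventually_add_less:
  "t < a \<Longrightarrow> eventually (\<lambda>h. t + h < a) (at_right (0::real))"
  "a \<le> t \<Longrightarrow> eventually (\<lambda>h. \<not> t + h < a) (at_right (0::real))"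
  "t \<le> a \<Longrightarrow> eventually (\<lambda>h. t + h < a) (at_left (0::real))"
  "a < t \<Longrightarrow> eventually (\<lambda>h. \<not> t + h < a) (at_left (0::real))"
proof -
  show "t < a \<Longrightarrow> eventually (\<lambda>h. t + h < a) (at_right (0::real))"
    unfolding eventually_at_right_field by (intro exI[of _ "a - t"]) auto
  show "a \<le> t \<Longrightarrow> eventually (\<lambda>h. \<not> t + h < a) (at_right (0::real))"
    unfolding eventually_at_right_field by (intro exI[of _ 1]) auto
  show "t \<le> a \<Longrightarrow> eventually (\<lambda>h. t + h < a) (at_left (0::real))"
    unfolding eventually_at_left_field by (intro exI[of _ "-1"]) auto
  show "a < t \<Longrightarrow> eventually (\<lambda>h. \<not> t + h < a) (at_left (0::real))"
    unfolding eventually_at_left_field by (intro exI[of _ "a - t"]) auto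
qed

lemma eventually_strand_step:
  "eventually (\<lambda>h. strand_step \<tau> v (t + h) = strand_step \<tau> v t) (at_right (0::real))"
  "eventually (\<lambda>h. strand_step \<tau> v (t + h) = strand_step_left \<tau> v t) (at_left (0::real))"
proof -
  have "eventually (\<lambda>h. (t + h < a) = (t < a)) (at_right (0::real))" for a
    using eventually_add_less(1,2)[of t a] eventually_add_less(2)[of a t]
    by (cases "t < a") (auto elim!: eventually_mono)
  from eventually_conj[OF this[of "\<tau> 0"] this[of "\<tau> 1"]]
  show "eventually (\<lambda>h. strand_step \<tau> v (t + h) = strand_step \<tau> v t) (at_right (0::real))"
    by eventually_elim (simp add: strand_step_def)
  have "eventually (\<lambda>h. (t + h < a) = (t \<le> a)) (at_left (0::real))" for a
    using eventually_add_less(3,4)[of t a] eventually_add_less(4)[of a t]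
    by (cases "t \<le> a") (auto elim!: eventually_mono)
  from eventually_conj[OF this[of "\<tau> 0"] this[of "\<tau> 1"]]
  show "eventually (\<lambda>h. strand_step \<tau> v (t + h) = strand_step_left \<tau> v t) (at_left (0::real))"
    by eventually_elim (simp add: strand_step_def strand_step_left_def)
qed

text \<open>Two interior parameters on each strand, among which are those of the classical crossings. For a
  strand without crossings any two parameters will do.\<close>

definition breakpoints ::
    "vdiagram \<Rightarrow> (real \<times> real) set \<Rightarrow> (real \<times> real \<Rightarrow> nat \<Rightarrow> real) \<Rightarrow> bool" where
  "breakpoints E \<I> \<tau> \<longleftrightarrow> (\<forall>I\<in>\<I>. fst I < \<tau> I 0 \<and> \<tau> I 0 < \<tau> I 1 \<and> \<tau> I 1 < snd I \<and>
     closed_arc I \<inter> crossing_points E \<subseteq> {cis (\<tau> I 0), cis (\<tau> I 1)})"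

text \<open>The part of a coloring inside the disc: \<open>v I 0\<close>, \<open>v I 1\<close>, \<open>v I 2\<close> are the successive labels along the
  strand \<open>I\<close>.\<close>

definition strand_coloring ::
    "'x set \<Rightarrow> 'x crossing_rule \<Rightarrow> vdiagram \<Rightarrow> (real \<times> real) set \<Rightarrow>
     (real \<times> real \<Rightarrow> nat \<Rightarrow> real) \<Rightarrow> (real \<times> real \<Rightarrow> nat \<Rightarrow> 'x) \<Rightarrow> bool" where
  "strand_coloring X R E \<I> \<tau> v \<longleftrightarrow>
     (\<forall>I\<in>\<I>. \<forall>k\<le>2. v I k \<in> X) \<and>
     (\<forall>I\<in>\<I>. \<forall>k<2. cis (\<tau> I k) \<notin> crossing_points E \<longrightarrow> v I k = v I (Suc k)) \<and>
     (\<forall>I\<in>\<I>. \<forall>J\<in>\<I>. \<forall>k<2. \<forall>l<2. classical_crossing E (cis (\<tau> I k)) (cis (\<tau> J l)) \<longrightarrow>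
        R (positive E (cis (\<tau> I k)) (cis (\<tau> J l))) (v J l) (v J (Suc l)) (v I k) (v I (Suc k)))"

lemma less_2_cases_nat: "(k::nat) < 2 \<longleftrightarrow> k = 0 \<or> k = 1"
  by auto

lemma breakpoints_mem:
  assumes "breakpoints E \<I> \<tau>" "I \<in> \<I>" "k < 2"
  shows "\<tau> I k \<in> {fst I<..<snd I}"
  using assms unfolding breakpoints_def less_2_cases_nat by fastforce

lemma breakpoints_crossing:
  assumes "breakpoints E \<I> \<tau>" "I \<in> \<I>" "p \<in> closed_arc I" "p \<in> crossing_points E"
  obtains k where "k < 2" "p = cis (\<tau> I k)"
  using assms unfolding breakpoints_def less_2_cases_nat by blast

text \<open>The restriction of a coloring to the strands. As colorings are right-continuous, the label after
  the breakpoint \<open>k\<close> is the value at that breakpoint.\<close>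

definition strand_values :: "(complex \<Rightarrow> 'x) \<Rightarrow> (real \<times> real \<Rightarrow> nat \<Rightarrow> real) \<Rightarrow> real \<times> real \<Rightarrow> nat \<Rightarrow> 'x" where
  "strand_values F \<tau> I k = F (cis (if k = 0 then fst I else \<tau> I (k - 1)))"

lemma strand_values_coloring:
  assumes sys: "arc_system \<I>" and bp: "breakpoints E \<I> \<tau>" and F: "F \<in> colorings X R E"
    and ends: "\<forall>I\<in>\<I>. cis (fst I) \<notin> crossing_points E \<and> cis (snd I) \<notin> crossing_points E"
  shows "\<And>I t. I \<in> \<I> \<Longrightarrow> t \<in> {fst I..snd I} \<Longrightarrow> F (cis t) = strand_step (\<tau> I) (strand_values F \<tau> I) t"
    "strand_coloring X R E \<I> \<tau> (strand_values F \<tau>)"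
proof -
  have *: "(\<forall>t\<in>{fst I..snd I}. F (cis t) = strand_step (\<tau> I) (strand_values F \<tau> I) t) \<and>
      (\<forall>k<2. before F (cis (\<tau> I k)) = strand_values F \<tau> I k)" if I: "I \<in> \<I>" for I
  proof -
    have \<tau>: "fst I < \<tau> I 0" "\<tau> I 0 < \<tau> I 1" "\<tau> I 1 < snd I"
      using bp I unfolding breakpoints_def by auto
    have r: "eventually (\<lambda>h. F (cis (t + h)) = F (cis t)) (at_right 0)" for t
      using coloringsD(2)[OF F cis_in_circle, of t] by (simp add: cis_mult)
    have b: "eventually (\<lambda>h. F (cis (t + h)) = before F (cis t)) (at_left 0)" for t
      using coloringsD(3)[OF F cis_in_circle, of t] by (simp add: cis_mult)
    have nc: "before F (cis t) = F (cis t)" if "t \<in> {fst I..snd I}" "t \<noteq> \<tau> I 0" "t \<noteq> \<tau> I 1" for t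
    proof -
      have "cis t \<notin> crossing_points E"
      proof
        assume *: "cis t \<in> crossing_points E"
        have "cis t \<in> closed_arc I"
          using that(1) unfolding closed_arc_def by blast
        then obtain k where k: "k < 2" "cis t = cis (\<tau> I k)"
          by (rule breakpoints_crossing[OF bp I _ *])
        then have "t = \<tau> I k"
          using arc_system_inj[OF sys I I that(1), of "\<tau> I k"] breakpoints_mem[OF bp I k(1)] by auto
        then show False
          using that k(1) less_2_cases_nat by auto
      qed
      then show ?thesis
        by (rule coloringsD(4)[OF F cis_in_circle])
    qed
    have l: "eventually (\<lambda>h. F (cis (t + h)) = F (cis t)) (at_left 0)"
      if "t \<in> {fst I..snd I}" "t \<noteq> \<tau> I 0" "t \<noteq> \<tau> I 1" for t
      using b[of t] nc[OF that] by simp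
    have r': "\<forall>t\<in>S. eventually (\<lambda>h. F (cis (t + h)) = F (cis t)) (at_right 0)" for S
      using r by blast
    have l0: "\<forall>t\<in>{fst I<..<\<tau> I 0}. eventually (\<lambda>h. F (cis (t + h)) = F (cis t)) (at_left 0)"
      and l1: "\<forall>t\<in>{\<tau> I 0<..<\<tau> I 1}. eventually (\<lambda>h. F (cis (t + h)) = F (cis t)) (at_left 0)"
      and l2: "\<forall>t\<in>{\<tau> I 1<..<snd I}. eventually (\<lambda>h. F (cis (t + h)) = F (cis t)) (at_left 0)"
      using \<tau> by (intro ballI l; simp)+
    note 0 = locally_constant_right[of "fst I" "\<tau> I 0" "\<lambda>t. F (cis t)", OF \<tau>(1) r' l0]
    note 1 = locally_constant_right[of "\<tau> I 0" "\<tau> I 1" "\<lambda>t. F (cis t)", OF \<tau>(2) r' l1]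
    note 2 = locally_constant_right[of "\<tau> I 1" "snd I" "\<lambda>t. F (cis t)", OF \<tau>(3) r' l2]
    have 3: "F (cis (snd I)) = F (cis (\<tau> I 1))"
      using 2(2)[OF b] nc[of "snd I"] \<tau> by simp
    have "F (cis t) = strand_step (\<tau> I) (strand_values F \<tau> I) t" if "t \<in> {fst I..snd I}" for t
      using 0(1)[of t] 1(1)[of t] 2(1)[of t] 3 that unfolding strand_step_def strand_values_def
      by (cases "t = snd I") auto
    then show ?thesis
      using 0(2)[OF b] 1(2)[OF b] unfolding less_2_cases_nat strand_values_def by auto
  qed
  then show "\<And>I t. I \<in> \<I> \<Longrightarrow> t \<in> {fst I..snd I} \<Longrightarrow> F (cis t) = strand_step (\<tau> I) (strand_values F \<tau> I) t"
    by blast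
  have after: "F (cis (\<tau> I k)) = strand_values F \<tau> I (Suc k)" for I k
    by (simp add: strand_values_def)
  show "strand_coloring X R E \<I> \<tau> (strand_values F \<tau>)"
    unfolding strand_coloring_def
  proof (intro conjI ballI allI impI)
    show "strand_values F \<tau> I k \<in> X" for I k
      using F unfolding strand_values_def colorings_def by (auto simp: PiE_mem)
  next
    fix I k assume I: "I \<in> \<I>" "k < 2" "cis (\<tau> I k) \<notin> crossing_points E"
    then have "before F (cis (\<tau> I k)) = F (cis (\<tau> I k))"
      using F unfolding colorings_def by simp
    then show "strand_values F \<tau> I k = strand_values F \<tau> I (Suc k)"
      using *[OF I(1)] I(2) after by simp
  next
    fix I J and k l :: nat
    assume I: "I \<in> \<I>" "J \<in> \<I>" "k < 2" "l < 2"
      and c: "classical_crossing E (cis (\<tau> I k)) (cis (\<tau> J l))"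
    then have "R (positive E (cis (\<tau> I k)) (cis (\<tau> J l))) (before F (cis (\<tau> J l))) (F (cis (\<tau> J l)))
        (before F (cis (\<tau> I k))) (F (cis (\<tau> I k)))"
      using F unfolding colorings_def by blast
    then show "R (positive E (cis (\<tau> I k)) (cis (\<tau> J l))) (strand_values F \<tau> J l)
        (strand_values F \<tau> J (Suc l)) (strand_values F \<tau> I k) (strand_values F \<tau> I (Suc k))"
      using * I after by simp
  qed
qed

text \<open>The circle leaves all the arcs right after the end, and right before the start, of each of them.\<close>

lemma eventually_leave_arcs:
  assumes sys: "arc_system \<I>" and I: "I \<in> \<I>"
  shows "eventually (\<lambda>h. cis (snd I + h) \<notin> \<Union>(closed_arc ` \<I>)) (at_right 0)"
    "eventually (\<lambda>h. cis (fst I + h) \<notin> \<Union>(closed_arc ` \<I>)) (at_left 0)"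
proof -
  have ab: "fst I < snd I" "snd I < fst I + 2 * pi"
    using sys I unfolding arc_system_def by auto
  let ?C = "\<Union>(closed_arc ` (\<I> - {I}))"
  have "closed ?C"
    using sys closed_closed_arc unfolding arc_system_def by auto
  have avoid: "eventually (\<lambda>h. cis (t + h) \<notin> ?C) (at 0)" if "t \<in> {fst I..snd I}" for t
  proof -
    have "cis t \<in> closed_arc I"
      using that unfolding closed_arc_def by blast
    then have "cis t \<notin> ?C"
      using sys I unfolding arc_system_def pairwise_def by blast
    from eventually_avoid_closed[OF \<open>closed ?C\<close> this] show ?thesis
      by (simp add: cis_mult)
  qed
  have r: "cis (snd I + h) \<notin> closed_arc I" if "h \<in> {0<..<fst I + 2 * pi - snd I}" for h
  proof
    assume "cis (snd I + h) \<in> closed_arc I"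
    then obtain s where "s \<in> {fst I..snd I}" "cis (snd I + h) = cis s"
      unfolding closed_arc_def by blast
    then show False
      using cis_inj_on_period[of "fst I" "snd I + h" s] that ab by auto
  qed
  have l: "cis (fst I + h) \<notin> closed_arc I" if "h \<in> {- (fst I + 2 * pi - snd I)<..<0}" for h
  proof
    assume "cis (fst I + h) \<in> closed_arc I"
    then obtain s where s: "s \<in> {fst I..snd I}" "cis (fst I + h) = cis s"
      unfolding closed_arc_def by blast
    have "cis (fst I + h + 2 * pi) = cis s"
      using s(2) by (simp add: cis_mult[symmetric])
    then show False
      using cis_inj_on_period[of "fst I" "fst I + h + 2 * pi" s] s(1) that ab by auto
  qed
  have U: "\<Union>(closed_arc ` \<I>) = closed_arc I \<union> ?C"
    using I by blast
  have "eventually (\<lambda>h. h \<in> {0<..<fst I + 2 * pi - snd I}) (at_right 0)"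
    using ab by (intro eventually_at_right_real) auto
  moreover have "eventually (\<lambda>h. cis (snd I + h) \<notin> ?C) (at_right 0)"
    using avoid[of "snd I"] ab unfolding eventually_at_0_iff by auto
  ultimately show "eventually (\<lambda>h. cis (snd I + h) \<notin> \<Union>(closed_arc ` \<I>)) (at_right 0)"
    unfolding U by eventually_elim (use r in blast)
  have "eventually (\<lambda>h. h \<in> {- (fst I + 2 * pi - snd I)<..<0}) (at_left 0)"
    using ab by (intro eventually_at_left_real) auto
  moreover have "eventually (\<lambda>h. cis (fst I + h) \<notin> ?C) (at_left 0)"
    using avoid[of "fst I"] ab unfolding eventually_at_0_iff by auto
  ultimately show "eventually (\<lambda>h. cis (fst I + h) \<notin> \<Union>(closed_arc ` \<I>)) (at_left 0)"
    unfolding U by eventually_elim (use l in blast)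
qed

text \<open>Gluing: a coloring of \<open>D\<close> outside the disc and a coloring of the strands of \<open>D'\<close> inside it with the
  same labels at the ends form a coloring of \<open>D'\<close>.\<close>

lemma coloring_extend:
  assumes ao: "agree_outside \<phi> \<I> D D'" and fin: "finite \<I>"
    and F: "F \<in> colorings X R D" and bp: "breakpoints D' \<I> \<tau>"
    and w: "strand_coloring X R D' \<I> \<tau> w"
    and ends: "\<And>I. I \<in> \<I> \<Longrightarrow> w I 0 = F (cis (fst I)) \<and> w I 2 = F (cis (snd I))"
  shows "\<exists>G\<in>colorings X R D'. \<forall>p\<in>circle - \<Union>(open_arc ` \<I>). G p = F p"
proof -
  let ?C = "\<Union>(closed_arc ` \<I>)"
  note sys = agree_outside_arc_system[OF ao fin]
  have "closed ?C"
    using fin closed_closed_arc by blast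
  define G where "G p = (if p \<in> ?C
      then let (I, t) = (SOME (I, t). I \<in> \<I> \<and> t \<in> {fst I..snd I} \<and> p = cis t) in strand_step (\<tau> I) (w I) t
      else F p)" for p
  have G_in: "G (cis t) = strand_step (\<tau> I) (w I) t" if "I \<in> \<I>" "t \<in> {fst I..snd I}" for I t
  proof -
    have "(SOME (J, s). J \<in> \<I> \<and> s \<in> {fst J..snd J} \<and> cis t = cis s) = (I, t)"
    proof (rule some_equality)
      show "case (I, t) of (J, s) \<Rightarrow> J \<in> \<I> \<and> s \<in> {fst J..snd J} \<and> cis t = cis s"
        using that by simp
      fix x assume x: "case x of (J, s) \<Rightarrow> J \<in> \<I> \<and> s \<in> {fst J..snd J} \<and> cis t = cis s"
      obtain J s where "x = (J, s)" by (cases x)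
      with x have "J \<in> \<I>" "s \<in> {fst J..snd J}" "cis t = cis s" by simp_all
      then show "x = (I, t)"
        using arc_system_inj[OF sys that(1) _ that(2), of J s] \<open>x = (J, s)\<close> by simp
    qed
    moreover have "cis t \<in> ?C"
      using that unfolding closed_arc_def by blast
    ultimately show ?thesis
      unfolding G_def by simp
  qed
  have G_out: "G p = F p" if "p \<notin> ?C" for p
    using that unfolding G_def by simp
  have bounds: "fst I < \<tau> I 0" "\<tau> I 0 < \<tau> I 1" "\<tau> I 1 < snd I" if "I \<in> \<I>" for I
    using bp that unfolding breakpoints_def by auto
  have G_ends: "G (cis (fst I)) = F (cis (fst I))" "G (cis (snd I)) = F (cis (snd I))" if "I \<in> \<I>" for I
    using G_in[OF that] bounds[OF that] ends[OF that] by (auto simp: strand_step_def)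
  have Fr: "eventually (\<lambda>h. F (p * cis h) = F p) (at_right 0)"
    and Fl: "eventually (\<lambda>h. F (p * cis h) = before F p) (at_left 0)" if "p \<in> circle" for p
    using F that unfolding colorings_def by blast+
  have ev_out: "eventually (\<lambda>h. G (p * cis h) = G p) (at_right 0)"
    "eventually (\<lambda>h. G (p * cis h) = before F p) (at_left 0)" if p: "p \<in> circle" "p \<notin> ?C" for p
  proof -
    have "eventually (\<lambda>h. p * cis h \<notin> ?C) (at (0::real))"
      by (rule eventually_avoid_closed[OF \<open>closed ?C\<close> p(2)])
    then have "eventually (\<lambda>h. G (p * cis h) = F (p * cis h)) (at 0)"
      by eventually_elim (rule G_out)
    then have *: "eventually (\<lambda>h. G (p * cis h) = F (p * cis h)) (at_right 0)"
      "eventually (\<lambda>h. G (p * cis h) = F (p * cis h)) (at_left 0)"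
      unfolding eventually_at_0_iff by auto
    show "eventually (\<lambda>h. G (p * cis h) = G p) (at_right 0)"
      using *(1) Fr[OF p(1)] by eventually_elim (use G_out[OF p(2)] in simp)
    show "eventually (\<lambda>h. G (p * cis h) = before F p) (at_left 0)"
      using *(2) Fl[OF p(1)] by eventually_elim simp
  qed
  \<comment> \<open>at the two ends of a strand one side belongs to the old coloring and one to the strand\<close>
  have ev_in_r: "eventually (\<lambda>h. G (cis t * cis h) = G (cis t)) (at_right 0)"
    if I: "I \<in> \<I>" and t: "t \<in> {fst I..snd I}" for I t
  proof (cases "t = snd I")
    case True
    show ?thesis
      using eventually_leave_arcs(1)[OF sys I] Fr[OF cis_in_circle, of "snd I"]
      by eventually_elim (use True G_out G_ends(2)[OF I] in \<open>auto simp: cis_mult\<close>)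
  next
    case False
    then have "eventually (\<lambda>h. h \<in> {0<..<snd I - t}) (at_right 0)"
      using t by (intro eventually_at_right_real) auto
    then show ?thesis
      using eventually_strand_step(1)[of "\<tau> I" "w I" t]
      by eventually_elim (use t G_in[OF I] in \<open>auto simp: cis_mult\<close>)
  qed
  have ev_in_l: "eventually (\<lambda>h. G (cis t * cis h) = strand_step_left (\<tau> I) (w I) t) (at_left 0)"
    if I: "I \<in> \<I>" and t: "t \<in> {fst I..snd I}" for I t
  proof (cases "t = fst I")
    case True
    have "before F (cis (fst I)) = F (cis (fst I))"
      using F agree_outside_endpoints(1)[OF ao _ I, of D] unfolding colorings_def by simp
    moreover have "strand_step_left (\<tau> I) (w I) (fst I) = w I 0"
      using bounds[OF I] by (simp add: strand_step_left_def)
    ultimately show ?thesis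
      using eventually_conj[OF eventually_leave_arcs(2)[OF sys I] Fl[OF cis_in_circle, of "fst I"]]
      by (elim eventually_mono) (use True G_out ends[OF I] in \<open>auto simp: cis_mult\<close>)
  next
    case False
    then have "eventually (\<lambda>h. h \<in> {fst I - t<..<0}) (at_left 0)"
      using t by (intro eventually_at_left_real) auto
    then show ?thesis
      using eventually_strand_step(2)[of "\<tau> I" "w I" t]
      by eventually_elim (use t G_in[OF I] in \<open>auto simp: cis_mult\<close>)
  qed
  have bef_out: "before G p = before F p" if "p \<in> circle" "p \<notin> ?C" for p
    using before_eqI[OF ev_out(2)[OF that]] .
  have bef_in: "before G (cis t) = strand_step_left (\<tau> I) (w I) t"
    if "I \<in> \<I>" "t \<in> {fst I..snd I}" for I t
    using before_eqI[OF ev_in_l[OF that]] .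
  have C_cases: "\<exists>I\<in>\<I>. \<exists>t\<in>{fst I..snd I}. p = cis t" if "p \<in> ?C" for p
    using that unfolding closed_arc_def by blast
  have wX: "w I k \<in> X" if "I \<in> \<I>" "k \<le> 2" for I k
    using w that unfolding strand_coloring_def by blast
  have GX: "G p \<in> X" if "p \<in> circle" for p
  proof (cases "p \<in> ?C")
    case True
    then show ?thesis
      using C_cases[OF True] G_in wX by (auto simp: strand_step_def)
  next
    case False
    then show ?thesis
      using G_out F that unfolding colorings_def by auto
  qed
  have G_undef: "G p = undefined" if "p \<notin> circle" for p
  proof -
    have "p \<notin> ?C"
      using that closed_arc_circle by blast
    then show ?thesis
      using G_out F that unfolding colorings_def by (auto simp: PiE_def extensional_def)
  qed
  have ev: "eventually (\<lambda>h. G (p * cis h) = G p) (at_right 0)"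
    "eventually (\<lambda>h. G (p * cis h) = before G p) (at_left 0)" if "p \<in> circle" for p
  proof -
    have "eventually (\<lambda>h. G (p * cis h) = G p) (at_right 0) \<and>
        eventually (\<lambda>h. G (p * cis h) = before G p) (at_left 0)"
    proof (cases "p \<in> ?C")
      case True
      then obtain I t where I: "I \<in> \<I>" "t \<in> {fst I..snd I}" "p = cis t"
        using C_cases by blast
      show ?thesis
        unfolding I(3) bef_in[OF I(1,2)] using ev_in_r[OF I(1,2)] ev_in_l[OF I(1,2)] by blast
    next
      case False
      show ?thesis
        unfolding bef_out[OF that False] using ev_out[OF that False] by blast
    qed
    then show "eventually (\<lambda>h. G (p * cis h) = G p) (at_right 0)"
      "eventually (\<lambda>h. G (p * cis h) = before G p) (at_left 0)" by blast+
  qed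
  have at_bp: "strand_step_left (\<tau> I) (w I) (\<tau> I k) = w I k" "strand_step (\<tau> I) (w I) (\<tau> I k) = w I (Suc k)"
    if "I \<in> \<I>" "k < 2" for I k
    using bounds[OF that(1)] that(2) unfolding less_2_cases_nat
    by (auto simp: strand_step_def strand_step_left_def numeral_2_eq_2)
  have nc: "before G p = G p" if p: "p \<in> circle" "p \<notin> crossing_points D'" for p
  proof (cases "p \<in> ?C")
    case True
    then obtain I t where I: "I \<in> \<I>" "t \<in> {fst I..snd I}" "p = cis t"
      using C_cases by blast
    show ?thesis
    proof (cases "\<exists>k<2. t = \<tau> I k")
      case True
      then obtain k where k: "k < 2" "t = \<tau> I k" by blast
      then have "w I k = w I (Suc k)"
        using w p(2) I unfolding strand_coloring_def by blast
      then show ?thesis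
        using bef_in G_in I at_bp k by simp
    next
      case False
      then have "t \<noteq> \<tau> I 0" "t \<noteq> \<tau> I 1" by auto
      then show ?thesis
        using bef_in[OF I(1,2)] G_in[OF I(1,2)] I(3) by (auto simp: strand_step_def strand_step_left_def)
    qed
  next
    case False
    then have "p \<notin> crossing_points D"
      using p agree_outside_classical(1,2)[OF ao fin] unfolding crossing_points_def by blast
    then show ?thesis
      using F p(1) bef_out[OF p(1) False] G_out[OF False] unfolding colorings_def by auto
  qed
  have cr: "R (positive D' p q) (before G q) (G q) (before G p) (G p)" if c: "classical_crossing D' p q" for p q
  proof -
    have pq: "p \<in> circle" "q \<in> circle" "double_point (curve D') p q"
      using c unfolding classical_crossing_def double_point_def by auto
    show ?thesis
    proof (cases "p \<in> ?C")
      case False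
      then have c': "classical_crossing D p q" "positive D' p q = positive D p q"
        using c agree_outside_classical(1,3)[OF ao fin pq(1)] by blast+
      then have "q \<notin> ?C"
        using agree_outside_outside(2)[OF ao fin pq(1) False] unfolding classical_crossing_def by blast
      then show ?thesis
        using F c' False bef_out G_out pq unfolding colorings_def by auto
    next
      case True
      then obtain I where I: "I \<in> \<I>" "p \<in> closed_arc I" by blast
      then obtain J where J: "J \<in> \<I>" "q \<in> closed_arc J"
        using agree_outside_inside[OF ao _ pq(3)] open_arc_subset by blast
      have "p \<in> crossing_points D'" "q \<in> crossing_points D'"
        using c unfolding crossing_points_def by blast+
      then obtain k l where kl: "k < 2" "p = cis (\<tau> I k)" "l < 2" "q = cis (\<tau> J l)"
        using breakpoints_crossing[OF bp] I J by metis
      have "R (positive D' p q) (w J l) (w J (Suc l)) (w I k) (w I (Suc k))"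
        using w I(1) J(1) kl c unfolding strand_coloring_def by blast
      moreover have "\<tau> I k \<in> {fst I..snd I}" "\<tau> J l \<in> {fst J..snd J}"
        using breakpoints_mem[OF bp] I(1) J(1) kl by (meson greaterThanLessThan_subseteq_atLeastAtMost_iff order_refl subsetD)+
      ultimately show ?thesis
        using bef_in G_in at_bp I(1) J(1) kl by simp
    qed
  qed
  have "G \<in> colorings X R D'"
    unfolding colorings_def using GX G_undef ev nc cr by (auto simp: PiE_def extensional_def)
  moreover have "G p = F p" if "p \<in> circle - \<Union>(open_arc ` \<I>)" for p
  proof (cases "p \<in> ?C")
    case True
    then obtain I t where I: "I \<in> \<I>" "t \<in> {fst I..snd I}" "p = cis t"
      using C_cases by blast
    then have "t = fst I \<or> t = snd I"
      using that unfolding open_arc_def by force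
    then show ?thesis
      using G_ends[OF I(1)] I(3) by blast
  qed (rule G_out)
  ultimately show ?thesis by blast
qed

lemma card_eq_by_relation:
  assumes "\<And>x. x \<in> A \<Longrightarrow> \<exists>y\<in>B. r x y" and "\<And>y. y \<in> B \<Longrightarrow> \<exists>x\<in>A. r x y"
    and "\<And>x x' y. x \<in> A \<Longrightarrow> x' \<in> A \<Longrightarrow> y \<in> B \<Longrightarrow> r x y \<Longrightarrow> r x' y \<Longrightarrow> x = x'"
    and "\<And>x y y'. x \<in> A \<Longrightarrow> y \<in> B \<Longrightarrow> y' \<in> B \<Longrightarrow> r x y \<Longrightarrow> r x y' \<Longrightarrow> y = y'"
  shows "card A = card B"
proof (rule bij_betw_same_card)
  define f where "f x = (SOME y. y \<in> B \<and> r x y)" for x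
  have f: "f x \<in> B \<and> r x (f x)" if "x \<in> A" for x
    unfolding f_def using someI_ex[of "\<lambda>y. y \<in> B \<and> r x y"] assms(1)[OF that] by blast
  show "bij_betw f A B"
  proof (rule bij_betw_imageI)
    show "inj_on f A"
      using f assms(3) by (metis inj_onI)
    show "f ` A = B"
      using f assms(2,4) by (auto simp: image_iff) metis
  qed
qed

text \<open>The labels at the ends of the strands determine the labels in the middle.\<close>

definition determined_by_ends ::
    "'x set \<Rightarrow> 'x crossing_rule \<Rightarrow> vdiagram \<Rightarrow> (real \<times> real) set \<Rightarrow>
     (real \<times> real \<Rightarrow> nat \<Rightarrow> real) \<Rightarrow> bool" where
  "determined_by_ends X R E \<I> \<tau> \<longleftrightarrow>
     (\<forall>v w. strand_coloring X R E \<I> \<tau> v \<longrightarrow> strand_coloring X R E \<I> \<tau> w \<longrightarrow>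
        (\<forall>I\<in>\<I>. v I 0 = w I 0 \<and> v I 2 = w I 2) \<longrightarrow> (\<forall>I\<in>\<I>. v I 1 = w I 1))"

text \<open>The labels at the ends of a coloring of the strands of \<open>D\<close> are also those of one of the strands
  of \<open>D'\<close>.\<close>

definition ends_extend ::
    "'x set \<Rightarrow> 'x crossing_rule \<Rightarrow> (real \<times> real) set \<Rightarrow>
     vdiagram \<Rightarrow> (real \<times> real \<Rightarrow> nat \<Rightarrow> real) \<Rightarrow> vdiagram \<Rightarrow> (real \<times> real \<Rightarrow> nat \<Rightarrow> real) \<Rightarrow> bool" where
  "ends_extend X R \<I> D \<tau> D' \<tau>' \<longleftrightarrow>
     (\<forall>v. strand_coloring X R D \<I> \<tau> v \<longrightarrow>
        (\<exists>w. strand_coloring X R D' \<I> \<tau>' w \<and> (\<forall>I\<in>\<I>. w I 0 = v I 0 \<and> w I 2 = v I 2)))"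

lemma coloring_determined_by_strands:
  assumes sys: "arc_system \<I>" and bp: "breakpoints E \<I> \<tau>"
    and ends: "\<forall>I\<in>\<I>. cis (fst I) \<notin> crossing_points E \<and> cis (snd I) \<notin> crossing_points E"
    and uniq: "determined_by_ends X R E \<I> \<tau>"
    and F: "F \<in> colorings X R E" and G: "G \<in> colorings X R E"
    and eq: "\<And>p. p \<in> circle - \<Union>(open_arc ` \<I>) \<Longrightarrow> F p = G p"
  shows "F = G"
proof -
  have ep: "cis t \<in> circle - \<Union>(open_arc ` \<I>)" if "I \<in> \<I>" "t = fst I \<or> t = snd I" for I t
  proof -
    have "t \<in> {fst I..snd I}"
      using sys that unfolding arc_system_def by auto
    have "cis t \<notin> open_arc J" if J: "J \<in> \<I>" for J
    proof
      assume "cis t \<in> open_arc J"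
      then obtain s where s: "s \<in> {fst J<..<snd J}" "cis t = cis s"
        unfolding open_arc_def by blast
      then have "I = J \<and> t = s"
        using arc_system_inj[OF sys \<open>I \<in> \<I>\<close> J \<open>t \<in> {fst I..snd I}\<close> _ s(2)] by simp
      then show False
        using s(1) \<open>t = fst I \<or> t = snd I\<close> by auto
    qed
    then show ?thesis by auto
  qed
  note vF = strand_values_coloring[OF sys bp F ends] and vG = strand_values_coloring[OF sys bp G ends]
  have 0: "strand_values F \<tau> I 0 = strand_values G \<tau> I 0 \<and> strand_values F \<tau> I 2 = strand_values G \<tau> I 2"
    if I: "I \<in> \<I>" for I
  proof -
    have "fst I < \<tau> I 0" "\<tau> I 0 < \<tau> I 1" "\<tau> I 1 < snd I"
      using bp I unfolding breakpoints_def by auto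
    then have "F (cis (snd I)) = strand_values F \<tau> I 2" "G (cis (snd I)) = strand_values G \<tau> I 2"
      using vF(1)[OF I, of "snd I"] vG(1)[OF I, of "snd I"] by (auto simp: strand_step_def)
    then show ?thesis
      using eq[OF ep[OF I]] by (simp add: strand_values_def)
  qed
  have 1: "strand_values F \<tau> I 1 = strand_values G \<tau> I 1" if "I \<in> \<I>" for I
    using uniq vF(2) vG(2) 0 that unfolding determined_by_ends_def by blast
  have "F p = G p" if p: "p \<in> circle" for p
  proof (cases "p \<in> \<Union>(open_arc ` \<I>)")
    case True
    then obtain I t where I: "I \<in> \<I>" "p = cis t" "t \<in> {fst I..snd I}"
      unfolding open_arc_def by force
    then show ?thesis
      using vF(1)[OF I(1,3)] vG(1)[OF I(1,3)] 0[OF I(1)] 1[OF I(1)] by (simp add: strand_step_def)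
  next
    case False
    then show ?thesis using eq p by blast
  qed
  then show ?thesis
    using F G unfolding colorings_def by (intro PiE_ext[of F circle "\<lambda>_. X" G]) auto
qed

lemma coloring_transfer:
  assumes ao: "agree_outside \<phi> \<I> D D'" and fin: "finite \<I>"
    and bp: "breakpoints D \<I> \<tau>" "breakpoints D' \<I> \<tau>'"
    and trans: "ends_extend X R \<I> D \<tau> D' \<tau>'"
    and F: "F \<in> colorings X R D"
  shows "\<exists>G\<in>colorings X R D'. \<forall>p\<in>circle - \<Union>(open_arc ` \<I>). F p = G p"
proof -
  note sys = agree_outside_arc_system[OF ao fin]
  have ends: "\<forall>I\<in>\<I>. cis (fst I) \<notin> crossing_points D \<and> cis (snd I) \<notin> crossing_points D"
    using agree_outside_endpoints[OF ao, of D] by blast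
  note vF = strand_values_coloring[OF sys bp(1) F ends]
  obtain w where w: "strand_coloring X R D' \<I> \<tau>' w"
    "\<And>I. I \<in> \<I> \<Longrightarrow> w I 0 = strand_values F \<tau> I 0 \<and> w I 2 = strand_values F \<tau> I 2"
    using trans vF(2) unfolding ends_extend_def by blast
  have "w I 0 = F (cis (fst I)) \<and> w I 2 = F (cis (snd I))" if I: "I \<in> \<I>" for I
  proof -
    have "fst I < \<tau> I 0" "\<tau> I 0 < \<tau> I 1" "\<tau> I 1 < snd I"
      using bp(1) I unfolding breakpoints_def by auto
    then have "F (cis (snd I)) = strand_values F \<tau> I 2"
      using vF(1)[OF I, of "snd I"] by (auto simp: strand_step_def)
    then show ?thesis
      using w(2)[OF I] by (simp add: strand_values_def)
  qed
  from coloring_extend[OF ao fin F bp(2) w(1) this] show ?thesis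
    by metis
qed

text \<open>A replacement inside a disc does not change the number of colorings if the labels at the ends of the
  strands are subject to the same conditions before and after, and determine the labels inside.\<close>

lemma card_colorings_tangle:
  assumes ao: "agree_outside \<phi> \<I> D D'" and fin: "finite \<I>"
    and bp: "breakpoints D \<I> \<tau>" "breakpoints D' \<I> \<tau>'"
    and trans: "ends_extend X R \<I> D \<tau> D' \<tau>'" "ends_extend X R \<I> D' \<tau>' D \<tau>"
    and uniq: "determined_by_ends X R D \<I> \<tau>" "determined_by_ends X R D' \<I> \<tau>'"
  shows "card (colorings X R D) = card (colorings X R D')"
proof (rule card_eq_by_relation[where r="\<lambda>F G. \<forall>p\<in>circle - \<Union>(open_arc ` \<I>). F p = G p"])
  note sys = agree_outside_arc_system[OF ao fin]
  have ends: "\<forall>I\<in>\<I>. cis (fst I) \<notin> crossing_points E \<and> cis (snd I) \<notin> crossing_points E"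
    if "E \<in> {D, D'}" for E
    using agree_outside_endpoints[OF ao that] by blast
  show "\<exists>G\<in>colorings X R D'. \<forall>p\<in>circle - \<Union>(open_arc ` \<I>). F p = G p" if "F \<in> colorings X R D" for F
    by (rule coloring_transfer[OF ao fin bp trans(1) that])
  show "\<exists>F\<in>colorings X R D. \<forall>p\<in>circle - \<Union>(open_arc ` \<I>). F p = G p" if "G \<in> colorings X R D'" for G
    using coloring_transfer[OF agree_outside_sym[OF ao] fin bp(2,1) trans(2) that] by metis
  show "F = F'" if "F \<in> colorings X R D" "F' \<in> colorings X R D" "G \<in> colorings X R D'"
    "\<forall>p\<in>circle - \<Union>(open_arc ` \<I>). F p = G p" "\<forall>p\<in>circle - \<Union>(open_arc ` \<I>). F' p = G p" for F F' G
    by (rule coloring_determined_by_strands[OF sys bp(1) ends[of D] uniq(1) that(1,2)]) (use that in auto)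
  show "G = G'" if "F \<in> colorings X R D" "G \<in> colorings X R D'" "G' \<in> colorings X R D'"
    "\<forall>p\<in>circle - \<Union>(open_arc ` \<I>). F p = G p" "\<forall>p\<in>circle - \<Union>(open_arc ` \<I>). F p = G' p" for F G G'
    by (rule coloring_determined_by_strands[OF sys bp(2) ends[of D'] uniq(2) that(2,3)]) (use that in auto)
qed

lemma strand_coloring_no_crossings:
  assumes "breakpoints E \<I> \<tau>" and "\<forall>I\<in>\<I>. closed_arc I \<inter> crossing_points E = {}"
  shows "strand_coloring X R E \<I> \<tau> v \<longleftrightarrow> (\<forall>I\<in>\<I>. v I 0 \<in> X \<and> v I 1 = v I 0 \<and> v I 2 = v I 0)"
proof -
  have nc: "cis (\<tau> I k) \<notin> crossing_points E" if "I \<in> \<I>" "k < 2" for I k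
  proof -
    have "cis (\<tau> I k) \<in> closed_arc I"
      using breakpoints_mem[OF assms(1) that] unfolding closed_arc_def by auto
    then show ?thesis
      using assms(2) that(1) by blast
  qed
  moreover from this have "\<not> classical_crossing E (cis (\<tau> I k)) q" if "I \<in> \<I>" "k < 2" for I k q
    using that unfolding crossing_points_def by blast
  moreover have "(\<forall>k\<le>2. P k) \<longleftrightarrow> P 0 \<and> P 1 \<and> P (2::nat)" for P
    by (auto simp: le_Suc_eq numeral_2_eq_2)
  ultimately show ?thesis
    unfolding strand_coloring_def less_2_cases_nat by (auto simp: numeral_2_eq_2)
qed

text \<open>The conditions on the labels of strands in terms of the double points inside the disc. An element
  \<open>((I, k), (J, l))\<close> of \<open>Q\<close> means that \<open>I\<close> at its breakpoint \<open>k\<close> crosses \<open>J\<close> at its breakpoint \<open>l\<close>, either over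
  it or in a virtual crossing.\<close>

lemma strand_coloring_sites:
  assumes diag: "is_diagram E" and sys: "arc_system \<I>" and bp: "breakpoints E \<I> \<tau>"
    and Q: "\<And>I k J l. ((I, k), (J, l)) \<in> Q \<Longrightarrow> I \<in> \<I> \<and> J \<in> \<I> \<and> k < 2 \<and> l < 2 \<and>
      double_point (curve E) (cis (\<tau> I k)) (cis (\<tau> J l)) \<and> cis (\<tau> J l) \<notin> over_pts E"
    and cover: "\<And>I k. I \<in> \<I> \<Longrightarrow> k < 2 \<Longrightarrow> (I, k) \<in> fst ` Q \<union> snd ` Q"
  shows "strand_coloring X R E \<I> \<tau> v \<longleftrightarrow> (\<forall>I\<in>\<I>. \<forall>k\<le>2. v I k \<in> X) \<and>
    (\<forall>((I, k), (J, l))\<in>Q. if cis (\<tau> I k) \<in> over_pts E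
      then R (positive E (cis (\<tau> I k)) (cis (\<tau> J l))) (v J l) (v J (Suc l)) (v I k) (v I (Suc k))
      else v J l = v J (Suc l) \<and> v I k = v I (Suc k))"
    (is "_ \<longleftrightarrow> ?X \<and> ?S")
proof -
  have partner: "q = r" if "double_point (curve E) p q" "double_point (curve E) p r" for p q r
    using diag that unfolding is_diagram_def generic_immersion_def by blast
  have virt: "cis (\<tau> I k) \<notin> crossing_points E \<and> cis (\<tau> J l) \<notin> crossing_points E"
    if "((I, k), (J, l)) \<in> Q" "cis (\<tau> I k) \<notin> over_pts E" for I k J l
    using Q[OF that(1)] that(2) partner double_point_sym
    unfolding crossing_points_def classical_crossing_def by blast
  have inj: "I = J \<and> k = l" if "I \<in> \<I>" "J \<in> \<I>" "k < 2" "l < 2" "cis (\<tau> I k) = cis (\<tau> J l)" for I J k l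
  proof -
    have "I = J \<and> \<tau> I k = \<tau> J l"
      by (rule arc_system_inj[OF sys that(1,2) _ _ that(5)])
        (use breakpoints_mem[OF bp] that in \<open>auto simp: less_eq_real_def\<close>)
    then show ?thesis
      using bp that unfolding breakpoints_def less_2_cases_nat by fastforce
  qed
  show ?thesis
  proof
    assume v: "strand_coloring X R E \<I> \<tau> v"
    have ?S
    proof clarify
      fix I k J l assume q: "((I, k), (J, l)) \<in> Q"
      note q' = Q[OF q]
      show "if cis (\<tau> I k) \<in> over_pts E
        then R (positive E (cis (\<tau> I k)) (cis (\<tau> J l))) (v J l) (v J (Suc l)) (v I k) (v I (Suc k))
        else v J l = v J (Suc l) \<and> v I k = v I (Suc k)"
      proof (cases "cis (\<tau> I k) \<in> over_pts E")
        case True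
        then have "classical_crossing E (cis (\<tau> I k)) (cis (\<tau> J l))"
          using q' unfolding classical_crossing_def by blast
        then show ?thesis
          using v q' True unfolding strand_coloring_def by simp
      next
        case False
        then show ?thesis
          using v q' virt[OF q False] unfolding strand_coloring_def by simp
      qed
    qed
    then show "?X \<and> ?S"
      using v unfolding strand_coloring_def by blast
  next
    assume "?X \<and> ?S"
    then have X: ?X and S: "\<And>I k J l. ((I, k), (J, l)) \<in> Q \<Longrightarrow> if cis (\<tau> I k) \<in> over_pts E
      then R (positive E (cis (\<tau> I k)) (cis (\<tau> J l))) (v J l) (v J (Suc l)) (v I k) (v I (Suc k))
      else v J l = v J (Suc l) \<and> v I k = v I (Suc k)"
      by fastforce+
    show "strand_coloring X R E \<I> \<tau> v"
      unfolding strand_coloring_def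
    proof (intro conjI ballI allI impI)
      fix I k assume I: "I \<in> \<I>" "k < 2" and nc: "cis (\<tau> I k) \<notin> crossing_points E"
      consider J l where "((I, k), (J, l)) \<in> Q" | J l where "((J, l), (I, k)) \<in> Q"
        using cover[OF I] by fastforce
      then show "v I k = v I (Suc k)"
      proof cases
        case 1
        then have "cis (\<tau> I k) \<notin> over_pts E"
          using Q[OF 1] nc unfolding crossing_points_def classical_crossing_def by blast
        then show ?thesis using S[OF 1] by simp
      next
        case 2
        then have "cis (\<tau> J l) \<notin> over_pts E"
          using Q[OF 2] nc unfolding crossing_points_def classical_crossing_def by blast
        then show ?thesis using S[OF 2] by simp
      qed
    next
      fix I J and k l :: nat
      assume IJ: "I \<in> \<I>" "J \<in> \<I>" "k < 2" "l < 2"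
        and c: "classical_crossing E (cis (\<tau> I k)) (cis (\<tau> J l))"
      then have c': "double_point (curve E) (cis (\<tau> I k)) (cis (\<tau> J l))" "cis (\<tau> I k) \<in> over_pts E"
        unfolding classical_crossing_def by auto
      consider J' l' where "((I, k), (J', l')) \<in> Q" | J' l' where "((J', l'), (I, k)) \<in> Q"
        using cover[OF IJ(1,3)] by fastforce
      then show "R (positive E (cis (\<tau> I k)) (cis (\<tau> J l))) (v J l) (v J (Suc l)) (v I k) (v I (Suc k))"
      proof cases
        case 1
        then have "cis (\<tau> J l) = cis (\<tau> J' l')"
          using partner c'(1) Q[OF 1] by blast
        then have "J = J' \<and> l = l'"
          using inj[of J J' l l'] IJ Q[OF 1] by blast
        then show ?thesis
          using S[OF 1] c'(2) by simp
      next
        case 2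
        then show ?thesis
          using Q[OF 2] c'(2) by blast
      qed
    qed (use X in blast)
  qed
qed

section \<open>The first Reidemeister move\<close>

lemma all_le_2: "(\<forall>k\<le>2. P k) \<longleftrightarrow> P 0 \<and> P 1 \<and> P (2::nat)"
  by (auto simp: le_Suc_eq numeral_2_eq_2)

lemma crossing_point_double:
  assumes "p \<in> crossing_points E"
  obtains q where "double_point (curve E) p q"
  using assms double_point_sym unfolding crossing_points_def classical_crossing_def by blast

lemma over_unique:
  assumes "is_diagram E" "double_point (curve E) p q" "p \<in> over_pts E"
  shows "q \<notin> over_pts E"
  using assms unfolding is_diagram_def by blast

lemma (in biquandle) card_colorings_reidemeister1:
  assumes fin: "finite X" and diag: "is_diagram D" "is_diagram D'" and r1: "reidemeister1 D D'"
  shows "card (colorings X (crossing_rel ov un) D) = card (colorings X (crossing_rel ov un) D')"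
proof -
  obtain \<phi> I where ao: "agree_outside \<phi> {I} D D'"
    and none: "crossings (curve D) I I = {}" and two: "card (crossings (curve D') I I) = 2"
    using r1 unfolding reidemeister1_def by blast
  note sys = agree_outside_arc_system[OF ao finite.insertI[OF finite.emptyI]]
  obtain p q where pq: "(p, q) \<in> crossings (curve D') I I"
    using two by (metis card.empty equals0I prod.exhaust zero_neq_numeral)
  then have d: "double_point (curve D') p q" and I: "p \<in> closed_arc I" "q \<in> closed_arc I"
    unfolding crossings_def by auto
  have "{(p, q), (q, p)} \<subseteq> crossings (curve D') I I"
    using d I double_point_sym unfolding crossings_def by auto
  moreover have "card {(p, q), (q, p)} = 2"
    using d unfolding double_point_def by auto
  ultimately have eq: "crossings (curve D') I I = {(p, q), (q, p)}"
    using two by (metis card_2_iff card_subset_eq finite.emptyI finite.insertI card.infinite zero_neq_numeral)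
  have "p \<in> open_arc I" "q \<in> open_arc I"
    using agree_outside_inside[OF ao, of D' p q I] agree_outside_inside[OF ao, of D' q p I] d I double_point_sym
    by blast+
  then obtain s t where st: "s \<in> {fst I<..<snd I}" "t \<in> {fst I<..<snd I}" "p = cis s" "q = cis t"
    unfolding open_arc_def by blast
  \<comment> \<open>the two passages through the self-crossing, in the order of the strand\<close>
  define t0 t1 where "t0 = min s t" and "t1 = max s t"
  have "s \<noteq> t"
    using d st unfolding double_point_def by auto
  then have t01: "fst I < t0" "t0 < t1" "t1 < snd I"
    using st unfolding t0_def t1_def by auto
  have dt: "double_point (curve D') (cis t0) (cis t1)" and pqt: "{p, q} = {cis t0, cis t1}"
    using d double_point_sym st unfolding t0_def t1_def min_def max_def by auto
  define \<tau> :: "real \<times> real \<Rightarrow> nat \<Rightarrow> real" where "\<tau> = (\<lambda>_ k. if k = 0 then t0 else t1)"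
  have no: "\<forall>J\<in>{I}. closed_arc J \<inter> crossing_points D = {}"
  proof (rule ccontr)
    assume "\<not> (\<forall>J\<in>{I}. closed_arc J \<inter> crossing_points D = {})"
    then obtain r where r: "r \<in> closed_arc I" "r \<in> crossing_points D"
      by blast
    obtain r' where r': "double_point (curve D) r r'"
      using crossing_point_double[OF r(2)] .
    then have "r' \<in> closed_arc I"
      using agree_outside_inside[OF ao, of D r r' I] r(1) open_arc_subset by blast
    then show False
      using none r r' unfolding crossings_def by blast
  qed
  have bpD: "breakpoints D {I} \<tau>"
    using no t01 unfolding breakpoints_def \<tau>_def by simp
  have "closed_arc I \<inter> crossing_points D' \<subseteq> {cis t0, cis t1}"
  proof
    fix r assume r: "r \<in> closed_arc I \<inter> crossing_points D'"
    then obtain r' where r': "double_point (curve D') r r'"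
      using crossing_point_double by blast
    then have "r' \<in> closed_arc I"
      using agree_outside_inside[OF ao, of D' r r' I] r open_arc_subset by blast
    then have "(r, r') \<in> crossings (curve D') I I"
      using r r' unfolding crossings_def by blast
    then show "r \<in> {cis t0, cis t1}"
      using eq pqt by blast
  qed
  then have bpD': "breakpoints D' {I} \<tau>"
    using t01 unfolding breakpoints_def \<tau>_def by simp
  note scD = strand_coloring_no_crossings[OF bpD no, where R="crossing_rel ov un" and X=X]
  note sites = strand_coloring_sites[OF diag(2) sys bpD', where R="crossing_rel ov un" and X=X,
      unfolded all_le_2]
  obtain P where scD': "\<And>v. strand_coloring X (crossing_rel ov un) D' {I} \<tau> v \<longleftrightarrow>
      v I 0 \<in> X \<and> v I 1 \<in> X \<and> v I 2 \<in> X \<and> P (v I 0) (v I 1) (v I 2)"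
    and P: "\<And>a b c. a \<in> X \<Longrightarrow> b \<in> X \<Longrightarrow> c \<in> X \<Longrightarrow> P a b c \<Longrightarrow> a = c" "\<And>a. a \<in> X \<Longrightarrow> \<exists>!b. b \<in> X \<and> P a b a"
  proof (cases "cis t1 \<in> over_pts D'")
    case True
    then have no_over: "cis t0 \<notin> over_pts D'"
      using over_unique[OF diag(2)] dt double_point_sym by blast
    show thesis
    proof (rule that[of "\<lambda>a b c. crossing_rel ov un (positive D' (cis t1) (cis t0)) a b b c"])
      show "strand_coloring X (crossing_rel ov un) D' {I} \<tau> v \<longleftrightarrow>
        v I 0 \<in> X \<and> v I 1 \<in> X \<and> v I 2 \<in> X \<and>
        crossing_rel ov un (positive D' (cis t1) (cis t0)) (v I 0) (v I 1) (v I 1) (v I 2)" for v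
        using True dt no_over double_point_sym[of "curve D'" "cis t1"]
        by (subst sites[of "{((I, 1), (I, 0))}"]) (auto simp: \<tau>_def numeral_2_eq_2)
      show "a = c" if "a \<in> X" "b \<in> X" "c \<in> X" "crossing_rel ov un (positive D' (cis t1) (cis t0)) a b b c"
        for a b c
        by (rule kink_under_first(2)[OF fin that])
      show "\<exists>!b. b \<in> X \<and> crossing_rel ov un (positive D' (cis t1) (cis t0)) a b b a" if "a \<in> X" for a
        by (rule kink_under_first(1)[OF fin that])
    qed
  next
    case t1: False
    show thesis
    proof (cases "cis t0 \<in> over_pts D'")
      case True
      show thesis
      proof (rule that[of "\<lambda>a b c. crossing_rel ov un (positive D' (cis t0) (cis t1)) b c a b"])
        show "strand_coloring X (crossing_rel ov un) D' {I} \<tau> v \<longleftrightarrow>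
          v I 0 \<in> X \<and> v I 1 \<in> X \<and> v I 2 \<in> X \<and>
          crossing_rel ov un (positive D' (cis t0) (cis t1)) (v I 1) (v I 2) (v I 0) (v I 1)" for v
          using True dt t1
          by (subst sites[of "{((I, 0), (I, 1))}"]) (auto simp: \<tau>_def numeral_2_eq_2)
        show "a = c" if "a \<in> X" "b \<in> X" "c \<in> X" "crossing_rel ov un (positive D' (cis t0) (cis t1)) b c a b"
          for a b c
          by (rule kink_over_first(2)[OF fin that])
        show "\<exists>!b. b \<in> X \<and> crossing_rel ov un (positive D' (cis t0) (cis t1)) b a a b" if "a \<in> X" for a
          by (rule kink_over_first(1)[OF fin that])
      qed
    next
      case False
      show thesis
      proof (rule that[of "\<lambda>a b c. b = c \<and> a = b"])
        show "strand_coloring X (crossing_rel ov un) D' {I} \<tau> v \<longleftrightarrow>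
          v I 0 \<in> X \<and> v I 1 \<in> X \<and> v I 2 \<in> X \<and> v I 1 = v I 2 \<and> v I 0 = v I 1" for v
          using False dt t1
          by (subst sites[of "{((I, 0), (I, 1))}"]) (auto simp: \<tau>_def numeral_2_eq_2)
      qed auto
    qed
  qed
  show ?thesis
  proof (rule card_colorings_tangle[OF ao _ bpD bpD'])
    show "ends_extend X (crossing_rel ov un) {I} D \<tau> D' \<tau>"
      unfolding ends_extend_def
    proof (intro allI impI)
      fix v assume "strand_coloring X (crossing_rel ov un) D {I} \<tau> v"
      then have v: "v I 0 \<in> X" "v I 2 = v I 0"
        unfolding scD by auto
      then obtain b where "b \<in> X" "P (v I 0) b (v I 0)"
        using P(2) by blast
      then show "\<exists>w. strand_coloring X (crossing_rel ov un) D' {I} \<tau> w \<and>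
          (\<forall>J\<in>{I}. w J 0 = v J 0 \<and> w J 2 = v J 2)"
        using v by (intro exI[of _ "\<lambda>_ k. if k = 1 then b else v I 0"]) (simp add: scD')
    qed
    show "ends_extend X (crossing_rel ov un) {I} D' \<tau> D \<tau>"
      unfolding ends_extend_def
    proof (intro allI impI)
      fix v assume "strand_coloring X (crossing_rel ov un) D' {I} \<tau> v"
      then have "v I 0 \<in> X" "v I 0 = v I 2"
        using P(1) unfolding scD' by auto
      then show "\<exists>w. strand_coloring X (crossing_rel ov un) D {I} \<tau> w \<and>
          (\<forall>J\<in>{I}. w J 0 = v J 0 \<and> w J 2 = v J 2)"
        by (intro exI[of _ "\<lambda>_ _. v I 0"]) (simp add: scD)
    qed
    show "determined_by_ends X (crossing_rel ov un) D {I} \<tau>"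
      unfolding determined_by_ends_def scD by auto
    show "determined_by_ends X (crossing_rel ov un) D' {I} \<tau>"
      unfolding determined_by_ends_def scD'
    proof (intro allI impI ballI)
      fix v w :: "real \<times> real \<Rightarrow> nat \<Rightarrow> 'x" and J
      assume v: "v I 0 \<in> X \<and> v I 1 \<in> X \<and> v I 2 \<in> X \<and> P (v I 0) (v I 1) (v I 2)"
        and w: "w I 0 \<in> X \<and> w I 1 \<in> X \<and> w I 2 \<in> X \<and> P (w I 0) (w I 1) (w I 2)"
        and eq: "\<forall>I\<in>{I}. v I 0 = w I 0 \<and> v I 2 = w I 2" and J: "J \<in> {I}"
      have "v I 2 = v I 0" "w I 2 = w I 0" "v I 0 = w I 0"
        using P(1)[of "v I 0" "v I 1" "v I 2"] P(1)[of "w I 0" "w I 1" "w I 2"] v w eq by auto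
      then have "v I 1 = w I 1"
        using P(2)[of "v I 0"] v w by metis
      then show "v J 1 = w J 1"
        using J by simp
    qed
  qed simp
qed

section \<open>Strands as graphs\<close>

text \<open>A strand that runs across the square as the graph of \<open>g\<close>: \<open>T x\<close> is the parameter of the point with
  horizontal coordinate \<open>x\<close>, and \<open>\<sigma>\<close> is \<open>1\<close> for a strand running to the right and \<open>-1\<close> for one running to
  the left.\<close>

definition strand_chart ::
    "(complex \<Rightarrow> complex) \<Rightarrow> (complex \<Rightarrow> complex) \<Rightarrow> real \<times> real \<Rightarrow> real \<Rightarrow> (real \<Rightarrow> real) \<Rightarrow> (real \<Rightarrow> real) \<Rightarrow> bool" where
  "strand_chart \<phi> c I \<sigma> T g \<longleftrightarrow>
     (\<sigma> = 1 \<or> \<sigma> = -1) \<and> T (- \<sigma>) = fst I \<and> T \<sigma> = snd I \<and>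
     (\<forall>x\<in>{-1..1}. T x \<in> {fst I..snd I} \<and> \<phi> (c (cis (T x))) = Complex x (g x)) \<and>
     (\<forall>t\<in>{fst I..snd I}. \<exists>x\<in>{-1..1}. T x = t) \<and>
     (\<forall>x\<in>{-1..1}. \<forall>y\<in>{-1..1}. x < y \<longrightarrow> \<sigma> * T x < \<sigma> * T y) \<and>
     continuous_on {-1..1} g \<and>
     (\<forall>x\<in>{-1<..<1}. \<exists>v. ((\<lambda>u. \<phi> (c (cis u))) has_vector_derivative v) (at (T x)) \<and>
        0 < \<sigma> * Re v \<and> (g has_real_derivative Im v / Re v) (at x))"

lemma graph_strand_chart:
  assumes \<phi>: "plane_diffeo \<phi>" and c: "smooth (\<lambda>t::real. c (cis t))"
    and I: "fst I < snd I" and gs: "graph_strand \<phi> c I"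
  shows "\<exists>\<sigma> T g. strand_chart \<phi> c I \<sigma> T g"
proof -
  obtain \<sigma> where \<sigma>: "\<sigma> = 1 \<or> \<sigma> = (-1::real)" "Re (\<phi> (c (cis (fst I)))) = - \<sigma>" "Re (\<phi> (c (cis (snd I)))) = \<sigma>"
    "\<And>t. t \<in> {fst I..snd I} \<Longrightarrow> 0 < \<sigma> * Re (vector_derivative (\<lambda>u. \<phi> (c (cis u))) (at t))"
    using gs unfolding graph_strand_def by blast
  have \<sigma>2: "\<sigma> * \<sigma> = 1"
    using \<sigma>(1) by auto
  define \<Psi> where "\<Psi> u = \<phi> (c (cis u))" for u
  define \<Psi>' where "\<Psi>' t = vector_derivative \<Psi> (at t)" for t
  have d: "(\<Psi> has_vector_derivative \<Psi>' t) (at t)" for t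
  proof -
    obtain L where "(\<phi> has_derivative L) (at (c (cis t)))"
      using \<phi> smooth_imp_has_derivative unfolding plane_diffeo_def by metis
    from has_velocity_compose[OF this has_velocity[OF c]]
    have "(\<Psi> has_vector_derivative L (velocity c (cis t))) (at t)"
      unfolding \<Psi>_def .
    then show ?thesis
      unfolding \<Psi>'_def using vector_derivative_at by metis
  qed
  have dRe: "((\<lambda>u. Re (\<Psi> u)) has_real_derivative Re (\<Psi>' t)) (at t)"
    and dIm: "((\<lambda>u. Im (\<Psi> u)) has_real_derivative Im (\<Psi>' t)) (at t)" for t
    using d[of t] has_vector_derivative_complex_iff
    by (auto simp: has_real_derivative_iff_has_vector_derivative)
  have pos: "0 < \<sigma> * Re (\<Psi>' t)" if "t \<in> {fst I..snd I}" for t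
    using \<sigma>(4)[OF that] unfolding \<Psi>'_def \<Psi>_def .
  define f where "f u = \<sigma> * Re (\<Psi> u)" for u
  have df: "(f has_real_derivative \<sigma> * Re (\<Psi>' t)) (at t)" for t
    unfolding f_def by (intro DERIV_cmult dRe)
  have f_mono: "f s < f t" if "fst I \<le> s" "s < t" "t \<le> snd I" for s t
    by (rule DERIV_pos_imp_increasing[OF that(2)]) (use df pos that in force)
  have f_ends: "f (fst I) = -1" "f (snd I) = 1"
    using \<sigma>(1-3) unfolding f_def \<Psi>_def by auto
  have f_cont: "continuous_on {fst I..snd I} f"
    using df by (meson DERIV_isCont continuous_at_imp_continuous_on)
  have f_inj: "inj_on f {fst I..snd I}"
    by (rule inj_onI) (use f_mono in \<open>metis atLeastAtMost_iff linorder_neqE less_irrefl\<close>)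
  have f_image: "f ` {fst I..snd I} = {-1..1}"
  proof
    show "f ` {fst I..snd I} \<subseteq> {-1..1}"
    proof
      fix y assume "y \<in> f ` {fst I..snd I}"
      then obtain t where t: "t \<in> {fst I..snd I}" "y = f t" by blast
      have "f (fst I) \<le> f t" "f t \<le> f (snd I)"
        using f_mono[of "fst I" t] f_mono[of t "snd I"] t(1) by (cases "t = fst I"; cases "t = snd I"; auto)+
      then show "y \<in> {-1..1}"
        using f_ends t(2) by simp
    qed
    show "{-1..1} \<subseteq> f ` {fst I..snd I}"
    proof
      fix y :: real assume "y \<in> {-1..1}"
      then have "\<exists>t\<ge>fst I. t \<le> snd I \<and> f t = y"
        using f_ends I f_cont by (intro IVT') auto
      then show "y \<in> f ` {fst I..snd I}" by auto
    qed
  qed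
  define S where "S = inv_into {fst I..snd I} f"
  have S: "S y \<in> {fst I..snd I}" "f (S y) = y" if "y \<in> {-1..1}" for y
    using that f_image unfolding S_def by (metis inv_into_into, metis f_inv_into_f)
  have Sf: "S (f t) = t" if "t \<in> {fst I..snd I}" for t
    unfolding S_def using f_inj that by simp
  have S_mono: "S y < S z" if "y \<in> {-1..1}" "z \<in> {-1..1}" "y < z" for y z
  proof (rule ccontr)
    assume "\<not> S y < S z"
    then have "f (S z) \<le> f (S y)"
      using f_mono[of "S z" "S y"] S(1)[OF that(1)] S(1)[OF that(2)] by (cases "S z = S y") auto
    then show False
      using S(2)[OF that(1)] S(2)[OF that(2)] that(3) by simp
  qed
  have "continuous_on (f ` {fst I..snd I}) S"
    by (rule continuous_on_inv[OF f_cont]) (use Sf in auto)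
  then have S_cont: "continuous_on {-1..1} S"
    unfolding f_image .
  have \<sigma>_mem: "\<sigma> * x \<in> {-1..1}" if "x \<in> {-1..1}" for x
    using that \<sigma>(1) by auto
  define T where "T x = S (\<sigma> * x)" for x
  have T: "T x \<in> {fst I..snd I}" "Re (\<Psi> (T x)) = x" if "x \<in> {-1..1}" for x
  proof -
    show "T x \<in> {fst I..snd I}"
      unfolding T_def by (rule S(1)[OF \<sigma>_mem[OF that]])
    have "\<sigma> * Re (\<Psi> (T x)) = \<sigma> * x"
      using S(2)[OF \<sigma>_mem[OF that]] unfolding f_def T_def .
    then show "Re (\<Psi> (T x)) = x"
      using \<sigma>(1) by auto
  qed
  have T_cont: "continuous_on {-1..1} T"
    unfolding T_def by (rule continuous_on_compose2[OF S_cont]) (use \<sigma>_mem in \<open>auto intro!: continuous_intros\<close>)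
  define g where "g x = Im (\<Psi> (T x))" for x
  have "continuous_on UNIV \<Psi>"
    using d by (meson continuous_at_imp_continuous_on has_vector_derivative_continuous)
  then have g_cont: "continuous_on {-1..1} g"
    unfolding g_def by (intro continuous_on_Im continuous_on_compose2[OF _ T_cont]) auto
  have deriv: "\<exists>v. (\<Psi> has_vector_derivative v) (at (T x)) \<and> 0 < \<sigma> * Re v \<and> (g has_real_derivative Im v / Re v) (at x)"
    if x: "x \<in> {-1<..<1}" for x
  proof -
    have x': "x \<in> {-1..1}" using x by auto
    have p: "0 < \<sigma> * Re (\<Psi>' (T x))"
      by (rule pos[OF T(1)[OF x']])
    have "(T has_real_derivative inverse (Re (\<Psi>' (T x)))) (at x)"
    proof (rule DERIV_inverse_function[where f="\<lambda>u. Re (\<Psi> u)" and a="-1" and b=1])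
      show "((\<lambda>u. Re (\<Psi> u)) has_real_derivative Re (\<Psi>' (T x))) (at (T x))"
        by (rule dRe)
      show "isCont T x"
        using continuous_on_interior[OF T_cont] x by simp
    qed (use p x T in auto)
    from DERIV_chain2[OF dIm this]
    have "(g has_real_derivative Im (\<Psi>' (T x)) * inverse (Re (\<Psi>' (T x)))) (at x)"
      unfolding g_def .
    then show ?thesis
      using d p by (auto simp: divide_inverse)
  qed
  have "strand_chart \<phi> c I \<sigma> T g"
    unfolding strand_chart_def
  proof (intro conjI ballI impI)
    show "T (- \<sigma>) = fst I" "T \<sigma> = snd I"
      unfolding T_def using Sf[of "fst I"] Sf[of "snd I"] f_ends I \<sigma>2 by auto
    show "\<phi> (c (cis (T x))) = Complex x (g x)" if "x \<in> {-1..1}" for x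
      using T(2)[OF that] unfolding g_def \<Psi>_def by (simp add: complex_eq_iff)
    show "\<exists>x\<in>{-1..1}. T x = t" if "t \<in> {fst I..snd I}" for t
    proof
      show "\<sigma> * f t \<in> {-1..1}"
        using f_image that \<sigma>_mem by blast
      show "T (\<sigma> * f t) = t"
        unfolding T_def using Sf[OF that] \<sigma>2 by (simp add: mult.assoc[symmetric])
    qed
    show "\<sigma> * T x < \<sigma> * T y" if "x \<in> {-1..1}" "y \<in> {-1..1}" "x < y" for x y
      using \<sigma>(1) S_mono[of x y] S_mono[of "- y" "- x"] that unfolding T_def by auto
  qed (use \<sigma>(1) T(1) g_cont deriv in \<open>auto simp: \<Psi>_def[abs_def]\<close>)
  then show ?thesis by blast
qed

lemma strand_chartD:
  assumes "strand_chart \<phi> c I \<sigma> T g"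
  shows "\<sigma> = 1 \<or> \<sigma> = -1" "T (- \<sigma>) = fst I" "T \<sigma> = snd I"
    "x \<in> {-1..1} \<Longrightarrow> T x \<in> {fst I..snd I}"
    "x \<in> {-1..1} \<Longrightarrow> \<phi> (c (cis (T x))) = Complex x (g x)"
    "t \<in> {fst I..snd I} \<Longrightarrow> \<exists>x\<in>{-1..1}. T x = t"
    "x \<in> {-1..1} \<Longrightarrow> y \<in> {-1..1} \<Longrightarrow> x < y \<Longrightarrow> \<sigma> * T x < \<sigma> * T y"
    "continuous_on {-1..1} g"
    "x \<in> {-1<..<1} \<Longrightarrow> \<exists>v. ((\<lambda>u. \<phi> (c (cis u))) has_vector_derivative v) (at (T x)) \<and>
        0 < \<sigma> * Re v \<and> (g has_real_derivative Im v / Re v) (at x)"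
  using assms unfolding strand_chart_def by blast+

lemma strand_chart_closed_arc:
  assumes "strand_chart \<phi> c I \<sigma> T g"
  shows "x \<in> {-1..1} \<Longrightarrow> cis (T x) \<in> closed_arc I"
    "p \<in> closed_arc I \<Longrightarrow> \<exists>x\<in>{-1..1}. p = cis (T x)"
  using strand_chartD(4,6)[OF assms] unfolding closed_arc_def by blast+

lemma strand_chart_less_iff:
  assumes ch: "strand_chart \<phi> c I \<sigma> T g" and "x \<in> {-1..1}" "y \<in> {-1..1}" "x \<noteq> y"
  shows "T x < T y \<longleftrightarrow> (x < y) = (\<sigma> = 1)"
  using strand_chartD(1)[OF ch] strand_chartD(7)[OF ch assms(2,3)] strand_chartD(7)[OF ch assms(3,2)] assms(4)
  by (cases "x < y") auto

lemma strand_chart_double_point: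
  assumes \<phi>: "plane_diffeo \<phi>"
    and I: "strand_chart \<phi> c I \<sigma> T g" and J: "strand_chart \<phi> c J \<rho> U h"
    and xy: "x \<in> {-1..1}" "y \<in> {-1..1}"
  shows "double_point c (cis (T x)) (cis (U y)) \<longleftrightarrow> cis (T x) \<noteq> cis (U y) \<and> x = y \<and> g x = h x"
proof -
  have "inj \<phi>"
    using \<phi> unfolding plane_diffeo_def bij_def by blast
  then have "c (cis (T x)) = c (cis (U y)) \<longleftrightarrow> \<phi> (c (cis (T x))) = \<phi> (c (cis (U y)))"
    by (simp add: inj_eq)
  also have "\<dots> \<longleftrightarrow> x = y \<and> g x = h x"
    unfolding strand_chartD(5)[OF I xy(1)] strand_chartD(5)[OF J xy(2)] by auto
  finally show ?thesis
    unfolding double_point_def by auto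
qed

lemma no_zero_same_sign:
  fixes d :: "real \<Rightarrow> real"
  assumes "a \<le> b" "continuous_on {a..b} d" "\<And>x. x \<in> {a..b} \<Longrightarrow> d x \<noteq> 0"
  shows "0 < d a \<longleftrightarrow> 0 < d b"
proof (rule ccontr)
  assume neg: "\<not> (0 < d a \<longleftrightarrow> 0 < d b)"
  then have "d a \<le> 0 \<and> 0 \<le> d b \<or> d b \<le> 0 \<and> 0 \<le> d a"
    by auto
  then have "\<exists>x\<ge>a. x \<le> b \<and> d x = 0"
    using IVT'[of d a 0 b] IVT2'[of d b 0 a] assms(1,2) by blast
  then show False
    using assms(3) by auto
qed

lemma derivative_sign:
  fixes d :: "real \<Rightarrow> real"
  assumes "(d has_real_derivative D) (at x)" "D \<noteq> 0" "d x = 0" "\<epsilon> > 0"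
  obtains h where "0 < h" "h < \<epsilon>" "0 < d (x + h) \<longleftrightarrow> 0 < D" "0 < d (x - h) \<longleftrightarrow> \<not> 0 < D"
proof (cases "0 < D")
  case True
  obtain a where a: "a > 0" "\<And>h. 0 < h \<Longrightarrow> h < a \<Longrightarrow> d x < d (x + h)"
    using DERIV_pos_inc_right[OF assms(1) True] by blast
  obtain b where b: "b > 0" "\<And>h. 0 < h \<Longrightarrow> h < b \<Longrightarrow> d (x - h) < d x"
    using DERIV_pos_inc_left[OF assms(1) True] by blast
  define h where "h = min (min a b) \<epsilon> / 2"
  have "0 < h" "h < a" "h < b" "h < \<epsilon>"
    using a(1) b(1) assms(4) unfolding h_def by (auto simp: min_def)
  then show ?thesis
    using that[of h] a(2)[of h] b(2)[of h] assms(3) True by auto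
next
  case False
  then have neg: "D < 0" using assms(2) by simp
  obtain a where a: "a > 0" "\<And>h. 0 < h \<Longrightarrow> h < a \<Longrightarrow> d (x + h) < d x"
    using DERIV_neg_dec_right[OF assms(1) neg] by blast
  obtain b where b: "b > 0" "\<And>h. 0 < h \<Longrightarrow> h < b \<Longrightarrow> d x < d (x - h)"
    using DERIV_neg_dec_left[OF assms(1) neg] by blast
  define h where "h = min (min a b) \<epsilon> / 2"
  have "0 < h" "h < a" "h < b" "h < \<epsilon>"
    using a(1) b(1) assms(4) unfolding h_def by (auto simp: min_def)
  then show ?thesis
    using that[of h] a(2)[of h] b(2)[of h] assms(3) False by auto
qed

lemma single_zero_signs:
  fixes d :: "real \<Rightarrow> real"
  assumes cont: "continuous_on {a..b} d" and x: "a < x" "x < b"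
    and zeros: "\<And>y. y \<in> {a..b} \<Longrightarrow> d y = 0 \<longleftrightarrow> y = x"
    and D: "(d has_real_derivative D) (at x)" "D \<noteq> 0"
  shows "0 < D \<longleftrightarrow> \<not> 0 < d a"
    "a \<le> y \<Longrightarrow> y < x \<Longrightarrow> 0 < d y \<longleftrightarrow> 0 < d a"
    "x < y \<Longrightarrow> y \<le> b \<Longrightarrow> 0 < d y \<longleftrightarrow> \<not> 0 < d a"
proof -
  have sub: "continuous_on {u..v} d" if "a \<le> u" "v \<le> b" for u v
    by (rule continuous_on_subset[OF cont]) (use that in auto)
  have left: "0 < d y \<longleftrightarrow> 0 < d a" if "a \<le> y" "y < x" for y
    using no_zero_same_sign[of a y d] sub[of a y] zeros that x by auto
  have right: "0 < d y \<longleftrightarrow> 0 < d b" if "x < y" "y \<le> b" for y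
    using no_zero_same_sign[of y b d] sub[of y b] zeros that x by auto
  have "d x = 0" using zeros[of x] x by simp
  moreover have "0 < min (x - a) (b - x)" using x by simp
  ultimately obtain h where h: "0 < h" "h < min (x - a) (b - x)"
    "0 < d (x + h) \<longleftrightarrow> 0 < D" "0 < d (x - h) \<longleftrightarrow> \<not> 0 < D"
    using derivative_sign[OF D] by blast
  then have *: "0 < d a \<longleftrightarrow> \<not> 0 < D" "0 < d b \<longleftrightarrow> 0 < D"
    using left[of "x - h"] right[of "x + h"] by auto
  show "0 < D \<longleftrightarrow> \<not> 0 < d a"
    using * by blast
  show "a \<le> y \<Longrightarrow> y < x \<Longrightarrow> 0 < d y \<longleftrightarrow> 0 < d a"
    by (rule left)
  show "x < y \<Longrightarrow> y \<le> b \<Longrightarrow> 0 < d y \<longleftrightarrow> \<not> 0 < d a"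
    using right * by blast
qed

lemma consecutive_zeros_signs:
  fixes d :: "real \<Rightarrow> real"
  assumes cont: "continuous_on {a..b} d" and xy: "a \<le> x" "x < y" "y \<le> b"
    and zeros: "\<And>z. x < z \<Longrightarrow> z < y \<Longrightarrow> d z \<noteq> 0" and 0: "d x = 0" "d y = 0"
    and D: "(d has_real_derivative D) (at x)" "D \<noteq> 0" and E: "(d has_real_derivative E) (at y)" "E \<noteq> 0"
  shows "0 < D \<longleftrightarrow> \<not> 0 < E"
proof -
  have "0 < (y - x) / 2" using xy by simp
  obtain h where h: "0 < h" "h < (y - x) / 2" "0 < d (x + h) \<longleftrightarrow> 0 < D"
    using derivative_sign[OF D 0(1) \<open>0 < (y - x) / 2\<close>] by blast
  obtain k where k: "0 < k" "k < (y - x) / 2" "0 < d (y - k) \<longleftrightarrow> \<not> 0 < E"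
    using derivative_sign[OF E 0(2) \<open>0 < (y - x) / 2\<close>] by blast
  have "x + h \<le> y - k"
    using h(2) k(2) by (simp add: field_simps)
  moreover have "continuous_on {x + h..y - k} d"
    by (rule continuous_on_subset[OF cont]) (use h(1) k(1) xy in auto)
  ultimately have "0 < d (x + h) \<longleftrightarrow> 0 < d (y - k)"
    by (rule no_zero_same_sign) (use zeros h(1) k(1) in auto)
  then show ?thesis
    using h(3) k(3) by blast
qed

text \<open>The slopes of the graphs determine the sign of a crossing: with \<open>v\<close>, \<open>w\<close> the velocities in the chart,
  \<open>wedge v w\<close> is the product of the horizontal components and the difference of the slopes, and the
  chart preserves the sign of \<^const>\<open>wedge\<close>.\<close>

lemma strand_chart_crossing_sign:
  assumes diag: "is_diagram E" and \<phi>: "oriented_plane_diffeo \<phi>"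
    and I: "strand_chart \<phi> (curve E) I \<sigma> T g" and J: "strand_chart \<phi> (curve E) J \<rho> U h"
    and x: "x \<in> {-1<..<1}" and d: "double_point (curve E) (cis (T x)) (cis (U x))"
  shows "\<exists>D. ((\<lambda>x. h x - g x) has_real_derivative D) (at x) \<and> D \<noteq> 0 \<and>
    (positive E (cis (T x)) (cis (U x)) \<longleftrightarrow> ((\<sigma> = \<rho>) \<longleftrightarrow> 0 < D))"
proof -
  let ?c = "curve E" and ?z = "curve E (cis (T x))"
  let ?p = "velocity ?c (cis (T x))" and ?q = "velocity ?c (cis (U x))"
  have z: "curve E (cis (U x)) = ?z"
    using d unfolding double_point_def by simp
  obtain L where L: "(\<phi> has_derivative L) (at ?z)"
    using \<phi> smooth_imp_has_derivative unfolding oriented_plane_diffeo_def plane_diffeo_def by metis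
  have "frechet_derivative \<phi> (at ?z) = L"
    using frechet_derivative_at[OF L] by simp
  then have det: "0 < wedge (L 1) (L \<i>)"
    using \<phi> unfolding oriented_plane_diffeo_def by metis
  obtain v where v: "((\<lambda>u. \<phi> (?c (cis u))) has_vector_derivative v) (at (T x))" "0 < \<sigma> * Re v"
    "(g has_real_derivative Im v / Re v) (at x)"
    using strand_chartD(9)[OF I x] by blast
  obtain w where w: "((\<lambda>u. \<phi> (?c (cis u))) has_vector_derivative w) (at (U x))" "0 < \<rho> * Re w"
    "(h has_real_derivative Im w / Re w) (at x)"
    using strand_chartD(9)[OF J x] by blast
  have "v = L ?p"
    using vector_derivative_unique_at[OF v(1) has_velocity_compose[OF L diagram_has_velocity[OF diag]]] .
  moreover have "w = L ?q"
    using vector_derivative_unique_at[OF w(1) has_velocity_compose[OF _ diagram_has_velocity[OF diag]], of L] L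
    unfolding z by blast
  ultimately have wvw: "wedge v w = wedge (L 1) (L \<i>) * wedge ?p ?q"
    by (simp only: wedge_linear[OF has_derivative_linear[OF L], of ?p ?q])
  have nz: "wedge ?p ?q \<noteq> 0"
    using diag d unfolding is_diagram_def generic_immersion_def by blast
  let ?D = "Im w / Re w - Im v / Re v"
  have Re: "Re v \<noteq> 0" "Re w \<noteq> 0"
    using v(2) w(2) by auto
  then have eq: "wedge v w = Re v * Re w * ?D"
    unfolding wedge_def by (simp add: field_simps)
  have sg: "0 < Re v * Re w \<longleftrightarrow> \<sigma> = \<rho>"
    using strand_chartD(1)[OF I] strand_chartD(1)[OF J] v(2) w(2) by (auto simp: zero_less_mult_iff)
  have "positive E (cis (T x)) (cis (U x)) \<longleftrightarrow> 0 < wedge v w"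
    unfolding positive_def wvw using det by (simp add: zero_less_mult_iff)
  also have "\<dots> \<longleftrightarrow> ((\<sigma> = \<rho>) \<longleftrightarrow> 0 < ?D)"
  proof -
    have "?D \<noteq> 0" "Re v * Re w \<noteq> 0"
      using eq wvw det nz Re by auto
    then show ?thesis
      unfolding eq sg[symmetric] by (auto simp: zero_less_mult_iff mult_less_0_iff)
  qed
  finally have "positive E (cis (T x)) (cis (U x)) \<longleftrightarrow> ((\<sigma> = \<rho>) \<longleftrightarrow> 0 < ?D)" .
  moreover have "?D \<noteq> 0"
    using eq wvw det nz by auto
  moreover have "((\<lambda>x. h x - g x) has_real_derivative ?D) (at x)"
    by (rule DERIV_diff[OF w(3) v(3)])
  ultimately show ?thesis by blast
qed

lemma strand_chart_no_self_crossing: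
  assumes \<phi>: "plane_diffeo \<phi>" and I: "strand_chart \<phi> c I \<sigma> T g"
    and pq: "p \<in> closed_arc I" "q \<in> closed_arc I"
  shows "\<not> double_point c p q"
proof
  assume d: "double_point c p q"
  obtain x y where xy: "x \<in> {-1..1}" "y \<in> {-1..1}" "p = cis (T x)" "q = cis (T y)"
    using strand_chart_closed_arc(2)[OF I] pq by blast
  have "cis (T x) \<noteq> cis (T y) \<and> x = y \<and> g x = g y"
    using strand_chart_double_point[OF \<phi> I I xy(1,2)] d unfolding xy(3,4) by blast
  then show False by blast
qed

text \<open>Two strands \<open>I\<close> and \<open>J\<close> of a disc, the graphs of \<open>g\<close> and \<open>h\<close>. The signs of
  their crossings are taken with \<open>I\<close> as the over strand.\<close>

locale strand_pair =
  fixes E :: vdiagram and \<phi> :: "complex \<Rightarrow> complex" and \<I> :: "(real \<times> real) set"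
    and I J :: "real \<times> real" and \<sigma> \<rho> :: real and T U g h :: "real \<Rightarrow> real"
  assumes diag: "is_diagram E" and orient: "oriented_plane_diffeo \<phi>" and sys: "arc_system \<I>"
    and mem: "I \<in> \<I>" "J \<in> \<I>" "I \<noteq> J"
    and chI: "strand_chart \<phi> (curve E) I \<sigma> T g" and chJ: "strand_chart \<phi> (curve E) J \<rho> U h"
    and ends: "\<not> double_point (curve E) (cis (fst I)) q" "\<not> double_point (curve E) (cis (snd I)) q"
begin

lemma cis_neq: "x \<in> {-1..1} \<Longrightarrow> y \<in> {-1..1} \<Longrightarrow> cis (T x) \<noteq> cis (U y)"
  using arc_system_inj[OF sys mem(1,2) strand_chartD(4)[OF chI] strand_chartD(4)[OF chJ]] mem(3) by blast

lemma double_point_iff: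
  "x \<in> {-1..1} \<Longrightarrow> y \<in> {-1..1} \<Longrightarrow>
    double_point (curve E) (cis (T x)) (cis (U y)) \<longleftrightarrow> x = y \<and> g x = h x"
  using strand_chart_double_point[OF _ chI chJ] orient cis_neq unfolding oriented_plane_diffeo_def by blast

lemma meet_interior:
  assumes "x \<in> {-1..1}" "g x = h x"
  shows "x \<in> {-1<..<1}"
proof -
  have d: "double_point (curve E) (cis (T x)) (cis (U x))"
    using double_point_iff assms by blast
  have "T (-1) \<in> {fst I, snd I}" "T 1 \<in> {fst I, snd I}"
    using strand_chartD(1,2,3)[OF chI] by auto
  then have "x \<noteq> -1" "x \<noteq> 1"
    using d ends by auto
  then show ?thesis
    using assms(1) by simp
qed

lemma crossings_eq:
  "crossings (curve E) I J = (\<lambda>x. (cis (T x), cis (U x))) ` {x \<in> {-1..1}. g x = h x}"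
proof (intro equalityI subsetI)
  fix z assume "z \<in> crossings (curve E) I J"
  then obtain p q where z: "z = (p, q)" "p \<in> closed_arc I" "q \<in> closed_arc J" "double_point (curve E) p q"
    unfolding crossings_def by auto
  then obtain x y where xy: "x \<in> {-1..1}" "y \<in> {-1..1}" "p = cis (T x)" "q = cis (U y)"
    using strand_chart_closed_arc(2)[OF chI] strand_chart_closed_arc(2)[OF chJ] by blast
  then have "x = y" "g x = h x"
    using double_point_iff z(4) by auto
  then show "z \<in> (\<lambda>x. (cis (T x), cis (U x))) ` {x \<in> {-1..1}. g x = h x}"
    using xy z(1) by blast
next
  fix z assume "z \<in> (\<lambda>x. (cis (T x), cis (U x))) ` {x \<in> {-1..1}. g x = h x}"
  then obtain x where "x \<in> {-1..1}" "g x = h x" "z = (cis (T x), cis (U x))"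
    by blast
  then show "z \<in> crossings (curve E) I J"
    using double_point_iff strand_chart_closed_arc(1)[OF chI] strand_chart_closed_arc(1)[OF chJ]
    unfolding crossings_def by blast
qed

lemma cis_T_inj: "x \<in> {-1..1} \<Longrightarrow> y \<in> {-1..1} \<Longrightarrow> cis (T x) = cis (T y) \<Longrightarrow> x = y"
  using arc_system_inj[OF sys mem(1,1) strand_chartD(4)[OF chI] strand_chartD(4)[OF chI]]
    strand_chartD(7)[OF chI, of x y] strand_chartD(7)[OF chI, of y x]
  by (metis less_irrefl linorder_neqE_linordered_idom)

lemma card_crossings: "card (crossings (curve E) I J) = card {x \<in> {-1..1}. g x = h x}"
  unfolding crossings_eq by (rule card_image) (auto intro!: inj_onI cis_T_inj)

lemma interior_param:
  assumes "x \<in> {-1..1}" "g x = h x"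
  shows "fst I < T x" "T x < snd I"
proof -
  have d: "double_point (curve E) (cis (T x)) (cis (U x))"
    using double_point_iff assms by blast
  then have "T x \<noteq> fst I" "T x \<noteq> snd I"
    using ends by metis+
  then show "fst I < T x" "T x < snd I"
    using strand_chartD(4)[OF chI assms(1)] by auto
qed

lemma crossing_sign:
  assumes "x \<in> {-1..1}" "g x = h x"
  obtains d where "((\<lambda>x. h x - g x) has_real_derivative d) (at x)" "d \<noteq> 0"
    "positive E (cis (T x)) (cis (U x)) \<longleftrightarrow> ((\<sigma> = \<rho>) \<longleftrightarrow> 0 < d)"
  using strand_chart_crossing_sign[OF diag orient chI chJ meet_interior[OF assms]] double_point_iff assms by blast

lemma continuous_difference: "continuous_on {-1..1} (\<lambda>x. h x - g x)"
  by (intro continuous_on_diff strand_chartD(8)[OF chI] strand_chartD(8)[OF chJ])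

text \<open>At a single crossing the vertical order of the strands changes, so their order at the left side
  of the square determines the sign of the crossing.\<close>

lemma single_crossing:
  assumes "card (crossings (curve E) I J) = 1"
  obtains x where "x \<in> {-1<..<1}" "\<forall>y\<in>{-1..1}. g y = h y \<longleftrightarrow> y = x"
    "positive E (cis (T x)) (cis (U x)) \<longleftrightarrow> ((\<sigma> = \<rho>) \<longleftrightarrow> \<not> g (-1) < h (-1))"
    "\<forall>y\<in>{-1..1}. y < x \<longrightarrow> (g y < h y \<longleftrightarrow> g (-1) < h (-1))"
    "\<forall>y\<in>{-1..1}. x < y \<longrightarrow> (g y < h y \<longleftrightarrow> \<not> g (-1) < h (-1))"
proof -
  obtain x where Z: "{x \<in> {-1..1}. g x = h x} = {x}"
    using assms unfolding card_crossings by (rule card_1_singletonE)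
  then have x: "x \<in> {-1..1}" "g x = h x"
    by blast+
  have zeros: "h y - g y = 0 \<longleftrightarrow> y = x" if "y \<in> {-1..1}" for y
  proof -
    have "y \<in> {x \<in> {-1..1}. g x = h x} \<longleftrightarrow> y \<in> {x}"
      unfolding Z ..
    then show ?thesis using that by auto
  qed
  obtain d where d: "((\<lambda>x. h x - g x) has_real_derivative d) (at x)" "d \<noteq> 0"
    "positive E (cis (T x)) (cis (U x)) \<longleftrightarrow> ((\<sigma> = \<rho>) \<longleftrightarrow> 0 < d)"
    by (rule crossing_sign[OF x])
  have int: "-1 < x" "x < 1"
    using meet_interior[OF x] by auto
  note s = single_zero_signs[OF continuous_difference int zeros d(1,2)]
  show ?thesis
  proof (rule that[of x])
    show "x \<in> {-1<..<1}"
      using int by simp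
    show "\<forall>y\<in>{-1..1}. g y = h y \<longleftrightarrow> y = x"
    proof
      fix y :: real assume "y \<in> {-1..1}"
      from zeros[OF this] show "g y = h y \<longleftrightarrow> y = x" by auto
    qed
    show "positive E (cis (T x)) (cis (U x)) \<longleftrightarrow> ((\<sigma> = \<rho>) \<longleftrightarrow> \<not> g (-1) < h (-1))"
      using d(3) s(1) by simp
    show "\<forall>y\<in>{-1..1}. y < x \<longrightarrow> (g y < h y \<longleftrightarrow> g (-1) < h (-1))"
    proof (intro ballI impI)
      fix y :: real assume y: "y \<in> {-1..1}" "y < x"
      from s(2)[of y] y show "g y < h y \<longleftrightarrow> g (-1) < h (-1)" by simp
    qed
    show "\<forall>y\<in>{-1..1}. x < y \<longrightarrow> (g y < h y \<longleftrightarrow> \<not> g (-1) < h (-1))"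
    proof (intro ballI impI)
      fix y :: real assume y: "y \<in> {-1..1}" "x < y"
      from s(3)[of y] y show "g y < h y \<longleftrightarrow> \<not> g (-1) < h (-1)" by simp
    qed
  qed
qed

text \<open>If there are just two crossings, then their signs are opposite.\<close>

lemma two_crossings:
  assumes "card (crossings (curve E) I J) = 2"
  obtains x y where "x \<in> {-1..1}" "y \<in> {-1..1}" "x < y" "\<forall>z\<in>{-1..1}. g z = h z \<longleftrightarrow> z = x \<or> z = y"
    "positive E (cis (T x)) (cis (U x)) \<longleftrightarrow> \<not> positive E (cis (T y)) (cis (U y))"
proof -
  obtain x' y' where Z': "{x \<in> {-1..1}. g x = h x} = {x', y'}" "x' \<noteq> y'"
    using assms unfolding card_crossings card_2_iff by blast
  define x y where "x = min x' y'" and "y = max x' y'"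
  have Z: "{x \<in> {-1..1}. g x = h x} = {x, y}" and "x < y"
    using Z' unfolding x_def y_def by (auto simp: min_def max_def)
  have x: "x \<in> {-1..1}" "g x = h x" and y: "y \<in> {-1..1}" "g y = h y"
    using Z by blast+
  have zeros: "g z = h z \<longleftrightarrow> z = x \<or> z = y" if "z \<in> {-1..1}" for z
    using that Z by blast
  obtain d where d: "((\<lambda>x. h x - g x) has_real_derivative d) (at x)" "d \<noteq> 0"
    "positive E (cis (T x)) (cis (U x)) \<longleftrightarrow> ((\<sigma> = \<rho>) \<longleftrightarrow> 0 < d)"
    by (rule crossing_sign[OF x])
  obtain e where e: "((\<lambda>x. h x - g x) has_real_derivative e) (at y)" "e \<noteq> 0"
    "positive E (cis (T y)) (cis (U y)) \<longleftrightarrow> ((\<sigma> = \<rho>) \<longleftrightarrow> 0 < e)"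
    by (rule crossing_sign[OF y])
  have "0 < d \<longleftrightarrow> \<not> 0 < e"
  proof (rule consecutive_zeros_signs[OF continuous_difference _ \<open>x < y\<close> _ _ _ _ d(1,2) e(1,2)])
    show "h z - g z \<noteq> 0" if "x < z" "z < y" for z
      using zeros[of z] that x(1) y(1) by auto
  qed (use x y in auto)
  then have "positive E (cis (T x)) (cis (U x)) \<longleftrightarrow> \<not> positive E (cis (T y)) (cis (U y))"
    using d(3) e(3) by blast
  with x y \<open>x < y\<close> zeros show ?thesis
    by (intro that[of x y]) auto
qed

end

section \<open>The second Reidemeister move\<close>

lemma crossing_rel_trivial:
  "crossing_rel (\<lambda>x y. x) (\<lambda>x y. x) pos ui uo oi ot \<longleftrightarrow> ui = uo \<and> oi = ot"
  unfolding crossing_rel_def by auto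

text \<open>Two consecutive crossings of opposite signs, for parallel and for antiparallel strands. Reversing
  both strands at the second crossing turns it into a copy of the first one, with the same labels on
  the segments between the crossings.\<close>

lemma crossing_rel_cancel:
  assumes ops: "switch_ops X ov un"
    and X: "v0 \<in> X" "v1 \<in> X" "v2 \<in> X" "w0 \<in> X" "w1 \<in> X" "w2 \<in> X"
  shows "crossing_rel ov un pos w0 w1 v0 v1 \<Longrightarrow> crossing_rel ov un (\<not> pos) w1 w2 v1 v2 \<Longrightarrow> v2 = v0 \<and> w2 = w0"
    "crossing_rel ov un pos w1 w2 v0 v1 \<Longrightarrow> crossing_rel ov un (\<not> pos) w0 w1 v1 v2 \<Longrightarrow> v2 = v0 \<and> w2 = w0"
proof -
  note det = crossing_rel_corner_determined[OF ops, unfolded corner_determined_def, rule_format]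
  show "crossing_rel ov un pos w0 w1 v0 v1 \<Longrightarrow> crossing_rel ov un (\<not> pos) w1 w2 v1 v2 \<Longrightarrow> v2 = v0 \<and> w2 = w0"
    unfolding crossing_rel_flip
    using det[of w2 w1 v2 v1 w0 w1 v0 v1 pos] X by blast
  show "crossing_rel ov un pos w1 w2 v0 v1 \<Longrightarrow> crossing_rel ov un (\<not> pos) w0 w1 v1 v2 \<Longrightarrow> v2 = v0 \<and> w2 = w0"
    unfolding crossing_rel_flip
    using det[of w1 w2 v0 v1 w1 w0 v2 v1 pos] X by blast
qed

text \<open>If the strands are antiparallel then \<open>J\<close> meets the two crossings in the opposite order.\<close>

lemma (in biquandle) card_colorings_reidemeister2:
  assumes diags: "is_diagram D" "is_diagram D'" and r2: "reidemeister2 D D'"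
  shows "card (colorings X (crossing_rel ov un) D) = card (colorings X (crossing_rel ov un) D')"
proof -
  obtain \<phi> I J where IJ: "I \<noteq> J" and ao: "agree_outside \<phi> {I, J} D D'"
    and gs: "\<And>E L. E \<in> {D, D'} \<Longrightarrow> L \<in> {I, J} \<Longrightarrow> graph_strand \<phi> (curve E) L"
    and none: "crossings (curve D) I J = {}" and two: "card (crossings (curve D') I J) = 2"
    and mode: "strand_over D' I J \<or> strands_virtual D' I J"
    using r2 unfolding reidemeister2_def by blast
  have fin: "finite {I, J}" by simp
  note sys = agree_outside_arc_system[OF ao fin]
  have orient: "oriented_plane_diffeo \<phi>"
    by (rule agree_outsideD(1)[OF ao])
  then have \<phi>: "plane_diffeo \<phi>"
    unfolding oriented_plane_diffeo_def by blast
  have chart: "\<exists>\<sigma> T g. strand_chart \<phi> (curve E) L \<sigma> T g" if "E \<in> {D, D'}" "L \<in> {I, J}" for E L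
  proof (rule graph_strand_chart[OF \<phi> _ _ gs[OF that]])
    show "smooth (\<lambda>t::real. curve E (cis t))"
      using diags that(1) unfolding is_diagram_def generic_immersion_def by blast
    show "fst L < snd L"
      using sys that(2) unfolding arc_system_def by blast
  qed
  have inside: "(p, q) \<in> crossings (curve E) I J \<or> (q, p) \<in> crossings (curve E) I J"
    if E: "E \<in> {D, D'}" and d: "double_point (curve E) p q" and p: "p \<in> closed_arc L" "L \<in> {I, J}" for E p q L
  proof -
    obtain M where M: "M \<in> {I, J}" "q \<in> closed_arc M"
      using agree_outside_inside[OF ao E d p(2,1)] open_arc_subset by blast
    obtain \<sigma> T g where ch: "strand_chart \<phi> (curve E) L \<sigma> T g"
      using chart[OF E p(2)] by blast
    have "L \<noteq> M"
      using strand_chart_no_self_crossing[OF \<phi> ch p(1)] M(2) d by blast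
    then show ?thesis
      using p M d double_point_sym unfolding crossings_def by auto
  qed
  obtain \<sigma> T g where chI: "strand_chart \<phi> (curve D') I \<sigma> T g"
    using chart[of D' I] by blast
  obtain \<rho> U h where chJ: "strand_chart \<phi> (curve D') J \<rho> U h"
    using chart[of D' J] by blast
  interpret IJ: strand_pair D' \<phi> "{I, J}" I J \<sigma> \<rho> T U g h
    by unfold_locales
      (use diags(2) orient sys IJ chI chJ agree_outsideD(5,6)[OF ao, of D' I] in auto)
  interpret JI: strand_pair D' \<phi> "{I, J}" J I \<rho> \<sigma> U T h g
    by unfold_locales
      (use diags(2) orient sys IJ chI chJ agree_outsideD(5,6)[OF ao, of D' J] in auto)
  obtain x y where xy: "x \<in> {-1..1}" "y \<in> {-1..1}" "x < y"
    and zeros: "\<forall>z\<in>{-1..1}. g z = h z \<longleftrightarrow> z = x \<or> z = y"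
    and sg: "positive D' (cis (T x)) (cis (U x)) \<longleftrightarrow> \<not> positive D' (cis (T y)) (cis (U y))"
    by (rule IJ.two_crossings[OF two])
  have gh: "g x = h x" "g y = h y"
    using zeros xy by auto
  \<comment> \<open>along a strand running to the left the crossings are met from right to left\<close>
  define \<tau> where "\<tau> L k = (if L = I then T (if (k = (0::nat)) = (\<sigma> = 1) then x else y)
    else U (if (k = 0) = (\<rho> = 1) then x else y))" for L k
  have T_less: "T x < T y \<longleftrightarrow> \<sigma> = 1" "T y < T x \<longleftrightarrow> \<sigma> \<noteq> 1"
    using strand_chart_less_iff[OF chI xy(1,2)] strand_chart_less_iff[OF chI xy(2,1)] xy(3) by auto
  have U_less: "U x < U y \<longleftrightarrow> \<rho> = 1" "U y < U x \<longleftrightarrow> \<rho> \<noteq> 1"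
    using strand_chart_less_iff[OF chJ xy(1,2)] strand_chart_less_iff[OF chJ xy(2,1)] xy(3) by auto
  have \<tau>_order: "\<forall>L\<in>{I, J}. fst L < \<tau> L 0 \<and> \<tau> L 0 < \<tau> L 1 \<and> \<tau> L 1 < snd L"
    using IJ IJ.interior_param[OF xy(1) gh(1)] IJ.interior_param[OF xy(2) gh(2)]
      JI.interior_param[OF xy(1) gh(1)[symmetric]] JI.interior_param[OF xy(2) gh(2)[symmetric]]
      T_less U_less unfolding \<tau>_def by auto
  have cr: "crossings (curve D') I J = {(cis (T x), cis (U x)), (cis (T y), cis (U y))}"
  proof -
    have "{x \<in> {-1..1}. g x = h x} = {x, y}"
      using zeros xy(1,2) by auto
    then show ?thesis
      unfolding IJ.crossings_eq by simp
  qed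
  have cp: "closed_arc L \<inter> crossing_points D' \<subseteq> {cis (\<tau> L 0), cis (\<tau> L 1)}" if L: "L \<in> {I, J}" for L
  proof
    fix p assume p: "p \<in> closed_arc L \<inter> crossing_points D'"
    then obtain q where "double_point (curve D') p q"
      using crossing_point_double by blast
    then have "(p, q) \<in> crossings (curve D') I J \<or> (q, p) \<in> crossings (curve D') I J"
      using inside[of D' p q L] p L by blast
    moreover have "cis (T z) \<notin> closed_arc J" "cis (U z) \<notin> closed_arc I" if "z \<in> {-1..1}" for z
      using IJ.cis_neq[OF that] JI.cis_neq[OF that] strand_chart_closed_arc(2)[OF chJ]
        strand_chart_closed_arc(2)[OF chI] by metis+
    ultimately show "p \<in> {cis (\<tau> L 0), cis (\<tau> L 1)}"
      using cr p L IJ xy(1,2) unfolding \<tau>_def by auto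
  qed
  have bpD': "breakpoints D' {I, J} \<tau>"
    using \<tau>_order cp unfolding breakpoints_def by blast
  have no: "\<forall>L\<in>{I, J}. closed_arc L \<inter> crossing_points D = {}"
  proof (rule ccontr)
    assume "\<not> ?thesis"
    then obtain L p where L: "L \<in> {I, J}" "p \<in> closed_arc L" "p \<in> crossing_points D"
      by blast
    obtain q where "double_point (curve D) p q"
      using crossing_point_double[OF L(3)] .
    then show False
      using inside[of D p q L] L none by blast
  qed
  then have bpD: "breakpoints D {I, J} \<tau>"
    using \<tau>_order unfolding breakpoints_def by blast
  let ?R = "crossing_rel ov un"
  note scD = strand_coloring_no_crossings[OF bpD no, where R="?R" and X=X]
  \<comment> \<open>the position along \<open>J\<close> of the crossing that \<open>I\<close> meets first\<close>
  define j where "j = (if \<sigma> = \<rho> then 0 else 1 :: nat)"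
  have \<sigma>\<rho>: "\<sigma> = 1 \<or> \<sigma> = -1" "\<rho> = 1 \<or> \<rho> = -1"
    using strand_chartD(1)[OF chI] strand_chartD(1)[OF chJ] by auto
  let ?p0 = "cis (\<tau> I 0)" and ?q0 = "cis (\<tau> J j)" and ?p1 = "cis (\<tau> I 1)" and ?q1 = "cis (\<tau> J (1 - j))"
  have sites: "(?p0, ?q0) \<in> crossings (curve D') I J" "(?p1, ?q1) \<in> crossings (curve D') I J"
    "positive D' ?p1 ?q1 \<longleftrightarrow> \<not> positive D' ?p0 ?q0"
    using cr sg IJ \<sigma>\<rho> unfolding \<tau>_def j_def by auto
  have dp: "double_point (curve D') ?p0 ?q0" "double_point (curve D') ?p1 ?q1"
    using sites(1,2) unfolding crossings_def by auto
  obtain o' u' where ops: "switch_ops X o' u'" and scD': "\<And>v. strand_coloring X ?R D' {I, J} \<tau> v \<longleftrightarrow>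
      v I 0 \<in> X \<and> v I 1 \<in> X \<and> v I 2 \<in> X \<and> v J 0 \<in> X \<and> v J 1 \<in> X \<and> v J 2 \<in> X \<and>
      crossing_rel o' u' (positive D' ?p0 ?q0) (v J j) (v J (Suc j)) (v I 0) (v I 1) \<and>
      crossing_rel o' u' (\<not> positive D' ?p0 ?q0) (v J (1 - j)) (v J (Suc (1 - j))) (v I 1) (v I 2)"
  proof -
    have over: "?q0 \<notin> over_pts D'" "?q1 \<notin> over_pts D'" "?p0 \<in> over_pts D' \<longleftrightarrow> strand_over D' I J"
      "?p1 \<in> over_pts D' \<longleftrightarrow> strand_over D' I J"
      using mode sites(1,2) dp over_unique[OF diags(2)] unfolding strand_over_def strands_virtual_def by blast+
    have "j < 2" "1 - j < 2" "j = 0 \<and> 1 - j = 1 \<or> j = 1 \<and> 1 - j = 0"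
      unfolding j_def by auto
    note sc = strand_coloring_sites[OF diags(2) sys bpD', where R="?R" and X=X
        and Q="{((I, 0), (J, j)), ((I, 1), (J, 1 - j))}", unfolded all_le_2]
    have sc': "strand_coloring X ?R D' {I, J} \<tau> v \<longleftrightarrow>
        v I 0 \<in> X \<and> v I 1 \<in> X \<and> v I 2 \<in> X \<and> v J 0 \<in> X \<and> v J 1 \<in> X \<and> v J 2 \<in> X \<and>
        (if strand_over D' I J then ?R (positive D' ?p0 ?q0) (v J j) (v J (Suc j)) (v I 0) (v I 1)
          else v J j = v J (Suc j) \<and> v I 0 = v I 1) \<and>
        (if strand_over D' I J then ?R (positive D' ?p1 ?q1) (v J (1 - j)) (v J (Suc (1 - j))) (v I 1) (v I 2)
          else v J (1 - j) = v J (Suc (1 - j)) \<and> v I 1 = v I 2)" for v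
    proof (subst sc)
      fix A B and k l :: nat
      assume "((A, k), (B, l)) \<in> {((I, 0), (J, j)), ((I, 1), (J, 1 - j))}"
      then show "A \<in> {I, J} \<and> B \<in> {I, J} \<and> k < 2 \<and> l < 2 \<and>
          double_point (curve D') (cis (\<tau> A k)) (cis (\<tau> B l)) \<and> cis (\<tau> B l) \<notin> over_pts D'"
        using dp over \<open>j < 2\<close> \<open>1 - j < 2\<close> by auto
    next
      fix A and k :: nat assume "A \<in> {I, J}" "k < 2"
      then show "(A, k) \<in> fst ` {((I, 0), (J, j)), ((I, 1), (J, 1 - j))} \<union>
          snd ` {((I, 0), (J, j)), ((I, 1), (J, 1 - j))}"
        using \<open>j = 0 \<and> 1 - j = 1 \<or> j = 1 \<and> 1 - j = 0\<close> less_2_cases_nat[of k] by auto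
    next
      have "(Suc 1 :: nat) = 2" by simp
      then show "(\<forall>I\<in>{I, J}. v I 0 \<in> X \<and> v I 1 \<in> X \<and> v I 2 \<in> X) \<and>
        (\<forall>((I, k), J, l)\<in>{((I, 0), J, j), ((I, 1), J, 1 - j)}.
           if cis (\<tau> I k) \<in> over_pts D'
           then ?R (positive D' (cis (\<tau> I k)) (cis (\<tau> J l))) (v J l) (v J (Suc l)) (v I k) (v I (Suc k))
           else v J l = v J (Suc l) \<and> v I k = v I (Suc k)) \<longleftrightarrow>
        v I 0 \<in> X \<and> v I 1 \<in> X \<and> v I 2 \<in> X \<and> v J 0 \<in> X \<and> v J 1 \<in> X \<and> v J 2 \<in> X \<and>
        (if strand_over D' I J then ?R (positive D' ?p0 ?q0) (v J j) (v J (Suc j)) (v I 0) (v I 1)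
          else v J j = v J (Suc j) \<and> v I 0 = v I 1) \<and>
        (if strand_over D' I J then ?R (positive D' ?p1 ?q1) (v J (1 - j)) (v J (Suc (1 - j))) (v I 1) (v I 2)
          else v J (1 - j) = v J (Suc (1 - j)) \<and> v I 1 = v I 2)"
        using over(3,4) by (simp only: ball_simps prod.case One_nat_def[symmetric] Suc_1) auto
    qed
    show thesis
    proof (cases "strand_over D' I J")
      case True
      then show ?thesis
        using that[OF switch_ops_biquandle] sc' sites(3) by auto
    next
      case False
      then show ?thesis
        using that[OF switch_ops_trivial] sc' by (auto simp: crossing_rel_trivial)
    qed
  qed
  have j: "j = 0 \<or> j = 1"
    unfolding j_def by auto
  have balanced: "v I 2 = v I 0 \<and> v J 2 = v J 0" if "strand_coloring X ?R D' {I, J} \<tau> v" for v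
    using that crossing_rel_cancel[OF ops, of "v I 0" "v I 1" "v I 2" "v J 0" "v J 1" "v J 2" "positive D' ?p0 ?q0"] j
    unfolding scD' by (auto simp: numeral_2_eq_2)
  show ?thesis
  proof (rule card_colorings_tangle[OF ao fin bpD bpD'])
    show "ends_extend X ?R {I, J} D \<tau> D' \<tau>"
      unfolding ends_extend_def
    proof (intro allI impI)
      fix v assume "strand_coloring X ?R D {I, J} \<tau> v"
      then have v: "v I 0 \<in> X" "v J 0 \<in> X" "v I 2 = v I 0" "v J 2 = v J 0"
        unfolding scD by auto
      have "\<exists>a\<in>X. \<exists>b\<in>X. if j = 0 then crossing_rel o' u' (positive D' ?p0 ?q0) (v J 0) a (v I 0) b
          else crossing_rel o' u' (positive D' ?p0 ?q0) a (v J 0) (v I 0) b"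
        using crossing_rel_exists[OF ops v(2,1)] by (cases "j = 0") simp_all
      then obtain a b where ab: "a \<in> X" "b \<in> X"
        "if j = 0 then crossing_rel o' u' (positive D' ?p0 ?q0) (v J 0) a (v I 0) b
          else crossing_rel o' u' (positive D' ?p0 ?q0) a (v J 0) (v I 0) b"
        by blast
      define w where "w L k = (if k = (1::nat) then if L = I then b else a else v L 0)" for L k
      have "strand_coloring X ?R D' {I, J} \<tau> w"
        unfolding scD' crossing_rel_flip using ab v IJ j unfolding w_def by auto
      then show "\<exists>w. strand_coloring X ?R D' {I, J} \<tau> w \<and> (\<forall>L\<in>{I, J}. w L 0 = v L 0 \<and> w L 2 = v L 2)"
        using v by (intro exI[of _ w]) (simp add: w_def)
    qed
    show "ends_extend X ?R {I, J} D' \<tau> D \<tau>"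
      unfolding ends_extend_def
    proof (intro allI impI)
      fix v assume v: "strand_coloring X ?R D' {I, J} \<tau> v"
      then have "v I 0 \<in> X" "v J 0 \<in> X"
        unfolding scD' by auto
      then show "\<exists>w. strand_coloring X ?R D {I, J} \<tau> w \<and> (\<forall>L\<in>{I, J}. w L 0 = v L 0 \<and> w L 2 = v L 2)"
        using balanced[OF v] by (intro exI[of _ "\<lambda>L _. v L 0"]) (simp add: scD)
    qed
    show "determined_by_ends X ?R D {I, J} \<tau>"
      unfolding determined_by_ends_def scD by auto
    show "determined_by_ends X ?R D' {I, J} \<tau>"
      unfolding determined_by_ends_def
    proof (intro allI impI)
      fix v w assume vw: "strand_coloring X ?R D' {I, J} \<tau> v" "strand_coloring X ?R D' {I, J} \<tau> w"
        and eq: "\<forall>L\<in>{I, J}. v L 0 = w L 0 \<and> v L 2 = w L 2"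
      note det = crossing_rel_corner_determined[OF ops, unfolded corner_determined_def, rule_format]
      have "v J 1 = w J 1 \<and> v I 1 = w I 1"
      proof (cases "j = 0")
        case True
        then show ?thesis
          using vw eq det[of "v J 0" "v J 1" "v I 0" "v I 1" "w J 0" "w J 1" "w I 0" "w I 1" "positive D' ?p0 ?q0"]
          unfolding scD' by auto
      next
        case False
        then show ?thesis
          using vw eq j det[of "v J 1" "v J 2" "v I 0" "v I 1" "w J 1" "w J 2" "w I 0" "w I 1" "positive D' ?p0 ?q0"]
          unfolding scD' by (auto simp: numeral_2_eq_2)
      qed
      then show "\<forall>L\<in>{I, J}. v L 1 = w L 1"
        by blast
    qed
  qed
qed

section \<open>The third Reidemeister move\<close>

text \<open>The position, first or second, of a crossing along a strand that has two of them.\<close>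

definition site :: "bool \<Rightarrow> nat" where
  "site m = (if m then 0 else 1)"

lemma over_face_eq:
  "(\<lambda>a. if a = p then x (Suc (site m)) else x (site m)) =
    (\<lambda>a. if a = (m = p) then x 1 else if m then x 0 else x (2::nat))"
  by (cases m; cases p) (auto simp: site_def numeral_2_eq_2)

lemma under_face_eq:
  "(\<lambda>a. if a = p then x (site m) else x (Suc (site m))) =
    (\<lambda>a. if a = (m \<noteq> p) then x 1 else if m then x 0 else x (2::nat))"
  by (cases m; cases p) (auto simp: site_def numeral_2_eq_2)

lemma site_less_2: "site m < 2"
  by (simp add: site_def)

context yang_baxter
begin

text \<open>The crossing relations of three strands with labels \<open>a\<close>, \<open>b\<close>, \<open>c\<close>. The flags record the order of the
  crossings along the oriented strands: \<open>m1\<close> holds if the first strand meets the second before the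
  third, \<open>m2\<close> if the second meets the first before the third, and \<open>m3\<close> if the third meets the first
  before the second. The signs of the three crossings are \<open>p12\<close>, \<open>p13\<close>, \<open>p23\<close>.\<close>

definition triple_relations ::
    "bool \<Rightarrow> bool \<Rightarrow> bool \<Rightarrow> bool \<Rightarrow> bool \<Rightarrow> bool \<Rightarrow> (nat \<Rightarrow> 'x) \<Rightarrow> (nat \<Rightarrow> 'x) \<Rightarrow> (nat \<Rightarrow> 'x) \<Rightarrow> bool" where
  "triple_relations p12 p13 p23 m1 m2 m3 a b c \<longleftrightarrow>
     crossing_rel o1 u1 p12 (b (site m2)) (b (Suc (site m2))) (a (site m1)) (a (Suc (site m1))) \<and>
     crossing_rel o2 u2 p13 (c (site m3)) (c (Suc (site m3))) (a (site (\<not> m1))) (a (Suc (site (\<not> m1)))) \<and>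
     crossing_rel o3 u3 p23 (c (site (\<not> m3))) (c (Suc (site (\<not> m3)))) (b (site (\<not> m2))) (b (Suc (site (\<not> m2))))"

text \<open>The conditions \<open>c\<close> relate the orders and the signs. They say that the two edges of the triangle
  lying on two of the strands are on the same side of the remaining strand.\<close>

lemma triple_relations_iff_triangle:
  assumes c: "(m1 = p13) = (m2 = p23)" "(m1 = p12) = (m3 = p23)" "(m2 = p12) = (m3 = p13)"
    and X: "\<forall>k\<le>2. a k \<in> X \<and> b k \<in> X \<and> c k \<in> X"
  shows "triple_relations p12 p13 p23 m1 m2 m3 a b c \<longleftrightarrow>
    triangle (m2 \<noteq> p12) (m1 = p12) (m1 \<noteq> p13) (a 1) (b 1) (c 1)
      (if m1 then a 0 else a 2) (if \<not> m1 then a 0 else a 2) (if m2 then b 0 else b 2)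
      (if \<not> m2 then b 0 else b 2) (if m3 then c 0 else c 2) (if \<not> m3 then c 0 else c 2)"
proof -
  have mem: "a (site m) \<in> X" "b (site m) \<in> X" "c (site m) \<in> X"
    "a (Suc (site m)) \<in> X" "b (Suc (site m)) \<in> X" "c (Suc (site m)) \<in> X" for m
    using X by (simp_all add: site_def)
  have e: "(m1 \<noteq> p13) = ((\<not> m1) = p13)" "(m2 \<noteq> p12) = (m3 \<noteq> p13)" "(m1 \<noteq> p13) = ((\<not> m2) = p23)"
    "(m1 = p12) = ((\<not> m3) \<noteq> p23)"
    using c by blast+
  show ?thesis
    unfolding triple_relations_def triangle_def
      crossing_rel_face_iff[OF mem(2) mem(5) mem(1) mem(4)]
      crossing_rel_face_iff[OF mem(3) mem(6) mem(1) mem(4)]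
      crossing_rel_face_iff[OF mem(3) mem(6) mem(2) mem(5)]
      over_face_eq under_face_eq
    using e by simp
qed

lemma triple_relations_transfer:
  assumes c: "(m1 = p13) = (m2 = p23)" "(m1 = p12) = (m3 = p23)" "(m2 = p12) = (m3 = p13)"
    and c': "(m1' = p13) = (m2' = p23)" "(m1' = p12) = (m3' = p23)" "(m2' = p12) = (m3' = p13)"
    and X: "\<forall>k\<le>2. a k \<in> X \<and> b k \<in> X \<and> c k \<in> X"
    and rel: "triple_relations p12 p13 p23 m1 m2 m3 a b c"
  shows "\<exists>x\<in>X. \<exists>y\<in>X. \<exists>z\<in>X. triple_relations p12 p13 p23 m1' m2' m3' (a(1 := x)) (b(1 := y)) (c(1 := z))"
proof (cases "m1 = m1'")
  case True
  then have "m2 = m2'" "m3 = m3'"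
    using c c' by blast+
  then show ?thesis
    using True rel X by (intro bexI[of _ "a 1"] bexI[of _ "b 1"] bexI[of _ "c 1"]) auto
next
  case False
  then have m: "m1' = (\<not> m1)" "m2' = (\<not> m2)" "m3' = (\<not> m3)"
    using c c' by blast+
  obtain x y z where xyz: "x \<in> X" "y \<in> X" "z \<in> X"
    "triangle (\<not> (m2 \<noteq> p12)) (\<not> (m1 = p12)) (\<not> (m1 \<noteq> p13)) x y z
      (if \<not> m1 then a 0 else a 2) (if m1 then a 0 else a 2) (if \<not> m2 then b 0 else b 2)
      (if m2 then b 0 else b 2) (if \<not> m3 then c 0 else c 2) (if m3 then c 0 else c 2)"
    using triangle_flip[OF rel[unfolded triple_relations_iff_triangle[OF c X]]] by blast
  have X': "\<forall>k\<le>2. (a(1 := x)) k \<in> X \<and> (b(1 := y)) k \<in> X \<and> (c(1 := z)) k \<in> X"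
    using X xyz by simp
  have "triple_relations p12 p13 p23 m1' m2' m3' (a(1 := x)) (b(1 := y)) (c(1 := z))"
  proof -
    have upd: "(f(1 := w)) 1 = w" "(f(1 := w)) 0 = f 0" "(f(1 := w)) 2 = f 2" for f :: "nat \<Rightarrow> 'x" and w
      by simp_all
    have neg: "((\<not> m2) \<noteq> p12) = (\<not> (m2 \<noteq> p12))" "((\<not> m1) = p12) = (\<not> (m1 = p12))"
      "((\<not> m1) \<noteq> p13) = (\<not> (m1 \<noteq> p13))"
      by blast+
    show ?thesis
      unfolding triple_relations_iff_triangle[OF c' X'] upd unfolding m neg
      using xyz(4) unfolding not_not .
  qed
  then show ?thesis
    using xyz by blast
qed

lemma triple_relations_unique:
  assumes c: "(m1 = p13) = (m2 = p23)" "(m1 = p12) = (m3 = p23)" "(m2 = p12) = (m3 = p13)"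
    and X: "\<forall>k\<le>2. a k \<in> X \<and> b k \<in> X \<and> c k \<in> X" "\<forall>k\<le>2. a' k \<in> X \<and> b' k \<in> X \<and> c' k \<in> X"
    and rel: "triple_relations p12 p13 p23 m1 m2 m3 a b c" "triple_relations p12 p13 p23 m1 m2 m3 a' b' c'"
    and eq: "a 0 = a' 0" "a 2 = a' 2" "b 0 = b' 0" "b 2 = b' 2" "c 0 = c' 0" "c 2 = c' 2"
  shows "a 1 = a' 1 \<and> b 1 = b' 1 \<and> c 1 = c' 1"
  using triangle_unique rel[unfolded triple_relations_iff_triangle[OF c X(1)] triple_relations_iff_triangle[OF c X(2)]]
  unfolding eq by blast

end

text \<open>Classical crossings with \<open>I\<close> over \<open>J\<close> if \<open>c\<close> holds, virtual crossings otherwise.\<close>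

definition strand_mode :: "vdiagram \<Rightarrow> real \<times> real \<Rightarrow> real \<times> real \<Rightarrow> bool \<Rightarrow> bool" where
  "strand_mode E I J c \<longleftrightarrow> (if c then strand_over E I J else strands_virtual E I J)"

lemma strand_mode_over:
  assumes "is_diagram E" "strand_mode E I J c" "(p, q) \<in> crossings (curve E) I J"
  shows "p \<in> over_pts E \<longleftrightarrow> c" "q \<notin> over_pts E"
proof -
  have "double_point (curve E) p q"
    using assms(3) unfolding crossings_def by blast
  then show "p \<in> over_pts E \<longleftrightarrow> c" "q \<notin> over_pts E"
    using assms over_unique[OF assms(1)]
    unfolding strand_mode_def strand_over_def strands_virtual_def by (auto split: if_splits)
qed

text \<open>Three propositional identities. With \<open>e13\<close> the statement that the third strand is above the
  first at the left side of the square, \<open>e12\<close> and \<open>e23\<close> likewise for the other pairs, \<open>o1\<close> that the crossing of the first strand with the second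
  lies to the left of its crossing with the third, \<open>o2\<close> and \<open>o3\<close> likewise for the second and the third strand
  (the crossing with the lower index being the one to the left), and \<open>s1\<close>, \<open>s2\<close>, \<open>s3\<close> that the strands run to the
  right, they translate the vertical position of the third strand at the crossing of two others into
  the conditions on orders and signs.\<close>

lemma signs_at_12:
  "((o1 = e13) = (o2 = e23)) \<Longrightarrow>
    ((o1 = s1) = ((s1 = s3) = (\<not> e13))) = ((o2 = s2) = ((s2 = s3) = (\<not> e23)))"
  by (cases o1; cases o2; cases e13; cases e23; cases s1; cases s2; cases s3) simp_all

lemma signs_at_13:
  "(((\<not> o1) = e12) = (\<not> (o3 = e23))) \<Longrightarrow>
    ((o1 = s1) = ((s1 = s2) = (\<not> e12))) = ((o3 = s3) = ((s2 = s3) = (\<not> e23)))"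
  by (cases o1; cases o3; cases e12; cases e23; cases s1; cases s2; cases s3) simp_all

lemma signs_at_23:
  "(((\<not> o2) = e12) = ((\<not> o3) = e13)) \<Longrightarrow>
    ((o2 = s2) = ((s1 = s2) = (\<not> e12))) = ((o3 = s3) = ((s1 = s3) = (\<not> e13)))"
  by (cases o2; cases o3; cases e12; cases e13; cases s1; cases s2; cases s3) simp_all

text \<open>The same relations for an arbitrary crossing rule, with flags telling which crossings are
  classical.\<close>

definition triple_coloring ::
    "'x set \<Rightarrow> 'x crossing_rule \<Rightarrow> bool \<Rightarrow> bool \<Rightarrow> bool \<Rightarrow> bool \<Rightarrow> bool \<Rightarrow> bool \<Rightarrow>
     bool \<Rightarrow> bool \<Rightarrow> bool \<Rightarrow> (nat \<Rightarrow> 'x) \<Rightarrow> (nat \<Rightarrow> 'x) \<Rightarrow> (nat \<Rightarrow> 'x) \<Rightarrow> bool" where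
  "triple_coloring X R c12 c13 c23 p12 p13 p23 m1 m2 m3 a b c \<longleftrightarrow>
     (\<forall>k\<le>2. a k \<in> X \<and> b k \<in> X \<and> c k \<in> X) \<and>
     (if c12 then R p12 (b (site m2)) (b (Suc (site m2))) (a (site m1)) (a (Suc (site m1)))
      else b (site m2) = b (Suc (site m2)) \<and> a (site m1) = a (Suc (site m1))) \<and>
     (if c13 then R p13 (c (site m3)) (c (Suc (site m3))) (a (site (\<not> m1))) (a (Suc (site (\<not> m1))))
      else c (site m3) = c (Suc (site m3)) \<and> a (site (\<not> m1)) = a (Suc (site (\<not> m1)))) \<and>
     (if c23 then R p23 (c (site (\<not> m3))) (c (Suc (site (\<not> m3)))) (b (site (\<not> m2))) (b (Suc (site (\<not> m2))))
      else c (site (\<not> m3)) = c (Suc (site (\<not> m3))) \<and> b (site (\<not> m2)) = b (Suc (site (\<not> m2))))"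

text \<open>Three strands of a disc, any two of which cross exactly once, as in the third move.\<close>

locale strand_triple =
  fixes E :: vdiagram and \<phi> :: "complex \<Rightarrow> complex" and I J K :: "real \<times> real"
    and \<sigma>I \<sigma>J \<sigma>K :: real and TI TJ TK gI gJ gK :: "real \<Rightarrow> real" and c12 c13 c23 :: bool
  assumes diag: "is_diagram E" and orient: "oriented_plane_diffeo \<phi>"
    and sys: "arc_system {I, J, K}" and dist: "I \<noteq> J" "I \<noteq> K" "J \<noteq> K"
    and chI: "strand_chart \<phi> (curve E) I \<sigma>I TI gI" and chJ: "strand_chart \<phi> (curve E) J \<sigma>J TJ gJ"
    and chK: "strand_chart \<phi> (curve E) K \<sigma>K TK gK"
    and ends: "\<And>L q. L \<in> {I, J, K} \<Longrightarrow>
      \<not> double_point (curve E) (cis (fst L)) q \<and> \<not> double_point (curve E) (cis (snd L)) q"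
    and inside: "\<And>L p q. L \<in> {I, J, K} \<Longrightarrow> p \<in> closed_arc L \<Longrightarrow> double_point (curve E) p q \<Longrightarrow>
      \<exists>M\<in>{I, J, K}. q \<in> closed_arc M"
    and cards: "card (crossings (curve E) I J) = 1" "card (crossings (curve E) I K) = 1"
      "card (crossings (curve E) J K) = 1"
    and modes: "strand_mode E I J c12" "strand_mode E I K c13" "strand_mode E J K c23"
begin

sublocale IJ: strand_pair E \<phi> "{I, J, K}" I J \<sigma>I \<sigma>J TI TJ gI gJ
  using diag orient sys dist chI chJ ends[of I] by unfold_locales auto
sublocale JI: strand_pair E \<phi> "{I, J, K}" J I \<sigma>J \<sigma>I TJ TI gJ gI
  using diag orient sys dist chI chJ ends[of J] by unfold_locales auto
sublocale IK: strand_pair E \<phi> "{I, J, K}" I K \<sigma>I \<sigma>K TI TK gI gK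
  using diag orient sys dist chI chK ends[of I] by unfold_locales auto
sublocale KI: strand_pair E \<phi> "{I, J, K}" K I \<sigma>K \<sigma>I TK TI gK gI
  using diag orient sys dist chI chK ends[of K] by unfold_locales auto
sublocale JK: strand_pair E \<phi> "{I, J, K}" J K \<sigma>J \<sigma>K TJ TK gJ gK
  using diag orient sys dist chJ chK ends[of J] by unfold_locales auto
sublocale KJ: strand_pair E \<phi> "{I, J, K}" K J \<sigma>K \<sigma>J TK TJ gK gJ
  using diag orient sys dist chJ chK ends[of K] by unfold_locales auto

text \<open>The signs of the crossings, expressed by the directions of the strands and the vertical order of
  their ends, which are the same before and after the move.\<close>

definition p12 :: bool where "p12 \<longleftrightarrow> ((\<sigma>I = \<sigma>J) \<longleftrightarrow> \<not> gI (-1) < gJ (-1))"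
definition p13 :: bool where "p13 \<longleftrightarrow> ((\<sigma>I = \<sigma>K) \<longleftrightarrow> \<not> gI (-1) < gK (-1))"
definition p23 :: bool where "p23 \<longleftrightarrow> ((\<sigma>J = \<sigma>K) \<longleftrightarrow> \<not> gJ (-1) < gK (-1))"

text \<open>The directions and the ends of the strands leave the orders of the crossings along the strands
  undetermined, but any of \<open>m1\<close>, \<open>m2\<close>, \<open>m3\<close> determines the two others.\<close>

lemma local_structure:
  obtains \<tau> m1 m2 m3 where "breakpoints E {I, J, K} \<tau>"
    "(m1 = p13) = (m2 = p23)" "(m1 = p12) = (m3 = p23)" "(m2 = p12) = (m3 = p13)"
    "\<forall>X R v. strand_coloring X R E {I, J, K} \<tau> v \<longleftrightarrow>
       triple_coloring X R c12 c13 c23 p12 p13 p23 m1 m2 m3 (v I) (v J) (v K)"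
proof -
  obtain x where x: "x \<in> {-1<..<1}" "\<forall>y\<in>{-1..1}. gI y = gJ y \<longleftrightarrow> y = x"
    "positive E (cis (TI x)) (cis (TJ x)) \<longleftrightarrow> p12"
    "\<forall>y\<in>{-1..1}. y < x \<longrightarrow> (gI y < gJ y \<longleftrightarrow> gI (-1) < gJ (-1))"
    "\<forall>y\<in>{-1..1}. x < y \<longrightarrow> (gI y < gJ y \<longleftrightarrow> \<not> gI (-1) < gJ (-1))"
    by (rule IJ.single_crossing[OF cards(1), folded p12_def])
  obtain y where y: "y \<in> {-1<..<1}" "\<forall>z\<in>{-1..1}. gI z = gK z \<longleftrightarrow> z = y"
    "positive E (cis (TI y)) (cis (TK y)) \<longleftrightarrow> p13"
    "\<forall>z\<in>{-1..1}. z < y \<longrightarrow> (gI z < gK z \<longleftrightarrow> gI (-1) < gK (-1))"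
    "\<forall>z\<in>{-1..1}. y < z \<longrightarrow> (gI z < gK z \<longleftrightarrow> \<not> gI (-1) < gK (-1))"
    by (rule IK.single_crossing[OF cards(2), folded p13_def])
  obtain z where z: "z \<in> {-1<..<1}" "\<forall>y\<in>{-1..1}. gJ y = gK y \<longleftrightarrow> y = z"
    "positive E (cis (TJ z)) (cis (TK z)) \<longleftrightarrow> p23"
    "\<forall>y\<in>{-1..1}. y < z \<longrightarrow> (gJ y < gK y \<longleftrightarrow> gJ (-1) < gK (-1))"
    "\<forall>y\<in>{-1..1}. z < y \<longrightarrow> (gJ y < gK y \<longleftrightarrow> \<not> gJ (-1) < gK (-1))"
    by (rule JK.single_crossing[OF cards(3), folded p23_def])
  have mem: "x \<in> {-1..1}" "y \<in> {-1..1}" "z \<in> {-1..1}"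
    using x(1) y(1) z(1) by auto
  have gx: "gI x = gJ x" and gy: "gI y = gK y" and gz: "gJ z = gK z"
    using x(2) y(2) z(2) mem by blast+
  have partner: "q = r" if "double_point (curve E) p q" "double_point (curve E) p r" for p q r
    using diag that unfolding is_diagram_def generic_immersion_def by blast
  have dx: "double_point (curve E) (cis (TI x)) (cis (TJ x))"
    and dy: "double_point (curve E) (cis (TI y)) (cis (TK y))"
    and dz: "double_point (curve E) (cis (TJ z)) (cis (TK z))"
    using IJ.double_point_iff IK.double_point_iff JK.double_point_iff mem gx gy gz by blast+
  have neq: "x \<noteq> y" "x \<noteq> z" "y \<noteq> z"
  proof -
    show "x \<noteq> y"
      using partner[OF dx, of "cis (TK y)"] dy JK.cis_neq[OF mem(1,2)] by blast
    show "x \<noteq> z"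
      using partner[of "cis (TJ x)" "cis (TI x)" "cis (TK z)"] dx dz IK.cis_neq[OF mem(1,3)] double_point_sym by blast
    show "y \<noteq> z"
      using partner[of "cis (TK y)" "cis (TI y)" "cis (TJ z)"] dy dz IJ.cis_neq[OF mem(2,3)] double_point_sym by blast
  qed
  define m1 m2 m3 where "m1 \<longleftrightarrow> (x < y) = (\<sigma>I = 1)" and "m2 \<longleftrightarrow> (x < z) = (\<sigma>J = 1)"
    and "m3 \<longleftrightarrow> (y < z) = (\<sigma>K = 1)"
  have \<sigma>: "\<sigma>I = 1 \<or> \<sigma>I = -1" "\<sigma>J = 1 \<or> \<sigma>J = -1" "\<sigma>K = 1 \<or> \<sigma>K = -1"
    using strand_chartD(1)[OF chI] strand_chartD(1)[OF chJ] strand_chartD(1)[OF chK] by auto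
  \<comment> \<open>at the crossing of two strands the third one is above both or below both; its position is read
    off from the vertical order at the left side and from the crossings already passed\<close>
  have s1: "((x < y) = (gI (-1) < gK (-1))) = ((x < z) = (gJ (-1) < gK (-1)))"
  proof -
    have "gI x < gK x \<longleftrightarrow> (x < y) = (gI (-1) < gK (-1))"
      using bspec[OF y(4) mem(1)] bspec[OF y(5) mem(1)] neq(1) by (cases "x < y") auto
    moreover have "gJ x < gK x \<longleftrightarrow> (x < z) = (gJ (-1) < gK (-1))"
      using bspec[OF z(4) mem(1)] bspec[OF z(5) mem(1)] neq(2) by (cases "x < z") auto
    ultimately show ?thesis using gx by simp
  qed
  have s2: "((\<not> x < y) = (gI (-1) < gJ (-1))) = (\<not> ((y < z) = (gJ (-1) < gK (-1))))"
  proof -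
    have "gI y < gJ y \<longleftrightarrow> (\<not> x < y) = (gI (-1) < gJ (-1))"
      using bspec[OF x(4) mem(2)] bspec[OF x(5) mem(2)] neq(1) by (cases "x < y") auto
    moreover have "gJ y < gK y \<longleftrightarrow> (y < z) = (gJ (-1) < gK (-1))"
      using bspec[OF z(4) mem(2)] bspec[OF z(5) mem(2)] neq(3) by (cases "y < z") auto
    moreover have "gJ y \<noteq> gK y"
      using z(2) mem neq by blast
    ultimately show ?thesis using gy by auto
  qed
  have s3: "((\<not> x < z) = (gI (-1) < gJ (-1))) = ((\<not> y < z) = (gI (-1) < gK (-1)))"
  proof -
    have "gI z < gJ z \<longleftrightarrow> (\<not> x < z) = (gI (-1) < gJ (-1))"
      using bspec[OF x(4) mem(3)] bspec[OF x(5) mem(3)] neq(2) by (cases "x < z") auto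
    moreover have "gI z < gK z \<longleftrightarrow> (\<not> y < z) = (gI (-1) < gK (-1))"
      using bspec[OF y(4) mem(3)] bspec[OF y(5) mem(3)] neq(3) by (cases "y < z") auto
    ultimately show ?thesis using gz by simp
  qed
  have sig: "(\<sigma>I = \<sigma>J) = ((\<sigma>I = 1) = (\<sigma>J = 1))" "(\<sigma>I = \<sigma>K) = ((\<sigma>I = 1) = (\<sigma>K = 1))"
    "(\<sigma>J = \<sigma>K) = ((\<sigma>J = 1) = (\<sigma>K = 1))"
    using \<sigma> by auto
  have c1: "(m1 = p13) = (m2 = p23)"
    unfolding m1_def m2_def p13_def p23_def sig by (rule signs_at_12[OF s1])
  have c2: "(m1 = p12) = (m3 = p23)"
    unfolding m1_def m3_def p12_def p23_def sig by (rule signs_at_13[OF s2])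
  have c3: "(m2 = p12) = (m3 = p13)"
    unfolding m2_def m3_def p12_def p13_def sig by (rule signs_at_23[OF s3])
  define \<tau> where "\<tau> L k = (if L = I then TI (if (k = (0::nat)) = m1 then x else y)
    else if L = J then TJ (if (k = 0) = m2 then x else z) else TK (if (k = 0) = m3 then y else z))" for L k
  have at: "\<tau> I (site m1) = TI x" "\<tau> I (site (\<not> m1)) = TI y" "\<tau> J (site m2) = TJ x" "\<tau> J (site (\<not> m2)) = TJ z"
    "\<tau> K (site m3) = TK y" "\<tau> K (site (\<not> m3)) = TK z"
    using dist unfolding \<tau>_def site_def by auto
  have less: "TI x < TI y \<longleftrightarrow> m1" "TI y < TI x \<longleftrightarrow> \<not> m1" "TJ x < TJ z \<longleftrightarrow> m2" "TJ z < TJ x \<longleftrightarrow> \<not> m2"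
    "TK y < TK z \<longleftrightarrow> m3" "TK z < TK y \<longleftrightarrow> \<not> m3"
  proof -
    have sw: "(y < x) = (\<not> x < y)" "(z < x) = (\<not> x < z)" "(z < y) = (\<not> y < z)"
      using neq by auto
    show "TI x < TI y \<longleftrightarrow> m1" "TJ x < TJ z \<longleftrightarrow> m2" "TK y < TK z \<longleftrightarrow> m3"
      unfolding m1_def m2_def m3_def
      by (rule strand_chart_less_iff[OF chI mem(1,2) neq(1)] strand_chart_less_iff[OF chJ mem(1,3) neq(2)]
          strand_chart_less_iff[OF chK mem(2,3) neq(3)])+
    show "TI y < TI x \<longleftrightarrow> \<not> m1" "TJ z < TJ x \<longleftrightarrow> \<not> m2" "TK z < TK y \<longleftrightarrow> \<not> m3"
      unfolding m1_def m2_def m3_def strand_chart_less_iff[OF chI mem(2,1) neq(1)[symmetric]]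
        strand_chart_less_iff[OF chJ mem(3,1) neq(2)[symmetric]]
        strand_chart_less_iff[OF chK mem(3,2) neq(3)[symmetric]] sw by blast+
  qed
  have order: "fst L < \<tau> L 0 \<and> \<tau> L 0 < \<tau> L 1 \<and> \<tau> L 1 < snd L" if "L \<in> {I, J, K}" for L
  proof -
    have "fst I < TI x" "TI x < snd I" "fst I < TI y" "TI y < snd I"
      "fst J < TJ x" "TJ x < snd J" "fst J < TJ z" "TJ z < snd J"
      "fst K < TK y" "TK y < snd K" "fst K < TK z" "TK z < snd K"
      using IJ.interior_param[OF mem(1) gx] IK.interior_param[OF mem(2) gy]
        JI.interior_param[OF mem(1) gx[symmetric]] JK.interior_param[OF mem(3) gz]
        KI.interior_param[OF mem(2) gy[symmetric]] KJ.interior_param[OF mem(3) gz[symmetric]] by auto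
    then show ?thesis
      using that less dist unfolding \<tau>_def by auto
  qed
  have crIJ: "crossings (curve E) I J = {(cis (TI x), cis (TJ x))}"
  proof -
    have "{y \<in> {-1..1}. gI y = gJ y} = {x}"
      using x(2) mem(1) by blast
    then show ?thesis unfolding IJ.crossings_eq by simp
  qed
  have crIK: "crossings (curve E) I K = {(cis (TI y), cis (TK y))}"
  proof -
    have "{z \<in> {-1..1}. gI z = gK z} = {y}"
      using y(2) mem(2) by blast
    then show ?thesis unfolding IK.crossings_eq by simp
  qed
  have crJK: "crossings (curve E) J K = {(cis (TJ z), cis (TK z))}"
  proof -
    have "{y \<in> {-1..1}. gJ y = gK y} = {z}"
      using z(2) mem(3) by blast
    then show ?thesis unfolding JK.crossings_eq by simp
  qed
  have \<phi>: "plane_diffeo \<phi>"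
    using orient unfolding oriented_plane_diffeo_def by blast
  have bp: "breakpoints E {I, J, K} \<tau>"
    unfolding breakpoints_def
  proof (intro ballI conjI subsetI)
    fix L p assume L: "L \<in> {I, J, K}" and p: "p \<in> closed_arc L \<inter> crossing_points E"
    then obtain q where q: "double_point (curve E) p q"
      using crossing_point_double by blast
    obtain M where M: "M \<in> {I, J, K}" "q \<in> closed_arc M"
      using inside[OF L _ q] p by blast
    have LM: "L \<noteq> M"
      using strand_chart_no_self_crossing[OF \<phi> chI, of p q] strand_chart_no_self_crossing[OF \<phi> chJ, of p q]
        strand_chart_no_self_crossing[OF \<phi> chK, of p q] L M p q by blast
    have cr: "(p, q) \<in> crossings (curve E) L M" "(q, p) \<in> crossings (curve E) M L"
      using p q M(2) double_point_sym unfolding crossings_def by auto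
    have \<tau>I: "{cis (\<tau> I 0), cis (\<tau> I 1)} = {cis (TI x), cis (TI y)}"
      unfolding \<tau>_def by (cases m1) auto
    have \<tau>J: "{cis (\<tau> J 0), cis (\<tau> J 1)} = {cis (TJ x), cis (TJ z)}"
      using dist unfolding \<tau>_def by (cases m2) auto
    have \<tau>K: "{cis (\<tau> K 0), cis (\<tau> K 1)} = {cis (TK y), cis (TK z)}"
      using dist unfolding \<tau>_def by (cases m3) auto
    consider "L = I" "M = J" | "L = I" "M = K" | "L = J" "M = I" | "L = J" "M = K" | "L = K" "M = I" | "L = K" "M = J"
      using L M(1) LM by blast
    then show "p \<in> {cis (\<tau> L 0), cis (\<tau> L 1)}"
      by cases (use cr crIJ crIK crJK \<tau>I \<tau>J \<tau>K in simp_all)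
  qed (use order in blast)+
  have over: "cis (TI x) \<in> over_pts E \<longleftrightarrow> c12" "cis (TJ x) \<notin> over_pts E"
    "cis (TI y) \<in> over_pts E \<longleftrightarrow> c13" "cis (TK y) \<notin> over_pts E"
    "cis (TJ z) \<in> over_pts E \<longleftrightarrow> c23" "cis (TK z) \<notin> over_pts E"
    using strand_mode_over[OF diag modes(1), of "cis (TI x)" "cis (TJ x)"]
      strand_mode_over[OF diag modes(2), of "cis (TI y)" "cis (TK y)"]
      strand_mode_over[OF diag modes(3), of "cis (TJ z)" "cis (TK z)"] crIJ crIK crJK by simp_all
  let ?Q = "{((I, site m1), (J, site m2)), ((I, site (\<not> m1)), (K, site m3)), ((J, site (\<not> m2)), (K, site (\<not> m3)))}"
  have "strand_coloring X R E {I, J, K} \<tau> v \<longleftrightarrow>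
      triple_coloring X R c12 c13 c23 p12 p13 p23 m1 m2 m3 (v I) (v J) (v K)"
    for X and R :: "'a crossing_rule" and v
  proof (subst strand_coloring_sites[OF diag sys bp, where Q="?Q"])
    fix A B and k l :: nat assume "((A, k), (B, l)) \<in> ?Q"
    then show "A \<in> {I, J, K} \<and> B \<in> {I, J, K} \<and> k < 2 \<and> l < 2 \<and>
        double_point (curve E) (cis (\<tau> A k)) (cis (\<tau> B l)) \<and> cis (\<tau> B l) \<notin> over_pts E"
      using at dx dy dz over site_less_2 by (elim insertE) simp_all
  next
    fix A and k :: nat assume A: "A \<in> {I, J, K}" "k < 2"
    have "k = site m \<or> k = site (\<not> m)" for m
      using A(2) unfolding site_def by auto
    from this[of m1] this[of m2] this[of m3]
    show "(A, k) \<in> fst ` ?Q \<union> snd ` ?Q"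
      using A(1) by auto
  next
    show "(\<forall>I\<in>{I, J, K}. \<forall>k\<le>2. v I k \<in> X) \<and>
      (\<forall>((I, k), J, l)\<in>?Q. if cis (\<tau> I k) \<in> over_pts E
        then R (positive E (cis (\<tau> I k)) (cis (\<tau> J l))) (v J l) (v J (Suc l)) (v I k) (v I (Suc k))
        else v J l = v J (Suc l) \<and> v I k = v I (Suc k)) \<longleftrightarrow>
       triple_coloring X R c12 c13 c23 p12 p13 p23 m1 m2 m3 (v I) (v J) (v K)"
      unfolding triple_coloring_def
      by (simp only: ball_simps prod.case at over x(3) y(3) z(3)) blast
  qed
  then show thesis
    using that[OF bp c1 c2 c3] by blast
qed

end

text \<open>By continuity, as the diagrams agree outside the closed arcs.\<close>

lemma agree_outside_curve_endpoint:
  assumes ao: "agree_outside \<phi> \<I> D D'" and fin: "finite \<I>" and I: "I \<in> \<I>"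
    and diags: "is_diagram D" "is_diagram D'"
  shows "curve D' (cis (fst I)) = curve D (cis (fst I))" "curve D' (cis (snd I)) = curve D (cis (snd I))"
proof -
  note sys = agree_outside_arc_system[OF ao fin]
  have lim: "((\<lambda>h. curve E (cis (t + h))) \<longlongrightarrow> curve E (cis t)) (at 0)" if "is_diagram E" for E t
  proof -
    have "isCont (\<lambda>u. curve E (cis u)) t"
      using has_vector_derivative_continuous[OF diagram_has_velocity[OF that]] .
    then show ?thesis
      unfolding isCont_iff .
  qed
  then have lims: "((\<lambda>h. curve E (cis (t + h))) \<longlongrightarrow> curve E (cis t)) (at_left 0)"
    "((\<lambda>h. curve E (cis (t + h))) \<longlongrightarrow> curve E (cis t)) (at_right 0)" if "is_diagram E" for E t
    using that unfolding filterlim_at_split by blast+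
  have "eventually (\<lambda>h. curve D' (cis (fst I + h)) = curve D (cis (fst I + h))) (at_left 0)"
    using eventually_leave_arcs(2)[OF sys I]
    by eventually_elim (rule agree_outsideD(7)[OF ao cis_in_circle])
  then have "((\<lambda>h. curve D' (cis (fst I + h))) \<longlongrightarrow> curve D (cis (fst I))) (at_left 0)"
    using lims(1)[OF diags(1)] by (simp add: tendsto_cong)
  then show "curve D' (cis (fst I)) = curve D (cis (fst I))"
    using tendsto_unique[OF trivial_limit_at_left_real lims(1)[OF diags(2)]] by blast
  have "eventually (\<lambda>h. curve D' (cis (snd I + h)) = curve D (cis (snd I + h))) (at_right 0)"
    using eventually_leave_arcs(1)[OF sys I]
    by eventually_elim (rule agree_outsideD(7)[OF ao cis_in_circle])
  then have "((\<lambda>h. curve D' (cis (snd I + h))) \<longlongrightarrow> curve D (cis (snd I))) (at_right 0)"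
    using lims(2)[OF diags(1)] by (simp add: tendsto_cong)
  then show "curve D' (cis (snd I)) = curve D (cis (snd I))"
    using tendsto_unique[OF trivial_limit_at_right_real lims(2)[OF diags(2)]] by blast
qed

text \<open>The direction of a strand and the height of its left end can be read off from the two end points.\<close>

lemma strand_chart_ends_eq:
  assumes ch: "strand_chart \<phi> c I \<sigma> T g" and ch': "strand_chart \<phi> c' I \<sigma>' T' g'"
    and eq: "c' (cis (fst I)) = c (cis (fst I))" "c' (cis (snd I)) = c (cis (snd I))"
  shows "\<sigma>' = \<sigma>" "g' (-1) = g (-1)"
proof -
  have \<sigma>: "- \<sigma> \<in> {-1..1}" "\<sigma> \<in> {-1..1}" "- \<sigma>' \<in> {-1..1}" "\<sigma>' \<in> {-1..1}"
    using strand_chartD(1)[OF ch] strand_chartD(1)[OF ch'] by auto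
  have "Complex (- \<sigma>') (g' (- \<sigma>')) = \<phi> (c' (cis (T' (- \<sigma>'))))"
    by (rule strand_chartD(5)[OF ch' \<sigma>(3), symmetric])
  also have "\<dots> = \<phi> (c (cis (T (- \<sigma>))))"
    by (simp only: strand_chartD(2)[OF ch'] strand_chartD(2)[OF ch] eq)
  also have "\<dots> = Complex (- \<sigma>) (g (- \<sigma>))"
    by (rule strand_chartD(5)[OF ch \<sigma>(1)])
  finally have 1: "- \<sigma>' = - \<sigma> \<and> g' (- \<sigma>') = g (- \<sigma>)"
    unfolding complex.inject .
  have "Complex \<sigma>' (g' \<sigma>') = \<phi> (c' (cis (T' \<sigma>')))"
    by (rule strand_chartD(5)[OF ch' \<sigma>(4), symmetric])
  also have "\<dots> = \<phi> (c (cis (T \<sigma>)))"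
    by (simp only: strand_chartD(3)[OF ch'] strand_chartD(3)[OF ch] eq)
  also have "\<dots> = Complex \<sigma> (g \<sigma>)"
    by (rule strand_chartD(5)[OF ch \<sigma>(2)])
  finally have 2: "\<sigma>' = \<sigma> \<and> g' \<sigma>' = g \<sigma>"
    unfolding complex.inject .
  show "\<sigma>' = \<sigma>"
    using 2 by simp
  then show "g' (-1) = g (-1)"
    using 1 2 strand_chartD(1)[OF ch] by auto
qed

text \<open>Both diagrams have the same signs. So the orders of the crossings on the strands are
  either all the same or all opposite, and in the second case the triangles are exchanged.\<close>

lemma (in biquandle) card_colorings_reidemeister3:
  assumes diags: "is_diagram D" "is_diagram D'" and r3: "reidemeister3 D D'"
  shows "card (colorings X (crossing_rel ov un) D) = card (colorings X (crossing_rel ov un) D')"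
proof -
  obtain \<phi> I J K where dist: "distinct [I, J, K]" and ao: "agree_outside \<phi> {I, J, K} D D'"
    and E: "\<And>E L. E \<in> {D, D'} \<Longrightarrow> L \<in> {I, J, K} \<Longrightarrow> graph_strand \<phi> (curve E) L"
      "\<And>E. E \<in> {D, D'} \<Longrightarrow> card (crossings (curve E) I J) = 1 \<and> card (crossings (curve E) I K) = 1 \<and>
         card (crossings (curve E) J K) = 1"
    and modes: "(\<forall>E\<in>{D, D'}. strand_over E I J \<and> strand_over E I K \<and> strand_over E J K) \<or>
       (\<forall>E\<in>{D, D'}. strands_virtual E I J \<and> strands_virtual E I K \<and> strands_virtual E J K) \<or>
       (\<forall>E\<in>{D, D'}. strands_virtual E I J \<and> strands_virtual E I K \<and> strand_over E J K)"
    using r3 unfolding reidemeister3_def by blast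
  have fin: "finite {I, J, K}" by simp
  note sys = agree_outside_arc_system[OF ao fin]
  have orient: "oriented_plane_diffeo \<phi>"
    by (rule agree_outsideD(1)[OF ao])
  then have \<phi>: "plane_diffeo \<phi>"
    unfolding oriented_plane_diffeo_def by blast
  let ?triv = "\<lambda>x y :: 'x. x"
  \<comment> \<open>virtual crossings count as crossings with trivial operations\<close>
  obtain c12 c13 c23 where mode: "\<forall>E\<in>{D, D'}.
      strand_mode E I J c12 \<and> strand_mode E I K c13 \<and> strand_mode E J K c23"
    and yb: "yang_baxter X (if c12 then ov else ?triv) (if c12 then un else ?triv)
      (if c13 then ov else ?triv) (if c13 then un else ?triv) (if c23 then ov else ?triv) (if c23 then un else ?triv)"
    using modes
  proof (elim disjE)
    assume "\<forall>E\<in>{D, D'}. strand_over E I J \<and> strand_over E I K \<and> strand_over E J K"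
    then show thesis
      using that[of True True True] yang_baxter_classical unfolding strand_mode_def by simp
  next
    assume "\<forall>E\<in>{D, D'}. strands_virtual E I J \<and> strands_virtual E I K \<and> strands_virtual E J K"
    then show thesis
      using that[of False False False] yang_baxter_virtual[of X] unfolding strand_mode_def by simp
  next
    assume "\<forall>E\<in>{D, D'}. strands_virtual E I J \<and> strands_virtual E I K \<and> strand_over E J K"
    then show thesis
      using that[of False False True] yang_baxter_mixed unfolding strand_mode_def by simp
  qed
  interpret yang_baxter X "if c12 then ov else ?triv" "if c12 then un else ?triv"
    "if c13 then ov else ?triv" "if c13 then un else ?triv" "if c23 then ov else ?triv" "if c23 then un else ?triv"
    by (rule yb)
  have chart: "\<exists>\<sigma> T g. strand_chart \<phi> (curve E) L \<sigma> T g" if "E \<in> {D, D'}" "L \<in> {I, J, K}" for E L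
  proof (rule graph_strand_chart[OF \<phi> _ _ E(1)[OF that]])
    show "smooth (\<lambda>t::real. curve E (cis t))"
      using diags that(1) unfolding is_diagram_def generic_immersion_def by blast
    show "fst L < snd L"
      using sys that(2) unfolding arc_system_def by blast
  qed
  have triple: "strand_triple E \<phi> I J K \<sigma>I \<sigma>J \<sigma>K TI TJ TK gI gJ gK c12 c13 c23"
    if "E \<in> {D, D'}" "strand_chart \<phi> (curve E) I \<sigma>I TI gI" "strand_chart \<phi> (curve E) J \<sigma>J TJ gJ"
      "strand_chart \<phi> (curve E) K \<sigma>K TK gK" for E \<sigma>I \<sigma>J \<sigma>K TI TJ TK gI gJ gK
  proof
    show "is_diagram E"
      using diags that(1) by blast
    show "oriented_plane_diffeo \<phi>" "arc_system {I, J, K}"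
      by (fact orient, fact sys)
    show "I \<noteq> J" "I \<noteq> K" "J \<noteq> K"
      using dist by auto
    show "\<not> double_point (curve E) (cis (fst L)) q \<and> \<not> double_point (curve E) (cis (snd L)) q"
      if "L \<in> {I, J, K}" for L q
      using agree_outsideD(5,6)[OF ao \<open>E \<in> {D, D'}\<close> that] by blast
    show "\<exists>M\<in>{I, J, K}. q \<in> closed_arc M"
      if "L \<in> {I, J, K}" "p \<in> closed_arc L" "double_point (curve E) p q" for L p q
      using agree_outside_inside[OF ao \<open>E \<in> {D, D'}\<close> that(3,1,2)] open_arc_subset by blast
  qed (use that E(2) mode in blast)+
  obtain \<sigma>I TI gI where chI: "strand_chart \<phi> (curve D) I \<sigma>I TI gI" using chart[of D I] by blast
  obtain \<sigma>J TJ gJ where chJ: "strand_chart \<phi> (curve D) J \<sigma>J TJ gJ" using chart[of D J] by blast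
  obtain \<sigma>K TK gK where chK: "strand_chart \<phi> (curve D) K \<sigma>K TK gK" using chart[of D K] by blast
  obtain \<sigma>I' TI' gI' where chI': "strand_chart \<phi> (curve D') I \<sigma>I' TI' gI'" using chart[of D' I] by blast
  obtain \<sigma>J' TJ' gJ' where chJ': "strand_chart \<phi> (curve D') J \<sigma>J' TJ' gJ'" using chart[of D' J] by blast
  obtain \<sigma>K' TK' gK' where chK': "strand_chart \<phi> (curve D') K \<sigma>K' TK' gK'" using chart[of D' K] by blast
  note endpoint = agree_outside_curve_endpoint[OF ao fin _ diags]
  have same: "\<sigma>I' = \<sigma>I" "gI' (-1) = gI (-1)" "\<sigma>J' = \<sigma>J" "gJ' (-1) = gJ (-1)" "\<sigma>K' = \<sigma>K" "gK' (-1) = gK (-1)"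
    using strand_chart_ends_eq[OF chI chI'] strand_chart_ends_eq[OF chJ chJ'] strand_chart_ends_eq[OF chK chK']
      endpoint[of I] endpoint[of J] endpoint[of K] by simp_all
  interpret T: strand_triple D \<phi> I J K \<sigma>I \<sigma>J \<sigma>K TI TJ TK gI gJ gK c12 c13 c23
    by (rule triple) (use chI chJ chK in auto)
  interpret T': strand_triple D' \<phi> I J K \<sigma>I' \<sigma>J' \<sigma>K' TI' TJ' TK' gI' gJ' gK' c12 c13 c23
    by (rule triple) (use chI' chJ' chK' in auto)
  have p_eq: "T'.p12 = T.p12" "T'.p13 = T.p13" "T'.p23 = T.p23"
    unfolding T.p12_def T.p13_def T.p23_def T'.p12_def T'.p13_def T'.p23_def by (simp_all only: same)
  let ?R = "crossing_rel ov un"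
  have relations: "triple_coloring X ?R c12 c13 c23 q12 q13 q23 n1 n2 n3 a b c \<longleftrightarrow>
      (\<forall>k\<le>2. a k \<in> X \<and> b k \<in> X \<and> c k \<in> X) \<and> triple_relations q12 q13 q23 n1 n2 n3 a b c"
    for q12 q13 q23 n1 n2 n3 a b c
    unfolding triple_coloring_def triple_relations_def by (simp add: crossing_rel_trivial)
  obtain \<tau> m1 m2 m3 where bp: "breakpoints D {I, J, K} \<tau>"
    and c: "(m1 = T.p13) = (m2 = T.p23)" "(m1 = T.p12) = (m3 = T.p23)" "(m2 = T.p12) = (m3 = T.p13)"
    and sc0: "\<forall>X R v. strand_coloring X R D {I, J, K} \<tau> v \<longleftrightarrow>
       triple_coloring X R c12 c13 c23 T.p12 T.p13 T.p23 m1 m2 m3 (v I) (v J) (v K :: nat \<Rightarrow> 'x)"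
    by (rule T.local_structure)
  obtain \<tau>' m1' m2' m3' where bp': "breakpoints D' {I, J, K} \<tau>'"
    and c': "(m1' = T.p13) = (m2' = T.p23)" "(m1' = T.p12) = (m3' = T.p23)" "(m2' = T.p12) = (m3' = T.p13)"
    and sc0': "\<forall>X R v. strand_coloring X R D' {I, J, K} \<tau>' v \<longleftrightarrow>
       triple_coloring X R c12 c13 c23 T.p12 T.p13 T.p23 m1' m2' m3' (v I) (v J) (v K :: nat \<Rightarrow> 'x)"
    by (rule T'.local_structure[unfolded p_eq])
  have sc: "strand_coloring X ?R D {I, J, K} \<tau> v \<longleftrightarrow>
       (\<forall>k\<le>2. v I k \<in> X \<and> v J k \<in> X \<and> v K k \<in> X) \<and>
       triple_relations T.p12 T.p13 T.p23 m1 m2 m3 (v I) (v J) (v K)" for v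
    unfolding relations[symmetric] using sc0 by blast
  have sc': "strand_coloring X ?R D' {I, J, K} \<tau>' v \<longleftrightarrow>
       (\<forall>k\<le>2. v I k \<in> X \<and> v J k \<in> X \<and> v K k \<in> X) \<and>
       triple_relations T.p12 T.p13 T.p23 m1' m2' m3' (v I) (v J) (v K)" for v
    unfolding relations[symmetric] using sc0' by blast
  have transfer: "\<exists>w. (\<forall>k\<le>2. w I k \<in> X \<and> w J k \<in> X \<and> w K k \<in> X) \<and>
       triple_relations T.p12 T.p13 T.p23 n1' n2' n3' (w I) (w J) (w K) \<and>
       (\<forall>L\<in>{I, J, K}. w L 0 = v L 0 \<and> w L 2 = v L 2)"
    if "(n1 = T.p13) = (n2 = T.p23)" "(n1 = T.p12) = (n3 = T.p23)" "(n2 = T.p12) = (n3 = T.p13)"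
      "(n1' = T.p13) = (n2' = T.p23)" "(n1' = T.p12) = (n3' = T.p23)" "(n2' = T.p12) = (n3' = T.p13)"
      "\<forall>k\<le>2. v I k \<in> X \<and> v J k \<in> X \<and> v K k \<in> X" "triple_relations T.p12 T.p13 T.p23 n1 n2 n3 (v I) (v J) (v K)"
    for n1 n2 n3 n1' n2' n3' v
  proof -
    note t = that
    obtain x y z where xyz: "x \<in> X" "y \<in> X" "z \<in> X"
      "triple_relations T.p12 T.p13 T.p23 n1' n2' n3' ((v I)(1 := x)) ((v J)(1 := y)) ((v K)(1 := z))"
      using triple_relations_transfer[OF t] by blast
    define w where "w L = (v L)(1 := if L = I then x else if L = J then y else z)" for L
    have "w I = (v I)(1 := x)" "w J = (v J)(1 := y)" "w K = (v K)(1 := z)"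
      using dist unfolding w_def by auto
    then show ?thesis
      using xyz t(7) by (intro exI[of _ w]) (auto simp: w_def)
  qed
  show ?thesis
  proof (rule card_colorings_tangle[OF ao fin bp bp'])
    show "ends_extend X ?R {I, J, K} D \<tau> D' \<tau>'"
      unfolding ends_extend_def sc sc' using transfer[OF c c'] by blast
    show "ends_extend X ?R {I, J, K} D' \<tau>' D \<tau>"
      unfolding ends_extend_def sc sc' using transfer[OF c' c] by blast
    show "determined_by_ends X ?R D {I, J, K} \<tau>"
      unfolding determined_by_ends_def sc
    proof (intro allI impI)
      fix v w
      assume "(\<forall>k\<le>2. v I k \<in> X \<and> v J k \<in> X \<and> v K k \<in> X) \<and>
          triple_relations T.p12 T.p13 T.p23 m1 m2 m3 (v I) (v J) (v K)"
        "(\<forall>k\<le>2. w I k \<in> X \<and> w J k \<in> X \<and> w K k \<in> X) \<and>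
          triple_relations T.p12 T.p13 T.p23 m1 m2 m3 (w I) (w J) (w K)"
        "\<forall>L\<in>{I, J, K}. v L 0 = w L 0 \<and> v L 2 = w L 2"
      then show "\<forall>L\<in>{I, J, K}. v L 1 = w L 1"
        using triple_relations_unique[OF c, of "v I" "v J" "v K" "w I" "w J" "w K"] by auto
    qed
    show "determined_by_ends X ?R D' {I, J, K} \<tau>'"
      unfolding determined_by_ends_def sc'
    proof (intro allI impI)
      fix v w
      assume "(\<forall>k\<le>2. v I k \<in> X \<and> v J k \<in> X \<and> v K k \<in> X) \<and>
          triple_relations T.p12 T.p13 T.p23 m1' m2' m3' (v I) (v J) (v K)"
        "(\<forall>k\<le>2. w I k \<in> X \<and> w J k \<in> X \<and> w K k \<in> X) \<and>
          triple_relations T.p12 T.p13 T.p23 m1' m2' m3' (w I) (w J) (w K)"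
        "\<forall>L\<in>{I, J, K}. v L 0 = w L 0 \<and> v L 2 = w L 2"
      then show "\<forall>L\<in>{I, J, K}. v L 1 = w L 1"
        using triple_relations_unique[OF c', of "v I" "v J" "v K" "w I" "w J" "w K"] by auto
    qed
  qed
qed

section \<open>Invariance and the bound\<close>

lemma (in biquandle) card_colorings_move:
  assumes "finite X" "move D D'"
  shows "card (colorings X (crossing_rel ov un) D) = card (colorings X (crossing_rel ov un) D')"
  using assms card_colorings_planar_isotopic card_colorings_reparametrized
    card_colorings_reidemeister1 card_colorings_reidemeister2 card_colorings_reidemeister3
  unfolding move_def by blast

lemma (in biquandle) card_colorings_equivalent:
  assumes "finite X" "equivclp move D D'"
  shows "card (colorings X (crossing_rel ov un) D) = card (colorings X (crossing_rel ov un) D')"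
  using assms(2)
proof (induction rule: equivclp_induct)
  case (step y z)
  then show ?case
    using card_colorings_move[OF assms(1)] by metis
qed simp

lemma virtual_knotD:
  assumes K: "K \<in> virtual_knots"
  shows "D \<in> K \<Longrightarrow> is_diagram D" "D \<in> K \<Longrightarrow> D' \<in> K \<Longrightarrow> equivclp move D D'"
    "D \<in> K \<Longrightarrow> move D D' \<Longrightarrow> D' \<in> K" "K \<noteq> {}"
proof -
  let ?r = "{(D, D'). is_diagram D \<and> is_diagram D' \<and> equivclp move D D'}"
  obtain C where C: "is_diagram C" "K = ?r `` {C}"
    using K unfolding virtual_knots_def by (auto elim: quotientE)
  then have K_eq: "K = {D. is_diagram D \<and> equivclp move C D}"
    by auto
  show "D \<in> K \<Longrightarrow> is_diagram D"
    unfolding K_eq by blast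
  show "D \<in> K \<Longrightarrow> D' \<in> K \<Longrightarrow> equivclp move D D'"
    unfolding K_eq by (blast intro: equivclp_trans equivclp_sym)
  show "D \<in> K \<Longrightarrow> move D D' \<Longrightarrow> D' \<in> K"
    unfolding K_eq by (auto intro: equivclp_into_equivclp simp: move_def)
  show "K \<noteq> {}"
    unfolding K_eq using C(1) by auto
qed

text \<open>The minimum defining \<^const>\<open>b2\<close> is taken over a nonempty set.\<close>

lemma b2_attained:
  assumes K: "K \<in> virtual_knots"
  obtains D where "D \<in> K" "morse_position D" "card (local_maxima D) = b2 K"
proof -
  obtain D where D: "D \<in> K"
    using virtual_knotD(4)[OF K] by blast
  then obtain D' where D': "is_diagram D'" "planar_isotopic D D'" "morse_position D'"
    using morse_position_exists[OF virtual_knotD(1)[OF K]] by blast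
  then have "move D D'"
    unfolding move_def using virtual_knotD(1)[OF K D] by blast
  then have "D' \<in> K"
    by (rule virtual_knotD(3)[OF K D])
  then have "\<exists>m. \<exists>D\<in>K. morse_position D \<and> card (local_maxima D) = m"
    using D'(3) by blast
  from LeastI_ex[OF this] show thesis
    using that unfolding b2_def by blast
qed

theorem proposition3p1:
  fixes X :: "'x set" and ov un :: "'x \<Rightarrow> 'x \<Rightarrow> 'x" and n :: nat and K :: "vdiagram set"
  assumes "biquandle X ov un" and "finite X" and "card X = n"
    and "K \<in> virtual_knots"
  shows "(\<forall>D\<in>K. n ^ b2 K \<ge> card (labelings X ov un D)) \<and>
         (\<forall>col. (\<forall>D\<in>K. card (labelings_both_in X ov un D) = col) \<longrightarrow> n ^ b2 K \<ge> col)"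
proof -
  interpret biquandle X ov un by (rule assms(1))
  obtain B where B: "B \<in> K" "morse_position B" "card (local_maxima B) = b2 K"
    by (rule b2_attained[OF assms(4)])
  note diag = virtual_knotD(1)[OF assms(4)]
  have bound: "card (labelings_by X R B) \<le> n ^ b2 K" if "corner_determined X R" for R
    using card_colorings_le[OF diag[OF B(1)] B(2) that assms(2)]
    unfolding card_labelings_by_eq[OF finite_crossing_points[OF diag[OF B(1)]]] B(3) assms(3) .
  show ?thesis
  proof (intro conjI ballI allI impI)
    fix D assume D: "D \<in> K"
    have "card (labelings X ov un D) = card (labelings_by X (crossing_rel ov un) B)"
      unfolding labelings_eq card_labelings_by_eq[OF finite_crossing_points[OF diag[OF D]]]
        card_labelings_by_eq[OF finite_crossing_points[OF diag[OF B(1)]]]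
      by (rule card_colorings_equivalent[OF assms(2) virtual_knotD(2)[OF assms(4) D B(1)]])
    also have "\<dots> \<le> n ^ b2 K"
      by (rule bound[OF crossing_rel_corner_determined[OF switch_ops_biquandle]])
    finally show "card (labelings X ov un D) \<le> n ^ b2 K" .
  next
    fix col assume "\<forall>D\<in>K. card (labelings_both_in X ov un D) = col"
    then have "col = card (labelings_by X (crossing_rel_both_in ov un) B)"
      using B(1) unfolding labelings_both_in_eq by simp
    also have "\<dots> \<le> n ^ b2 K"
      by (rule bound[OF crossing_rel_both_in_corner_determined[OF switch_ops_biquandle]])
    finally show "col \<le> n ^ b2 K" .
  qed
qed

end
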